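(* Let $i\ge0$ be an integer and let $\mathcal I=(I_n)_{n\ge1}$ be an $\mathrm{Inc}^i$-invariant chain of proper monomial ideals $I_n\subsetneq R_n$. Let $r\ge\mathrm{ind}^i(\mathcal I)$ and denote by $\mathcal M$ the set of all subsets $M$ of $G_i(I_r)$ such that $v_M$ is not divisible by any element of $G_i^-(I_r)$. Then there exists an integer $\tilde D(\mathcal I)$ such that $$\operatorname{pd}I_n\ge\max\{\gamma_i(\mathcal I:v_M)\mid M\in\mathcal M\}\,n+\tilde D(\mathcal I)\quad\text{for all } n\gg0 .$$
   Context: Fix an integer $c\ge 1$ and a field $K$; let $\mathbb N$ be the set of positive integers and $[c]=\{1,\dots,c\}$. For $n\ge1$ let $R_n=K[x_{k,j}\mid 1\le k\le c,\ 1\le j\le n]$ and $R=\bigcup_{n\ge1}R_n$. For an integer $i\ge0$ let $\mathrm{Inc}^i$ be the monoid of all strictly increasing maps $\pi:\mathbb N\to\mathbb N$ with $\pi(j)=j$ for all $j\le i$; it acts on $R$ by $K$-algebra endomorphisms via $\pi\cdot x_{k,j}=x_{k,\pi(j)}$. For $m\le n$ put $\mathrm{Inc}^i_{m,n}=\{\pi\in\mathrm{Inc}^i\mid \pi(m)\le n\}$. A chain $\mathcal I=(I_n)_{n\ge1}$ of ideals $I_n\subseteq R_n$ is $\mathrm{Inc}^i$-invariant if $\pi(f)\in I_n$ for all $m\le n$, $f\in I_m$, $\pi\in\mathrm{Inc}^i_{m,n}$. For such a chain there is an integer $r\ge1$ such that for all $n\ge r$ the ideal $I_n$ of $R_n$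 is generated by $\{\pi(f)\mid f\in I_r,\ \pi\in\mathrm{Inc}^i_{r,n}\}$ (known); the least such $r$ is denoted $\mathrm{ind}^i(\mathcal I)$. For a monomial $u\ne1$, $\min(u)$ (resp. $\max(u)$) is the smallest (resp. largest) index $j$ such that some $x_{k,j}$ divides $u$; by convention the conditions $\max(u)\le i$ and $\min(u)>i$ are regarded as satisfied by $u=1$ when $u$ is a factor in a factorization. For a proper monomial ideal $J\subsetneq R_n$ with minimal set of monomial generators $G(J)$, let $G_i^+(J)=\{u\in G(J)\mid \min(u)>i\}$, $G_i(J)=\{u\in G(J)\mid \min(u)\le i<\max(u)\}$, $G_i^-(J)=\{u\in G(J)\mid \max(u)\le i\}$. A set $C\subseteq[c]$ covers a monomial $u$ if there is $k\in C$ such that $x_{k,j}$ divides $u$ for some $j\ge1$; $C$ is an $i$-cover of $J$ if it covers every element of $G_i^+(J)$. Put $\gamma_i(J)=\min\{\#C\mid C\text{ is an }i\text{-cover of }J\}$, and $\gamma_i(R_n)=\infty$. For an $\mathrm{Inc}^i$-invariant chain $\mathcal J=(J_n)_{n\ge1}$ of monomial ideals, $\gamma_i(J_n)$ is the same for all $n\ge\mathrm{ind}^i(\mathcal J)$, and $\gamma_i(\mathcal J)$ denotes this common value. Every $u\in G_i(I_r)$ is written uniquely as $u=u_1u_2$ with monomials $u_1,u_2$ such that $\max(u_1)\le i$ and $\min(u_2)>i$. For $M\subseteq G_i(I_r)$ put $v_M=\prod_{u\in M}u_1$ (so $v_\emptyset=1$), and let $\mathcal I:v_M$ be the chain $(I_n:v_M)_{n\ge1}$,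 which is an $\mathrm{Inc}^i$-invariant chain with $\mathrm{ind}^i(\mathcal I:v_M)\le\mathrm{ind}^i(\mathcal I)$ (only $n\ge r$ matters here, for which $v_M\in R_n$; thus $\gamma_i(\mathcal I:v_M)=\gamma_i(I_n:v_M)$ for $n\ge r$). $\operatorname{pd} I_n$ is the projective dimension of $I_n$ as an $R_n$-module, so $\operatorname{pd}I_n=\operatorname{pd}(R_n/I_n)-1$; for $I_n=0$ this is read as $-1$. *)

theory Defs
  imports
    "HOL-Algebra.Module"
    "HOL-Algebra.Ideal"
    "HOL-Library.Poly_Mapping"
    "HOL-Library.Extended_Real"
begin

section \<open>Projective dimension of modules over a commutative ring\<close>

definition mod_hom ::
  "('r, 'x) ring_scheme \<Rightarrow> ('r, 'm, 'y) module_scheme \<Rightarrow> ('r, 'n, 'z) module_scheme \<Rightarrow> ('m \<Rightarrow> 'n) set"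
  where
  "mod_hom R M N =
    {h \<in> carrier M \<rightarrow> carrier N.
      (\<forall>x\<in>carrier M. \<forall>y\<in>carrier M. h (x \<oplus>\<^bsub>M\<^esub> y) = h x \<oplus>\<^bsub>N\<^esub> h y) \<and>
      (\<forall>a\<in>carrier R. \<forall>x\<in>carrier M. h (a \<odot>\<^bsub>M\<^esub> x) = a \<odot>\<^bsub>N\<^esub> h x)}"

definition mod_ker :: "('r, 'm, 'y) module_scheme \<Rightarrow> ('r, 'n, 'z) module_scheme \<Rightarrow> ('m \<Rightarrow> 'n) \<Rightarrow> 'm set"
  where "mod_ker M N h = {x \<in> carrier M. h x = \<zero>\<^bsub>N\<^esub>}"

text \<open>The free module with basis \<open>X\<close>: finitely supported functions on \<open>X\<close>, extended by zero.
  The fields \<^const>\<open>mult\<close> and \<^const>\<open>one\<close> of a module record play no role.\<close>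

definition free_mod :: "('r, 'x) ring_scheme \<Rightarrow> 'i set \<Rightarrow> ('r, 'i \<Rightarrow> 'r) module" where
  "free_mod R X =
    \<lparr>carrier = {f. range f \<subseteq> carrier R \<and> finite {i. f i \<noteq> \<zero>\<^bsub>R\<^esub>} \<and> {i. f i \<noteq> \<zero>\<^bsub>R\<^esub>} \<subseteq> X},
     mult = undefined, one = undefined,
     zero = (\<lambda>i. \<zero>\<^bsub>R\<^esub>),
     add = (\<lambda>f g i. f i \<oplus>\<^bsub>R\<^esub> g i),
     smult = (\<lambda>a f i. a \<otimes>\<^bsub>R\<^esub> f i)\<rparr>"

text \<open>A module is projective if it is a direct summand of a free module. Basis sets \<open>X\<close> in the
  element type of \<open>P\<close> suffice, because a projective \<open>P\<close> is a direct summand of the free module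
  with basis \<open>carrier P\<close>.\<close>

definition projective_mod :: "('r, 'x) ring_scheme \<Rightarrow> ('r, 'p, 'y) module_scheme \<Rightarrow> bool" where
  "projective_mod R P \<longleftrightarrow>
    Module.module R P \<and>
    (\<exists>X :: 'p set. \<exists>s \<in> mod_hom R P (free_mod R X). \<exists>q \<in> mod_hom R (free_mod R X) P.
       \<forall>x\<in>carrier P. q (s x) = x)"

text \<open>\<open>\<dots> \<rightarrow> P 1 \<rightarrow> P 0 \<rightarrow> M \<rightarrow> 0\<close> is exact with all \<open>P k\<close> projective and
  \<open>P k = 0\<close> for \<open>k > d\<close>; here \<open>\<epsilon> : P 0 \<rightarrow> M\<close> and \<open>\<delta> k : P (Suc k) \<rightarrow> P k\<close>.\<close>

definition proj_resolution ::
  "('r, 'x) ring_scheme \<Rightarrow> ('r, 'm, 'y) module_scheme \<Rightarrow> nat \<Rightarrow>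
    (nat \<Rightarrow> ('r, 'p) module) \<Rightarrow> ('p \<Rightarrow> 'm) \<Rightarrow> (nat \<Rightarrow> 'p \<Rightarrow> 'p) \<Rightarrow> bool"
  where
  "proj_resolution R M d P \<epsilon> \<delta> \<longleftrightarrow>
    (\<forall>k. projective_mod R (P k)) \<and>
    (\<forall>k>d. carrier (P k) = {\<zero>\<^bsub>P k\<^esub>}) \<and>
    \<epsilon> \<in> mod_hom R (P 0) M \<and>
    (\<forall>k. \<delta> k \<in> mod_hom R (P (Suc k)) (P k)) \<and>
    \<epsilon> ` carrier (P 0) = carrier M \<and>
    \<delta> 0 ` carrier (P 1) = mod_ker (P 0) M \<epsilon> \<and>
    (\<forall>k. \<delta> (Suc k) ` carrier (P (Suc (Suc k))) = mod_ker (P (Suc k)) (P k) (\<delta> k))"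

text \<open>The zero module has projective dimension \<open>-1\<close>. The modules of a resolution have their
  elements in the type \<open>nat \<times> 'r \<times> 'm\<close>. This is no restriction: starting with the free module
  on \<open>carrier M\<close> and continuing with free modules on the successive kernels, all modules occurring
  have cardinality at most that of this type, and so does the kernel which, by Schanuel's lemma, is
  projective and ends the resolution; module structures can be transported along injections.\<close>

definition proj_dim :: "('r, 'x) ring_scheme \<Rightarrow> ('r, 'm, 'y) module_scheme \<Rightarrow> ereal" where
  "proj_dim R M =
    (if carrier M = {\<zero>\<^bsub>M\<^esub>} then -1
     else Inf {ereal (real d) | d.
       \<exists>(P :: nat \<Rightarrow> ('r, nat \<times> 'r \<times> 'm) module) \<epsilon> \<delta>. proj_resolution R M d P \<epsilon> \<delta>})"

definition ideal_mod :: "('r, 'x) ring_scheme \<Rightarrow> 'r set \<Rightarrow> ('r, 'r) module" where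
  "ideal_mod R J =
    \<lparr>carrier = J, mult = mult R, one = one R, zero = zero R, add = add R, smult = mult R\<rparr>"


section \<open>The polynomial rings\<close>

text \<open>The pair \<open>(k, j)\<close> stands for the variable \<open>x\<^bsub>k,j\<^esub>\<close>. The type contains further variables
  (\<open>k\<close> or \<open>j\<close> zero, or \<open>k > c\<close>), which do not occur in elements of the rings \<open>Rn c n\<close>.\<close>

type_synonym mon = "(nat \<times> nat) \<Rightarrow>\<^sub>0 nat"
type_synonym 'k pol = "mon \<Rightarrow>\<^sub>0 'k"

definition Rn_set :: "nat \<Rightarrow> nat \<Rightarrow> ('k::field) pol set" where
  "Rn_set c n = {f. \<forall>a\<in>Poly_Mapping.keys f. Poly_Mapping.keys a \<subseteq> {1..c} \<times> {1..n}}"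

definition Rn :: "nat \<Rightarrow> nat \<Rightarrow> ('k::field) pol ring" where
  "Rn c n = \<lparr>carrier = Rn_set c n, mult = (*), one = 1, zero = 0, add = (+)\<rparr>"

definition var :: "nat \<Rightarrow> nat \<Rightarrow> ('k::field) pol" where
  "var k j = Poly_Mapping.single (Poly_Mapping.single (k, j) 1) 1"

text \<open>Monomials are regarded as polynomials, so that divisibility is \<^term>\<open>(dvd)\<close>.\<close>

definition monomials :: "('k::field) pol set" where
  "monomials = {Poly_Mapping.single a 1 | a. True}"

definition mon_min :: "('k::field) pol \<Rightarrow> nat" where
  "mon_min u = Min {j. \<exists>k. var k j dvd u}"

definition mon_max :: "('k::field) pol \<Rightarrow> nat" where
  "mon_max u = Max {j. \<exists>k. var k j dvd u}"

definition monomial_ideal :: "nat \<Rightarrow> nat \<Rightarrow> ('k::field) pol set \<Rightarrow> bool" where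
  "monomial_ideal c n J \<longleftrightarrow>
    ideal J (Rn c n) \<and> (\<exists>S \<subseteq> monomials \<inter> Rn_set c n. J = Idl\<^bsub>Rn c n\<^esub> S)"

definition min_gens :: "nat \<Rightarrow> nat \<Rightarrow> ('k::field) pol set \<Rightarrow> 'k pol set" where
  "min_gens c n J =
    (THE G. G \<subseteq> monomials \<inter> Rn_set c n \<and> Idl\<^bsub>Rn c n\<^esub> G = J \<and>
       (\<forall>H. H \<subset> G \<longrightarrow> Idl\<^bsub>Rn c n\<^esub> H \<noteq> J))"


section \<open>Increasing maps and invariant chains\<close>

text \<open>Maps of the positive integers; the value at \<open>0\<close> is irrelevant.\<close>

definition Inc :: "nat \<Rightarrow> (nat \<Rightarrow> nat) set" where
  "Inc i = {\<pi>. \<pi> ` {1..} \<subseteq> {1..} \<and> strict_mono_on {1..} \<pi> \<and> (\<forall>j\<in>{1..i}. \<pi> j = j)}"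

definition Inc_mn :: "nat \<Rightarrow> nat \<Rightarrow> nat \<Rightarrow> (nat \<Rightarrow> nat) set" where
  "Inc_mn i m n = {\<pi> \<in> Inc i. \<pi> m \<le> n}"

text \<open>The \<open>K\<close>-algebra endomorphism with \<open>x\<^bsub>k,j\<^esub> \<mapsto> x\<^bsub>k,\<pi>(j)\<^esub>\<close>\<close>

definition act :: "(nat \<Rightarrow> nat) \<Rightarrow> ('k::field) pol \<Rightarrow> 'k pol" where
  "act \<pi> f = (\<Sum>a\<in>Poly_Mapping.keys f. Poly_Mapping.single 0 (Poly_Mapping.lookup f a) *
                 (\<Prod>(k, j)\<in>Poly_Mapping.keys a. var k (\<pi> j) ^ Poly_Mapping.lookup a (k, j)))"

text \<open>Chains are indexed by \<open>n \<ge> 1\<close>; the entry at \<open>0\<close> is irrelevant.\<close>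

definition Inc_invariant_chain :: "nat \<Rightarrow> nat \<Rightarrow> (nat \<Rightarrow> ('k::field) pol set) \<Rightarrow> bool" where
  "Inc_invariant_chain c i I \<longleftrightarrow>
    (\<forall>n\<ge>1. ideal (I n) (Rn c n)) \<and>
    (\<forall>m n f \<pi>. 1 \<le> m \<and> m \<le> n \<and> f \<in> I m \<and> \<pi> \<in> Inc_mn i m n \<longrightarrow> act \<pi> f \<in> I n)"

definition Inc_ind :: "nat \<Rightarrow> nat \<Rightarrow> (nat \<Rightarrow> ('k::field) pol set) \<Rightarrow> nat" where
  "Inc_ind c i I =
    (LEAST r. r \<ge> 1 \<and> (\<forall>n\<ge>r. I n = Idl\<^bsub>Rn c n\<^esub> {act \<pi> f | \<pi> f. f \<in> I r \<and> \<pi> \<in> Inc_mn i r n}))"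


section \<open>Covers\<close>

definition gens_pos :: "nat \<Rightarrow> nat \<Rightarrow> nat \<Rightarrow> ('k::field) pol set \<Rightarrow> 'k pol set" where
  "gens_pos c n i J = {u \<in> min_gens c n J. mon_min u > i}"

definition gens_mid :: "nat \<Rightarrow> nat \<Rightarrow> nat \<Rightarrow> ('k::field) pol set \<Rightarrow> 'k pol set" where
  "gens_mid c n i J = {u \<in> min_gens c n J. mon_min u \<le> i \<and> i < mon_max u}"

definition gens_neg :: "nat \<Rightarrow> nat \<Rightarrow> nat \<Rightarrow> ('k::field) pol set \<Rightarrow> 'k pol set" where
  "gens_neg c n i J = {u \<in> min_gens c n J. mon_max u \<le> i}"

definition covers :: "nat set \<Rightarrow> ('k::field) pol \<Rightarrow> bool" where
  "covers C u \<longleftrightarrow> (\<exists>k\<in>C. \<exists>j\<ge>1. var k j dvd u)"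

definition i_cover :: "nat \<Rightarrow> nat \<Rightarrow> nat \<Rightarrow> ('k::field) pol set \<Rightarrow> nat set \<Rightarrow> bool" where
  "i_cover c n i J C \<longleftrightarrow> C \<subseteq> {1..c} \<and> (\<forall>u\<in>gens_pos c n i J. covers C u)"

definition gamma :: "nat \<Rightarrow> nat \<Rightarrow> nat \<Rightarrow> ('k::field) pol set \<Rightarrow> enat" where
  "gamma c n i J =
    (if J = Rn_set c n then \<infinity> else enat (Min {card C | C. i_cover c n i J C}))"

definition gamma_chain :: "nat \<Rightarrow> nat \<Rightarrow> (nat \<Rightarrow> ('k::field) pol set) \<Rightarrow> enat" where
  "gamma_chain c i J = (THE g. \<forall>n \<ge> Inc_ind c i J. gamma c n i (J n) = g)"


section \<open>The colon chains\<close>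

text \<open>The factor \<open>u\<^sub>1\<close> of the factorization \<open>u = u\<^sub>1 u\<^sub>2\<close> with \<open>max(u\<^sub>1) \<le> i < min(u\<^sub>2)\<close>\<close>

definition lower_part :: "nat \<Rightarrow> ('k::field) pol \<Rightarrow> 'k pol" where
  "lower_part i u =
    (THE u1. u1 \<in> monomials \<and> (u1 = 1 \<or> mon_max u1 \<le> i) \<and>
       (\<exists>u2\<in>monomials. (u2 = 1 \<or> mon_min u2 > i) \<and> u = u1 * u2))"

definition v_prod :: "nat \<Rightarrow> ('k::field) pol set \<Rightarrow> 'k pol" where
  "v_prod i M = (\<Prod>u\<in>M. lower_part i u)"

text \<open>If \<open>v\<close> is a monomial outside \<open>Rn c n\<close>, the \<open>n\<close>-th ideal of this chain is zero; this happens
  only for small \<open>n\<close>.\<close>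

definition colon_chain :: "nat \<Rightarrow> (nat \<Rightarrow> ('k::field) pol set) \<Rightarrow> 'k pol \<Rightarrow> nat \<Rightarrow> 'k pol set" where
  "colon_chain c I v n = {f \<in> Rn_set c n. f * v \<in> I n}"

definition M_family :: "nat \<Rightarrow> nat \<Rightarrow> nat \<Rightarrow> (nat \<Rightarrow> ('k::field) pol set) \<Rightarrow> 'k pol set set" where
  "M_family c i r I =
    {M. M \<subseteq> gens_mid c r i (I r) \<and> \<not> (\<exists>w\<in>gens_neg c r i (I r). w dvd v_prod i M)}"

end

theory Submission
  imports Defs "HOL-Library.Sublist"
begin

text \<open>Let \<open>v = v\<^sub>M\<close> and let \<open>\<gamma>\<close> be the covering number of the colon chain by \<open>v\<close>. Among the
  monomials outside \<open>I\<^sub>n\<close> that are multiples of \<open>v\<close> and have bounded exponents, take one, \<open>w\<close>, of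
  maximal degree. The set \<open>A\<close> of variables \<open>x\<close> with \<open>x w \<in> I\<^sub>n\<close> is then a vertex cover of the
  generators of \<open>I\<^sub>n : v\<close> supported in the columns beyond \<open>i\<close>. A column of \<open>A\<close> with fewer than
  \<open>\<gamma>\<close> elements misses such a generator \<open>f\<close>; if many columns had the same such shape, some
  increasing map would move \<open>f\<close> into them, off \<open>A\<close>. So all but boundedly many columns of \<open>A\<close>
  have at least \<open>\<gamma>\<close> elements.
  Finally, \<open>w\<close> is a socle element of \<open>R\<^sub>n / I\<^sub>n\<close> with respect to the regular sequence \<open>A\<close>, which
  forces \<open>pd I\<^sub>n \<ge> #A - 1\<close>: along a projective resolution each syzygy module gains one variable of
  regularity and keeps a socle element modulo one more variable.

  That the stability index of a chain is attained follows from Higman's lemma, applied to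
  monomials regarded as words of columns.\<close>

section \<open>Regular sequences and projective resolutions\<close>

text \<open>The choice of \<open>M\<close> enters through two facts: \<open>v\<close> involves only
  the first \<open>i\<close> columns, so every map in \<open>Inc i\<close> fixes it and moves a
  product \<open>f * v\<close> through \<open>f\<close> alone; and \<open>v\<close> lies in no
  \<open>I n\<close>. The exponent bound must dominate the exponents of the finitely many chosen
  generators: a variable outside \<open>A\<close> then occurs in a maximal \<open>w\<close> often
  enough that a generator moved off \<open>A\<close>, times \<open>v\<close>, would divide
  \<open>w\<close>. The generators are fixed at one level \<open>m\<close>, so the loss does not
  depend on \<open>n\<close>: at most \<open>m\<close> columns for each of at most
  \<open>2 ^ c\<close> shapes, each losing at most \<gamma>. In terms of Tor, \<open>w\<close>
  represents a nonzero class in the top Koszul homology of R/J with respect to \<open>A\<close>,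
  which is Tor of degree #A of R/(A) and R/J. The argument with syzygies writes out the connecting
  maps that carry this class along a resolution. Covering numbers of a colon chain are read off at
  its own stability index, so stabilization is needed for the colon chains as well as for the given
  chain.\<close>

fun seq_sub :: "('r, 'm, 'y) module_scheme \<Rightarrow> (nat \<Rightarrow> 'r) \<Rightarrow> nat \<Rightarrow> 'm set" where
  "seq_sub N x 0 = {\<zero>\<^bsub>N\<^esub>}"
| "seq_sub N x (Suc l) = {(x l \<odot>\<^bsub>N\<^esub> p) \<oplus>\<^bsub>N\<^esub> q | p q. p \<in> carrier N \<and> q \<in> seq_sub N x l}"

text \<open>Since \<open>seq_sub N x l\<close> is the submodule (x 0, ..., x (l - 1)) N, this is
  weak regularity: the quotient by the whole sequence may vanish, so the zero modules at the end of
  a resolution qualify.\<close>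

definition seq_regular :: "('r, 'm, 'y) module_scheme \<Rightarrow> (nat \<Rightarrow> 'r) \<Rightarrow> nat \<Rightarrow> bool" where
  "seq_regular N x j \<longleftrightarrow>
    (\<forall>l<j. \<forall>m\<in>carrier N. x l \<odot>\<^bsub>N\<^esub> m \<in> seq_sub N x l \<longrightarrow> m \<in> seq_sub N x l)"

context Module.module
begin

lemma seq_sub_carrier:
  assumes "\<forall>t. x t \<in> carrier R" and "m \<in> seq_sub M x l"
  shows "m \<in> carrier M"
  using assms(2)
proof (induction l arbitrary: m)
  case 0
  then show ?case by simp
next
  case (Suc l)
  then obtain p q where "m = x l \<odot>\<^bsub>M\<^esub> p \<oplus>\<^bsub>M\<^esub> q" "p \<in> carrier M" "q \<in> seq_sub M x l"
    by auto
  with Suc.IH assms(1) show ?case by simp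
qed

lemma seq_sub_zero: "\<forall>t. x t \<in> carrier R \<Longrightarrow> \<zero>\<^bsub>M\<^esub> \<in> seq_sub M x l"
proof (induction l)
  case 0
  then show ?case by simp
next
  case (Suc l)
  have "\<zero>\<^bsub>M\<^esub> = x l \<odot>\<^bsub>M\<^esub> \<zero>\<^bsub>M\<^esub> \<oplus>\<^bsub>M\<^esub> \<zero>\<^bsub>M\<^esub>"
    using Suc.prems by simp
  moreover have "\<zero>\<^bsub>M\<^esub> \<in> seq_sub M x l" using Suc by blast
  ultimately show ?case unfolding seq_sub.simps by blast
qed

lemma seq_sub_add:
  assumes x: "\<forall>t. x t \<in> carrier R" and "m \<in> seq_sub M x l" "m' \<in> seq_sub M x l"
  shows "m \<oplus>\<^bsub>M\<^esub> m' \<in> seq_sub M x l"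
  using assms(2,3)
proof (induction l arbitrary: m m')
  case 0
  then show ?case by simp
next
  case (Suc l)
  then obtain p q p' q' where
    1: "m = x l \<odot>\<^bsub>M\<^esub> p \<oplus>\<^bsub>M\<^esub> q" "p \<in> carrier M" "q \<in> seq_sub M x l" and
    2: "m' = x l \<odot>\<^bsub>M\<^esub> p' \<oplus>\<^bsub>M\<^esub> q'" "p' \<in> carrier M" "q' \<in> seq_sub M x l"
    by auto
  have q: "q \<in> carrier M" "q' \<in> carrier M" using 1 2 x seq_sub_carrier by blast+
  have "m \<oplus>\<^bsub>M\<^esub> m' = x l \<odot>\<^bsub>M\<^esub> (p \<oplus>\<^bsub>M\<^esub> p') \<oplus>\<^bsub>M\<^esub> (q \<oplus>\<^bsub>M\<^esub> q')"
    using 1 2 q x by (simp add: smult_r_distr M.a_ac)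
  moreover have "q \<oplus>\<^bsub>M\<^esub> q' \<in> seq_sub M x l" using Suc.IH 1 2 by blast
  ultimately show ?case using 1 2 by auto
qed

lemma seq_sub_smult:
  assumes x: "\<forall>t. x t \<in> carrier R" and a: "a \<in> carrier R" and "m \<in> seq_sub M x l"
  shows "a \<odot>\<^bsub>M\<^esub> m \<in> seq_sub M x l"
  using assms(3)
proof (induction l arbitrary: m)
  case 0
  then show ?case using a by simp
next
  case (Suc l)
  then obtain p q where
    1: "m = x l \<odot>\<^bsub>M\<^esub> p \<oplus>\<^bsub>M\<^esub> q" "p \<in> carrier M" "q \<in> seq_sub M x l"
    by auto
  have q: "q \<in> carrier M" using 1 x seq_sub_carrier by blast
  have "a \<odot>\<^bsub>M\<^esub> m = x l \<odot>\<^bsub>M\<^esub> (a \<odot>\<^bsub>M\<^esub> p) \<oplus>\<^bsub>M\<^esub> (a \<odot>\<^bsub>M\<^esub> q)"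
    using 1 q x a by (simp add: smult_r_distr R.m_comm smult_assoc1[symmetric])
  moreover have "a \<odot>\<^bsub>M\<^esub> q \<in> seq_sub M x l" using Suc.IH 1 by blast
  ultimately show ?case using 1 a by auto
qed

lemma neg_eq_smult: "m \<in> carrier M \<Longrightarrow> \<ominus>\<^bsub>M\<^esub> m = (\<ominus>\<^bsub>R\<^esub> \<one>\<^bsub>R\<^esub>) \<odot>\<^bsub>M\<^esub> m"
  by (simp add: smult_l_minus)

lemma seq_sub_neg:
  assumes "\<forall>t. x t \<in> carrier R" and "m \<in> seq_sub M x l"
  shows "\<ominus>\<^bsub>M\<^esub> m \<in> seq_sub M x l"
  using seq_sub_smult[OF assms(1) _ assms(2), of "\<ominus>\<^bsub>R\<^esub> \<one>\<^bsub>R\<^esub>"] seq_sub_carrier[OF assms]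
  by (simp add: neg_eq_smult)

lemma seq_sub_minus:
  assumes "\<forall>t. x t \<in> carrier R" and "m \<in> seq_sub M x l" "m' \<in> seq_sub M x l"
  shows "m \<ominus>\<^bsub>M\<^esub> m' \<in> seq_sub M x l"
  unfolding a_minus_def using assms seq_sub_neg seq_sub_add by blast

end

lemma mod_homD:
  assumes "h \<in> mod_hom R M N"
  shows "x \<in> carrier M \<Longrightarrow> h x \<in> carrier N"
    and "x \<in> carrier M \<Longrightarrow> y \<in> carrier M \<Longrightarrow> h (x \<oplus>\<^bsub>M\<^esub> y) = h x \<oplus>\<^bsub>N\<^esub> h y"
    and "a \<in> carrier R \<Longrightarrow> x \<in> carrier M \<Longrightarrow> h (a \<odot>\<^bsub>M\<^esub> x) = a \<odot>\<^bsub>N\<^esub> h x"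
  using assms unfolding mod_hom_def by auto

lemma mod_hom_zero:
  assumes "Module.module R M" "Module.module R N" "h \<in> mod_hom R M N"
  shows "h \<zero>\<^bsub>M\<^esub> = \<zero>\<^bsub>N\<^esub>"
proof -
  interpret M: Module.module R M by fact
  interpret N: Module.module R N by fact
  have "h (\<zero>\<^bsub>R\<^esub> \<odot>\<^bsub>M\<^esub> \<zero>\<^bsub>M\<^esub>) = \<zero>\<^bsub>R\<^esub> \<odot>\<^bsub>N\<^esub> h \<zero>\<^bsub>M\<^esub>"
    using mod_homD(3)[OF assms(3)] by blast
  moreover have "h \<zero>\<^bsub>M\<^esub> \<in> carrier N" using mod_homD(1)[OF assms(3)] by simp
  ultimately show ?thesis by simp
qed

lemma mod_hom_neg:
  assumes "Module.module R M" "Module.module R N" "h \<in> mod_hom R M N" "m \<in> carrier M"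
  shows "h (\<ominus>\<^bsub>M\<^esub> m) = \<ominus>\<^bsub>N\<^esub> h m"
proof -
  interpret M: Module.module R M by fact
  interpret N: Module.module R N by fact
  show ?thesis
    using mod_homD[OF assms(3)] assms(4) by (simp add: M.neg_eq_smult N.neg_eq_smult)
qed

lemma mod_hom_seq_sub:
  assumes "Module.module R M" "Module.module R N" "h \<in> mod_hom R M N" and x: "\<forall>t. x t \<in> carrier R"
    and "m \<in> seq_sub M x l"
  shows "h m \<in> seq_sub N x l"
  using assms(5)
proof (induction l arbitrary: m)
  case 0
  then show ?case using mod_hom_zero assms by simp
next
  case (Suc l)
  then obtain p q where
    1: "m = x l \<odot>\<^bsub>M\<^esub> p \<oplus>\<^bsub>M\<^esub> q" "p \<in> carrier M" "q \<in> seq_sub M x l"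
    by auto
  interpret M: Module.module R M by fact
  have q: "q \<in> carrier M" using 1 x M.seq_sub_carrier by blast
  have "h m = x l \<odot>\<^bsub>N\<^esub> h p \<oplus>\<^bsub>N\<^esub> h q"
    using 1 q x mod_homD[OF assms(3)] by simp
  with Suc.IH[OF 1(3)] mod_homD(1)[OF assms(3) 1(2)] show ?case by auto
qed

lemma mod_hom_seq_sub_lift:
  assumes "Module.module R M" "Module.module R N" "h \<in> mod_hom R M N" and x: "\<forall>t. x t \<in> carrier R"
    and surj: "h ` carrier M = carrier N" and "n \<in> seq_sub N x l"
  shows "\<exists>m \<in> seq_sub M x l. h m = n"
  using assms(6)
proof (induction l arbitrary: n)
  case 0
  then show ?case using mod_hom_zero assms by simp
next
  case (Suc l)
  then obtain p q where
    1: "n = x l \<odot>\<^bsub>N\<^esub> p \<oplus>\<^bsub>N\<^esub> q" "p \<in> carrier N" "q \<in> seq_sub N x l"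
    by auto
  interpret M: Module.module R M by fact
  obtain q' where q': "q' \<in> seq_sub M x l" "h q' = q" using Suc.IH 1 by blast
  obtain p' where p': "p' \<in> carrier M" "h p' = p" using 1 surj by (metis imageE)
  have "q' \<in> carrier M" using q' x M.seq_sub_carrier by blast
  then have "h (x l \<odot>\<^bsub>M\<^esub> p' \<oplus>\<^bsub>M\<^esub> q') = n"
    using 1 p' q' x mod_homD[OF assms(3)] by simp
  with p' q' show ?case by auto
qed

lemma module_mod_ker:
  assumes "Module.module R M" "Module.module R N" "h \<in> mod_hom R M N"
  shows "Module.module R (M\<lparr>carrier := mod_ker M N h\<rparr>)"
proof -
  interpret M: Module.module R M by fact
  interpret N: Module.module R N by fact
  have "submodule (mod_ker M N h) R M"
    using mod_homD[OF assms(3)] mod_hom_zero[OF assms] mod_hom_neg[OF assms]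
    by (intro M.submoduleI) (auto simp: mod_ker_def)
  then show ?thesis using assms(1) by (rule submodule.submodule_is_module)
qed

section \<open>The kernel of a surjection onto a module with a regular sequence\<close>

context
  fixes R :: "('r, 'x) ring_scheme" and P :: "('r, 'p, 'y) module_scheme"
    and N :: "('r, 'n, 'z) module_scheme" and h :: "'p \<Rightarrow> 'n" and x :: "nat \<Rightarrow> 'r" and j :: nat
    and K :: "('r, 'p, 'y) module_scheme"
  assumes P: "Module.module R P" and N: "Module.module R N" and h: "h \<in> mod_hom R P N"
    and x: "\<forall>t. x t \<in> carrier R"
    and surj: "h ` carrier P = carrier N"
    and reg: "seq_regular N x j"
  defines "K \<equiv> P\<lparr>carrier := mod_ker P N h\<rparr>"
begin

interpretation P: Module.module R P by (rule P)
interpretation N: Module.module R N by (rule N)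

text \<open>For projective \<open>P\<close> this is the vanishing of Tor_1 of \<open>N\<close> and
  R/(x 0, ..., x (l - 1)). Regularity puts the image of the leading coefficient \<open>p\<close>
  into (x 0, ..., x (l - 1)) N. Subtracting a lift \<open>p'\<close> of that image moves the
  coefficient into the kernel, and the remainder \<open>q2\<close> falls to the induction
  hypothesis.\<close>

lemma seq_sub_ker_eq:
  assumes "l \<le> j" "k \<in> mod_ker P N h" "k \<in> seq_sub P x l"
  shows "k \<in> seq_sub K x l"
  using assms
proof (induction l arbitrary: k)
  case 0
  then show ?case by (simp add: K_def)
next
  case (Suc l)
  note hD = mod_homD[OF h]
  obtain p q where
    1: "k = x l \<odot>\<^bsub>P\<^esub> p \<oplus>\<^bsub>P\<^esub> q" "p \<in> carrier P" "q \<in> seq_sub P x l"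
    using Suc.prems(3) by auto
  have qc: "q \<in> carrier P" using 1 x P.seq_sub_carrier by blast
  have kc: "k \<in> carrier P" "h k = \<zero>\<^bsub>N\<^esub>" using Suc.prems(2) by (auto simp: mod_ker_def)
  have "x l \<odot>\<^bsub>N\<^esub> h p \<oplus>\<^bsub>N\<^esub> h q = \<zero>\<^bsub>N\<^esub>"
    using 1 qc kc x hD by simp
  then have "x l \<odot>\<^bsub>N\<^esub> h p = \<ominus>\<^bsub>N\<^esub> h q"
    using 1 qc x hD(1) by (simp add: N.M.minus_equality)
  then have "x l \<odot>\<^bsub>N\<^esub> h p \<in> seq_sub N x l"
    using N.seq_sub_neg[OF x mod_hom_seq_sub[OF P N h x 1(3)]] by simp
  then have "h p \<in> seq_sub N x l"
    using reg Suc.prems(1) 1 hD(1) unfolding seq_regular_def by auto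
  then obtain p' where p': "p' \<in> seq_sub P x l" "h p' = h p"
    using mod_hom_seq_sub_lift[OF P N h x surj] by blast
  have p'c: "p' \<in> carrier P" using p' x P.seq_sub_carrier by blast
  define p2 where "p2 = p \<ominus>\<^bsub>P\<^esub> p'"
  define q2 where "q2 = x l \<odot>\<^bsub>P\<^esub> p' \<oplus>\<^bsub>P\<^esub> q"
  have p2: "p2 \<in> carrier P" "h p2 = \<zero>\<^bsub>N\<^esub>"
    using 1 p' p'c hD mod_hom_neg[OF P N h p'c]
    by (simp_all add: p2_def a_minus_def N.M.r_neg)
  have "p = p2 \<oplus>\<^bsub>P\<^esub> p'" using 1 p'c by (simp add: p2_def a_minus_def P.M.a_assoc P.M.l_neg)
  then have k: "k = x l \<odot>\<^bsub>P\<^esub> p2 \<oplus>\<^bsub>P\<^esub> q2"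
    using 1 p2 p'c qc x by (simp add: q2_def P.smult_r_distr P.M.a_assoc)
  have q2: "q2 \<in> seq_sub P x l"
    unfolding q2_def using P.seq_sub_add P.seq_sub_smult x p' 1 by blast
  have q2c: "q2 \<in> carrier P" using q2 x P.seq_sub_carrier by blast
  have "h k = x l \<odot>\<^bsub>N\<^esub> h p2 \<oplus>\<^bsub>N\<^esub> h q2"
    using k p2 q2c x hD by simp
  then have "h q2 = \<zero>\<^bsub>N\<^esub>"
    using kc p2 x hD(1)[OF q2c] by simp
  then have "q2 \<in> seq_sub K x l"
    using Suc.IH[OF _ _ q2] Suc.prems(1) q2c by (simp add: mod_ker_def)
  moreover have "p2 \<in> carrier K" using p2 by (simp add: K_def mod_ker_def)
  ultimately show ?case using k by (auto simp: K_def)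
qed

lemma seq_sub_ker_subset: "k \<in> seq_sub K x l \<Longrightarrow> k \<in> seq_sub P x l"
proof (induction l arbitrary: k)
  case 0
  then show ?case by (simp add: K_def)
next
  case (Suc l)
  then show ?case by (auto simp: K_def mod_ker_def)
qed

text \<open>The gain of one place comes from the range of \<open>seq_sub_ker_eq\<close>: regularity
  of \<open>N\<close> below \<open>j\<close> controls the intersection with the kernel for all
  \<open>l\<close> up to and including \<open>j\<close>.\<close>

lemma seq_regular_ker:
  assumes "seq_regular P x (Suc j)"
  shows "seq_regular K x (Suc j)"
  unfolding seq_regular_def
proof (intro allI impI ballI)
  fix l m assume l: "l < Suc j" and m: "m \<in> carrier K" and xm: "x l \<odot>\<^bsub>K\<^esub> m \<in> seq_sub K x l"
  have "x l \<odot>\<^bsub>P\<^esub> m \<in> seq_sub P x l"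
    using seq_sub_ker_subset[OF xm] by (simp add: K_def)
  then have "m \<in> seq_sub P x l"
    using assms l m by (auto simp: seq_regular_def K_def mod_ker_def)
  then show "m \<in> seq_sub K x l"
    using seq_sub_ker_eq l m by (simp add: K_def)
qed

text \<open>This is the connecting homomorphism written out. For a lift \<open>p\<close> of
  \<open>m\<close>, the product of \<open>x j\<close> and \<open>p\<close> lies in the kernel up to
  (x 0, ..., x (j - 1)) P, and its kernel part \<open>k\<close> is the new socle element. If
  \<open>k\<close> were trivial, cancelling \<open>x j\<close> in \<open>P\<close> would place
  \<open>p\<close> in the kernel plus (x 0, ..., x (j - 1)) P, and \<open>m\<close> would be trivial
  as well.\<close>

lemma socle_ker:
  assumes regP: "seq_regular P x (Suc j)"
    and m: "m \<in> carrier N" "m \<notin> seq_sub N x j"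
    and soc: "\<And>a. a < H \<Longrightarrow> x a \<odot>\<^bsub>N\<^esub> m \<in> seq_sub N x j" and j: "j < H"
  shows "\<exists>k. k \<in> carrier K \<and> k \<notin> seq_sub K x (Suc j) \<and>
    (\<forall>a<H. x a \<odot>\<^bsub>K\<^esub> k \<in> seq_sub K x (Suc j))"
proof -
  note hD = mod_homD[OF h]
  interpret K: Module.module R K unfolding K_def by (rule module_mod_ker[OF P N h])
  obtain p where p: "p \<in> carrier P" "h p = m" using m surj by (metis imageE)
  have lift: "\<exists>k q. k \<in> mod_ker P N h \<and> q \<in> seq_sub P x j \<and> x a \<odot>\<^bsub>P\<^esub> p = k \<oplus>\<^bsub>P\<^esub> q" if "a < H" for a
  proof -
    have "h (x a \<odot>\<^bsub>P\<^esub> p) \<in> seq_sub N x j" using soc[OF that] p x hD by simp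
    then obtain q where q: "q \<in> seq_sub P x j" "h q = h (x a \<odot>\<^bsub>P\<^esub> p)"
      using mod_hom_seq_sub_lift[OF P N h x surj] by blast
    have qc: "q \<in> carrier P" using q x P.seq_sub_carrier by blast
    have xp: "x a \<odot>\<^bsub>P\<^esub> p \<in> carrier P" using p x by simp
    have "x a \<odot>\<^bsub>P\<^esub> p \<ominus>\<^bsub>P\<^esub> q \<in> mod_ker P N h"
      using qc xp q hD(2)[OF xp, of "\<ominus>\<^bsub>P\<^esub> q"] mod_hom_neg[OF P N h qc] hD(1)[OF xp]
      by (simp add: mod_ker_def a_minus_def N.M.r_neg)
    moreover have "x a \<odot>\<^bsub>P\<^esub> p = (x a \<odot>\<^bsub>P\<^esub> p \<ominus>\<^bsub>P\<^esub> q) \<oplus>\<^bsub>P\<^esub> q"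
      using qc xp by (simp add: a_minus_def P.M.a_assoc P.M.l_neg)
    ultimately show ?thesis using q by blast
  qed
  obtain k q where k: "k \<in> mod_ker P N h" and q: "q \<in> seq_sub P x j"
    and kq: "x j \<odot>\<^bsub>P\<^esub> p = k \<oplus>\<^bsub>P\<^esub> q" using lift[OF j] by blast
  have qc: "q \<in> carrier P" using q x P.seq_sub_carrier by blast
  have kc: "k \<in> carrier P" using k by (simp add: mod_ker_def)
  have "k \<notin> seq_sub K x (Suc j)"
  proof
    assume "k \<in> seq_sub K x (Suc j)"
    then obtain k1 k2 where kk: "k = x j \<odot>\<^bsub>P\<^esub> k1 \<oplus>\<^bsub>P\<^esub> k2" "k1 \<in> mod_ker P N h" "k2 \<in> seq_sub K x j"
      by (auto simp: K_def)
    have k1: "k1 \<in> carrier P" "h k1 = \<zero>\<^bsub>N\<^esub>" using kk by (auto simp: mod_ker_def)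
    have k2: "k2 \<in> seq_sub P x j" using seq_sub_ker_subset kk(3) by blast
    have k2c: "k2 \<in> carrier P" using k2 x P.seq_sub_carrier by blast
    have "x j \<odot>\<^bsub>P\<^esub> (p \<ominus>\<^bsub>P\<^esub> k1) = x j \<odot>\<^bsub>P\<^esub> p \<oplus>\<^bsub>P\<^esub> \<ominus>\<^bsub>P\<^esub> (x j \<odot>\<^bsub>P\<^esub> k1)"
      using p k1 x by (simp add: a_minus_def P.smult_r_distr P.smult_r_minus)
    also have "\<dots> = (x j \<odot>\<^bsub>P\<^esub> k1 \<oplus>\<^bsub>P\<^esub> (k2 \<oplus>\<^bsub>P\<^esub> q)) \<oplus>\<^bsub>P\<^esub> \<ominus>\<^bsub>P\<^esub> (x j \<odot>\<^bsub>P\<^esub> k1)"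
      using kq kk k1 k2c qc x by (simp add: P.M.a_assoc)
    also have "\<dots> = k2 \<oplus>\<^bsub>P\<^esub> q"
      using k1 k2c qc x by (metis P.M.a_closed P.M.a_comm P.M.r_neg1 P.smult_closed P.M.a_inv_closed)
    finally have "x j \<odot>\<^bsub>P\<^esub> (p \<ominus>\<^bsub>P\<^esub> k1) \<in> seq_sub P x j"
      using P.seq_sub_add[OF x k2 q] by simp
    then have "p \<ominus>\<^bsub>P\<^esub> k1 \<in> seq_sub P x j"
      using regP p k1 by (simp add: seq_regular_def)
    then have "h (p \<ominus>\<^bsub>P\<^esub> k1) \<in> seq_sub N x j" using mod_hom_seq_sub[OF P N h x] by blast
    moreover have "h (p \<ominus>\<^bsub>P\<^esub> k1) = m"
      using p k1 hD mod_hom_neg[OF P N h k1(1)] m by (simp add: a_minus_def)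
    ultimately show False using m by simp
  qed
  moreover have "x a \<odot>\<^bsub>K\<^esub> k \<in> seq_sub K x (Suc j)" if a: "a < H" for a
  proof -
    obtain k' q' where k': "k' \<in> mod_ker P N h" and q': "q' \<in> seq_sub P x j"
      and kq': "x a \<odot>\<^bsub>P\<^esub> p = k' \<oplus>\<^bsub>P\<^esub> q'" using lift[OF a] by blast
    have q'c: "q' \<in> carrier P" using q' x P.seq_sub_carrier by blast
    have k'c: "k' \<in> carrier P" using k' by (simp add: mod_ker_def)
    \<comment> \<open>Expanding the product of \<open>x a\<close>, \<open>x j\<close> and
      \<open>p\<close> in two ways shows \<open>x a\<close> times \<open>k\<close> to be
      \<open>x j\<close> times \<open>k'\<close> plus an error \<open>y\<close>. The other two terms
      lie in the kernel, hence so does \<open>y\<close>, and \<open>seq_sub_ker_eq\<close> makes it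
      trivial already inside the kernel.\<close>
    have "x a \<odot>\<^bsub>P\<^esub> (k \<oplus>\<^bsub>P\<^esub> q) = x j \<odot>\<^bsub>P\<^esub> (k' \<oplus>\<^bsub>P\<^esub> q')"
      unfolding kq[symmetric] kq'[symmetric] using p x
      by (simp add: P.R.m_comm P.smult_assoc1[symmetric])
    then have eq: "x a \<odot>\<^bsub>P\<^esub> k \<oplus>\<^bsub>P\<^esub> x a \<odot>\<^bsub>P\<^esub> q = x j \<odot>\<^bsub>P\<^esub> k' \<oplus>\<^bsub>P\<^esub> x j \<odot>\<^bsub>P\<^esub> q'"
      using x qc kc q'c k'c by (simp add: P.smult_r_distr)
    define y where "y = x j \<odot>\<^bsub>P\<^esub> q' \<ominus>\<^bsub>P\<^esub> x a \<odot>\<^bsub>P\<^esub> q"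
    have y: "y \<in> seq_sub P x j"
      unfolding y_def using P.seq_sub_minus P.seq_sub_smult x q q' by blast
    have yc: "y \<in> carrier P" using y x P.seq_sub_carrier by blast
    have "x a \<odot>\<^bsub>P\<^esub> k = (x a \<odot>\<^bsub>P\<^esub> k \<oplus>\<^bsub>P\<^esub> x a \<odot>\<^bsub>P\<^esub> q) \<oplus>\<^bsub>P\<^esub> \<ominus>\<^bsub>P\<^esub> (x a \<odot>\<^bsub>P\<^esub> q)"
      using x qc kc by (simp add: P.M.a_assoc P.M.r_neg)
    also have "\<dots> = x j \<odot>\<^bsub>P\<^esub> k' \<oplus>\<^bsub>P\<^esub> y"
      unfolding eq y_def a_minus_def using x q'c k'c qc by (simp add: P.M.a_assoc)
    finally have e: "x a \<odot>\<^bsub>P\<^esub> k = x j \<odot>\<^bsub>P\<^esub> k' \<oplus>\<^bsub>P\<^esub> y" .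
    have "h (x a \<odot>\<^bsub>P\<^esub> k) = \<zero>\<^bsub>N\<^esub>" using k x hD kc by (simp add: mod_ker_def)
    moreover have "h (x j \<odot>\<^bsub>P\<^esub> k' \<oplus>\<^bsub>P\<^esub> y) = h y"
      using k' x hD k'c yc by (simp add: mod_ker_def)
    ultimately have "y \<in> mod_ker P N h" using e yc by (simp add: mod_ker_def)
    then have "y \<in> seq_sub K x j" using seq_sub_ker_eq[OF order_refl _ y] by blast
    with e k' show ?thesis by (auto simp: K_def)
  qed
  ultimately show ?thesis using k by (auto simp: K_def)
qed

end

section \<open>The length of a projective resolution\<close>

lemma proj_resolution_step:
  fixes P :: "nat \<Rightarrow> ('r, 'p) module"
  assumes N: "Module.module R N"
    and x: "\<forall>t. x t \<in> carrier R"
    and proj: "\<And>Q :: ('r, 'p) module. projective_mod R Q \<Longrightarrow> seq_regular Q x H"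
    and res: "proj_resolution R N d P \<epsilon> \<delta>"
    and reg: "seq_regular N x j"
    and m: "m \<in> carrier N" "m \<notin> seq_sub N x j" "\<And>a. a < H \<Longrightarrow> x a \<odot>\<^bsub>N\<^esub> m \<in> seq_sub N x j"
    and j: "j < H"
  defines "K \<equiv> (P 0)\<lparr>carrier := mod_ker (P 0) N \<epsilon>\<rparr>"
  shows "\<exists>k. k \<in> carrier K \<and> k \<notin> seq_sub K x (Suc j) \<and> (\<forall>a<H. x a \<odot>\<^bsub>K\<^esub> k \<in> seq_sub K x (Suc j))"
    and "seq_regular K x (Suc j)"
    and "Module.module R K"
proof -
  have P0: "Module.module R (P 0)" and pr: "projective_mod R (P 0)" and eps: "\<epsilon> \<in> mod_hom R (P 0) N"
    and surj: "\<epsilon> ` carrier (P 0) = carrier N"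
    using res unfolding proj_resolution_def projective_mod_def by auto
  have rP: "seq_regular (P 0) x (Suc j)"
    using proj[OF pr] j unfolding seq_regular_def by auto
  show "\<exists>k. k \<in> carrier K \<and> k \<notin> seq_sub K x (Suc j) \<and> (\<forall>a<H. x a \<odot>\<^bsub>K\<^esub> k \<in> seq_sub K x (Suc j))"
    unfolding K_def by (rule socle_ker[OF P0 N eps x surj reg rP m j])
  show "seq_regular K x (Suc j)"
    unfolding K_def by (rule seq_regular_ker[OF P0 N eps x surj reg rP])
  show "Module.module R K"
    unfolding K_def by (rule module_mod_ker[OF P0 N eps])
qed

lemma proj_resolution_shift:
  assumes "proj_resolution R N (Suc d) P \<epsilon> \<delta>"
  shows "proj_resolution R ((P 0)\<lparr>carrier := mod_ker (P 0) N \<epsilon>\<rparr>) d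
    (\<lambda>k. P (Suc k)) (\<delta> 0) (\<lambda>k. \<delta> (Suc k))"
proof -
  note a = assms[unfolded proj_resolution_def]
  have im: "\<delta> 0 ` carrier (P (Suc 0)) = mod_ker (P 0) N \<epsilon>" using a by simp
  have "\<delta> 0 \<in> mod_hom R (P (Suc 0)) ((P 0)\<lparr>carrier := mod_ker (P 0) N \<epsilon>\<rparr>)"
    using a im by (auto simp: mod_hom_def)
  then show ?thesis
    using a im by (simp add: proj_resolution_def mod_ker_def)
qed

lemma proj_resolution_ker_trivial:
  assumes "proj_resolution R N 0 P \<epsilon> \<delta>"
  shows "mod_ker (P 0) N \<epsilon> = {\<zero>\<^bsub>P 0\<^esub>}"
proof -
  note a = assms[unfolded proj_resolution_def]
  have "carrier (P 1) = {\<zero>\<^bsub>P 1\<^esub>}" using a by simp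
  moreover have "\<delta> 0 \<zero>\<^bsub>P 1\<^esub> = \<zero>\<^bsub>P 0\<^esub>"
    using a by (intro mod_hom_zero) (auto simp: projective_mod_def)
  ultimately show ?thesis using a by auto
qed

text \<open>Passing to the first syzygy raises \<open>j\<close> by one and lowers \<open>d\<close>
  by one. At \<open>d = 0\<close> the next syzygy is zero and has no room for a socle element,
  unless \<open>j\<close> has already reached \<open>H\<close>. The element type of \<open>N\<close>
  is that of the resolving modules because the induction replaces \<open>N\<close> by a submodule of
  \<open>P 0\<close>.\<close>

lemma resolution_length_aux:
  fixes P :: "nat \<Rightarrow> ('r, 'p) module" and N :: "('r, 'p) module"
  assumes x: "\<forall>t. x t \<in> carrier R"
    and proj: "\<And>Q :: ('r, 'p) module. projective_mod R Q \<Longrightarrow> seq_regular Q x H"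
    and "Module.module R N"
    and "proj_resolution R N d P \<epsilon> \<delta>"
    and "seq_regular N x j"
    and "m \<in> carrier N" "m \<notin> seq_sub N x j" "\<And>a. a < H \<Longrightarrow> x a \<odot>\<^bsub>N\<^esub> m \<in> seq_sub N x j"
  shows "H \<le> j + d"
  using assms(3-)
proof (induction d arbitrary: N P \<epsilon> \<delta> j m)
  case 0
  show ?case
  proof (rule ccontr)
    assume "\<not> H \<le> j + 0"
    then have j: "j < H" by simp
    define K where "K = (P 0)\<lparr>carrier := mod_ker (P 0) N \<epsilon>\<rparr>"
    note st = proj_resolution_step[OF 0(1) x proj 0(2,3,4,5,6) j, folded K_def]
    interpret K: Module.module R K by (rule st(3))
    obtain k where "k \<in> carrier K" "k \<notin> seq_sub K x (Suc j)" using st(1) by blast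
    moreover have "carrier K = {\<zero>\<^bsub>K\<^esub>}"
      using proj_resolution_ker_trivial[OF 0(2)] by (simp add: K_def)
    ultimately show False using K.seq_sub_zero[OF x] by (simp del: seq_sub.simps)
  qed
next
  case (Suc d)
  show ?case
  proof (cases "j < H")
    case False
    then show ?thesis by simp
  next
    case j: True
    define K where "K = (P 0)\<lparr>carrier := mod_ker (P 0) N \<epsilon>\<rparr>"
    note st = proj_resolution_step[OF Suc.prems(1) x proj Suc.prems(2-6) j, folded K_def]
    obtain k where "k \<in> carrier K" "k \<notin> seq_sub K x (Suc j)"
      "\<And>a. a < H \<Longrightarrow> x a \<odot>\<^bsub>K\<^esub> k \<in> seq_sub K x (Suc j)" using st(1) by blast
    from Suc.IH[OF st(3) proj_resolution_shift[OF Suc.prems(2), folded K_def] st(2) this]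
    show ?thesis by simp
  qed
qed

text \<open>The first step is taken separately, since \<open>N\<close> may have another element type
  than the resolution; from the first syzygy on, all modules live in the type of
  \<open>P\<close>.\<close>

theorem resolution_length_ge:
  fixes P :: "nat \<Rightarrow> ('r, 'p) module"
  assumes x: "\<forall>t. x t \<in> carrier R"
    and proj: "\<And>Q :: ('r, 'p) module. projective_mod R Q \<Longrightarrow> seq_regular Q x H"
    and N: "Module.module R N"
    and res: "proj_resolution R N d P \<epsilon> \<delta>"
    and reg: "seq_regular N x j"
    and m: "m \<in> carrier N" "m \<notin> seq_sub N x j" "\<And>a. a < H \<Longrightarrow> x a \<odot>\<^bsub>N\<^esub> m \<in> seq_sub N x j"
  shows "H \<le> j + d"
proof (rule ccontr)
  assume "\<not> H \<le> j + d"
  then have j: "j < H" by simp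
  define K where "K = (P 0)\<lparr>carrier := mod_ker (P 0) N \<epsilon>\<rparr>"
  note st = proj_resolution_step[OF N x proj res reg m j, folded K_def]
  obtain k where k: "k \<in> carrier K" "k \<notin> seq_sub K x (Suc j)"
    "\<And>a. a < H \<Longrightarrow> x a \<odot>\<^bsub>K\<^esub> k \<in> seq_sub K x (Suc j)" using st(1) by blast
  show False
  proof (cases d)
    case 0
    interpret K: Module.module R K by (rule st(3))
    have "carrier K = {\<zero>\<^bsub>K\<^esub>}"
      using proj_resolution_ker_trivial res 0 by (simp add: K_def)
    with k K.seq_sub_zero[OF x] show False by (simp del: seq_sub.simps)
  next
    case (Suc d')
    from resolution_length_aux[OF x proj st(3) proj_resolution_shift[OF res[unfolded Suc], folded K_def] st(2) k]
    show False using \<open>\<not> H \<le> j + d\<close> Suc by simp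
  qed
qed

section \<open>Ideals, free modules and projective modules\<close>

lemma module_ring_self:
  assumes "cring R"
  shows "Module.module R (ideal_mod R (carrier R))"
proof -
  interpret cring R by fact
  have "\<And>x. x \<in> carrier R \<Longrightarrow> \<exists>y\<in>carrier R. y \<oplus>\<^bsub>R\<^esub> x = \<zero>\<^bsub>R\<^esub>"
    using l_neg by blast
  then have "abelian_group (ideal_mod R (carrier R))"
    by (intro abelian_groupI) (auto simp: ideal_mod_def a_ac)
  then show ?thesis
    using assms by (intro Module.moduleI) (auto simp: ideal_mod_def l_distr r_distr m_assoc)
qed

lemma module_ideal_mod:
  assumes "cring R" "ideal J R"
  shows "Module.module R (ideal_mod R J)"
proof -
  interpret cring R by fact
  interpret ideal J R by fact
  interpret M: Module.module R "ideal_mod R (carrier R)" by (rule module_ring_self) fact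
  have "\<ominus>\<^bsub>ideal_mod R (carrier R)\<^esub> a \<in> J" if "a \<in> J" for a
  proof -
    have "\<ominus>\<^bsub>ideal_mod R (carrier R)\<^esub> a = (\<ominus>\<^bsub>R\<^esub> \<one>\<^bsub>R\<^esub>) \<otimes>\<^bsub>R\<^esub> a"
      using M.neg_eq_smult[of a] that by (simp add: ideal_mod_def Icarr)
    then show ?thesis using that by (simp add: I_l_closed)
  qed
  then have "submodule J R (ideal_mod R (carrier R))"
    using I_l_closed by (intro M.submoduleI) (auto simp: ideal_mod_def)
  then have "Module.module R ((ideal_mod R (carrier R))\<lparr>carrier := J\<rparr>)"
    using M.module_axioms by (rule submodule.submodule_is_module)
  then show ?thesis by (simp add: ideal_mod_def)
qed

lemma module_free_mod:
  assumes "cring R"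
  shows "Module.module R (free_mod R X)"
proof -
  interpret cring R by fact
  let ?F = "free_mod R X"
  have supp: "finite {i. f i \<oplus>\<^bsub>R\<^esub> g i \<noteq> \<zero>\<^bsub>R\<^esub>} \<and> {i. f i \<oplus>\<^bsub>R\<^esub> g i \<noteq> \<zero>\<^bsub>R\<^esub>} \<subseteq> X"
    if "finite {i. f i \<noteq> \<zero>\<^bsub>R\<^esub>}" "{i. f i \<noteq> \<zero>\<^bsub>R\<^esub>} \<subseteq> X" "finite {i. g i \<noteq> \<zero>\<^bsub>R\<^esub>}" "{i. g i \<noteq> \<zero>\<^bsub>R\<^esub>} \<subseteq> X"
    for f g
  proof -
    have "{i. f i \<oplus>\<^bsub>R\<^esub> g i \<noteq> \<zero>\<^bsub>R\<^esub>} \<subseteq> {i. f i \<noteq> \<zero>\<^bsub>R\<^esub>} \<union> {i. g i \<noteq> \<zero>\<^bsub>R\<^esub>}" by auto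
    then show ?thesis using that(2,4) finite_subset[OF _ finite_UnI[OF that(1,3)]] by blast
  qed
  have smult: "(\<lambda>i. a \<otimes>\<^bsub>R\<^esub> f i) \<in> carrier ?F" if "a \<in> carrier R" "f \<in> carrier ?F" for a f
  proof -
    have "{i. a \<otimes>\<^bsub>R\<^esub> f i \<noteq> \<zero>\<^bsub>R\<^esub>} \<subseteq> {i. f i \<noteq> \<zero>\<^bsub>R\<^esub>}" using that by auto
    moreover have "finite {i. f i \<noteq> \<zero>\<^bsub>R\<^esub>}" "{i. f i \<noteq> \<zero>\<^bsub>R\<^esub>} \<subseteq> X" "range f \<subseteq> carrier R"
      using that by (simp_all add: free_mod_def)
    moreover from this have "range (\<lambda>i. a \<otimes>\<^bsub>R\<^esub> f i) \<subseteq> carrier R" using that(1) by blast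
    ultimately show ?thesis by (simp add: free_mod_def finite_subset)
  qed
  have inv: "\<exists>g\<in>carrier ?F. g \<oplus>\<^bsub>?F\<^esub> f = \<zero>\<^bsub>?F\<^esub>" if f: "f \<in> carrier ?F" for f
  proof
    show "(\<lambda>i. (\<ominus>\<^bsub>R\<^esub> \<one>\<^bsub>R\<^esub>) \<otimes>\<^bsub>R\<^esub> f i) \<in> carrier ?F" by (rule smult) (simp_all add: f)
    show "(\<lambda>i. (\<ominus>\<^bsub>R\<^esub> \<one>\<^bsub>R\<^esub>) \<otimes>\<^bsub>R\<^esub> f i) \<oplus>\<^bsub>?F\<^esub> f = \<zero>\<^bsub>?F\<^esub>"
      using f by (simp add: free_mod_def l_minus l_neg image_subset_iff)
  qed
  have ab: "abelian_group ?F"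
  proof (rule abelian_groupI)
    fix f assume "f \<in> carrier ?F"
    then show "\<exists>g\<in>carrier ?F. g \<oplus>\<^bsub>?F\<^esub> f = \<zero>\<^bsub>?F\<^esub>" by (rule inv)
  qed (use supp in \<open>auto simp: free_mod_def image_subset_iff a_ac\<close>)
  show ?thesis
  proof (rule Module.moduleI[OF assms ab])
    fix a f assume "a \<in> carrier R" "f \<in> carrier ?F"
    then show "a \<odot>\<^bsub>?F\<^esub> f \<in> carrier ?F" using smult by (simp add: free_mod_def)
  qed (auto simp: free_mod_def image_subset_iff l_distr r_distr m_assoc)
qed

lemma seq_sub_free_mod_nth:
  assumes "f \<in> seq_sub (free_mod R X) x l"
  shows "f i \<in> seq_sub (ideal_mod R (carrier R)) x l"
  using assms
proof (induction l arbitrary: f)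
  case 0
  then show ?case by (simp add: free_mod_def ideal_mod_def)
next
  case (Suc l)
  then obtain p q where pq: "f = x l \<odot>\<^bsub>free_mod R X\<^esub> p \<oplus>\<^bsub>free_mod R X\<^esub> q"
    "p \<in> carrier (free_mod R X)" "q \<in> seq_sub (free_mod R X) x l" by auto
  then have "f i = x l \<odot>\<^bsub>ideal_mod R (carrier R)\<^esub> p i \<oplus>\<^bsub>ideal_mod R (carrier R)\<^esub> q i"
    by (simp add: free_mod_def ideal_mod_def)
  moreover have "p i \<in> carrier (ideal_mod R (carrier R))"
    using pq(2) by (auto simp: free_mod_def ideal_mod_def)
  ultimately show ?case using Suc.IH[OF pq(3)] by auto
qed

lemma seq_sub_free_modI:
  assumes "cring R" and x: "\<forall>t. x t \<in> carrier R"
    and "f \<in> carrier (free_mod R X)" "\<forall>i. f i \<in> seq_sub (ideal_mod R (carrier R)) x l"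
  shows "f \<in> seq_sub (free_mod R X) x l"
  using assms(3,4)
proof (induction l arbitrary: f)
  case 0
  then show ?case by (auto simp: free_mod_def ideal_mod_def)
next
  case (Suc l)
  interpret cring R by fact
  let ?S = "ideal_mod R (carrier R)"
  interpret M: Module.module R ?S by (rule module_ring_self) fact
  \<comment> \<open>Where \<open>f\<close> vanishes both parts are chosen to be zero; otherwise the
    pieces could have infinite support or leave \<open>X\<close>.\<close>
  have ex: "\<forall>i. \<exists>p q. p \<in> carrier R \<and> q \<in> seq_sub ?S x l \<and> f i = x l \<otimes>\<^bsub>R\<^esub> p \<oplus>\<^bsub>R\<^esub> q \<and>
      (f i = \<zero>\<^bsub>R\<^esub> \<longrightarrow> p = \<zero>\<^bsub>R\<^esub> \<and> q = \<zero>\<^bsub>R\<^esub>)" (is "\<forall>i. ?E i")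
  proof
    fix i show "?E i"
    proof (cases "f i = \<zero>\<^bsub>R\<^esub>")
      case True
      have "\<zero>\<^bsub>R\<^esub> \<in> seq_sub ?S x l" using M.seq_sub_zero[OF x] by (simp add: ideal_mod_def)
      moreover have "x l \<otimes>\<^bsub>R\<^esub> \<zero>\<^bsub>R\<^esub> \<oplus>\<^bsub>R\<^esub> \<zero>\<^bsub>R\<^esub> = \<zero>\<^bsub>R\<^esub>" using x by simp
      ultimately show ?thesis using True by force
    next
      case False
      have "f i \<in> seq_sub ?S x (Suc l)" using Suc.prems by blast
      then show ?thesis using False by (auto simp: ideal_mod_def)
    qed
  qed
  obtain p where "\<forall>i. \<exists>q. p i \<in> carrier R \<and> q \<in> seq_sub ?S x l \<and> f i = x l \<otimes>\<^bsub>R\<^esub> p i \<oplus>\<^bsub>R\<^esub> q \<and>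
      (f i = \<zero>\<^bsub>R\<^esub> \<longrightarrow> p i = \<zero>\<^bsub>R\<^esub> \<and> q = \<zero>\<^bsub>R\<^esub>)"
    using choice[OF ex] by (elim exE)
  then obtain q where "\<forall>i. p i \<in> carrier R \<and> q i \<in> seq_sub ?S x l \<and> f i = x l \<otimes>\<^bsub>R\<^esub> p i \<oplus>\<^bsub>R\<^esub> q i \<and>
      (f i = \<zero>\<^bsub>R\<^esub> \<longrightarrow> p i = \<zero>\<^bsub>R\<^esub> \<and> q i = \<zero>\<^bsub>R\<^esub>)"
    by (elim choice[THEN exE])
  then have pq: "p i \<in> carrier R" "q i \<in> seq_sub ?S x l" "f i = x l \<otimes>\<^bsub>R\<^esub> p i \<oplus>\<^bsub>R\<^esub> q i"
    "f i = \<zero>\<^bsub>R\<^esub> \<Longrightarrow> p i = \<zero>\<^bsub>R\<^esub>" "f i = \<zero>\<^bsub>R\<^esub> \<Longrightarrow> q i = \<zero>\<^bsub>R\<^esub>" for i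
    by blast+
  have qc: "q i \<in> carrier R" for i
    using M.seq_sub_carrier[OF x pq(2)] by (simp add: ideal_mod_def)
  have F: "finite {i. f i \<noteq> \<zero>\<^bsub>R\<^esub>}" "{i. f i \<noteq> \<zero>\<^bsub>R\<^esub>} \<subseteq> X"
    using Suc.prems by (auto simp: free_mod_def)
  have sub: "{i. p i \<noteq> \<zero>\<^bsub>R\<^esub>} \<subseteq> {i. f i \<noteq> \<zero>\<^bsub>R\<^esub>}" "{i. q i \<noteq> \<zero>\<^bsub>R\<^esub>} \<subseteq> {i. f i \<noteq> \<zero>\<^bsub>R\<^esub>}"
    using pq(4,5) by auto
  have p: "p \<in> carrier (free_mod R X)" and q: "q \<in> carrier (free_mod R X)"
    using pq(1) qc order_trans[OF sub(1) F(2)] order_trans[OF sub(2) F(2)]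
      finite_subset[OF sub(1) F(1)] finite_subset[OF sub(2) F(1)]
    by (simp_all add: free_mod_def image_subset_iff)
  have "q \<in> seq_sub (free_mod R X) x l" using Suc.IH[OF q] pq(2) by blast
  moreover have "f = x l \<odot>\<^bsub>free_mod R X\<^esub> p \<oplus>\<^bsub>free_mod R X\<^esub> q"
    by (simp add: free_mod_def pq(3)[symmetric])
  ultimately show ?case using p by auto
qed

text \<open>In a free module regularity can be checked coordinate by coordinate, and a projective
  module inherits it as a retract: \<open>s\<close> carries the relation into the free module, the
  cancellation happens there, and \<open>q\<close> carries the result back.\<close>

lemma seq_regular_projective_mod:
  fixes P :: "('r, 'p, 'y) module_scheme"
  assumes R: "cring R" and x: "\<forall>t. x t \<in> carrier R"
    and reg: "seq_regular (ideal_mod R (carrier R)) x H"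
    and proj: "projective_mod R P"
  shows "seq_regular P x H"
  unfolding seq_regular_def
proof (intro allI impI ballI)
  fix l m assume l: "l < H" and m: "m \<in> carrier P" and xm: "x l \<odot>\<^bsub>P\<^esub> m \<in> seq_sub P x l"
  obtain X :: "'p set" and s q where s: "s \<in> mod_hom R P (free_mod R X)" and q: "q \<in> mod_hom R (free_mod R X) P"
    and qs: "\<And>x. x \<in> carrier P \<Longrightarrow> q (s x) = x" and P: "Module.module R P"
    using proj unfolding projective_mod_def by blast
  note F = module_free_mod[OF R, of X]
  have "s (x l \<odot>\<^bsub>P\<^esub> m) \<in> seq_sub (free_mod R X) x l"
    by (rule mod_hom_seq_sub[OF P F s x xm])
  then have "x l \<odot>\<^bsub>free_mod R X\<^esub> s m \<in> seq_sub (free_mod R X) x l"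
    using mod_homD(3)[OF s] x m by simp
  then have "x l \<odot>\<^bsub>ideal_mod R (carrier R)\<^esub> s m i \<in> seq_sub (ideal_mod R (carrier R)) x l" for i
    using seq_sub_free_mod_nth by (force simp: free_mod_def ideal_mod_def)
  moreover have sm: "s m \<in> carrier (free_mod R X)" using mod_homD(1)[OF s m] .
  moreover from sm have "s m i \<in> carrier (ideal_mod R (carrier R))" for i
    by (auto simp: free_mod_def ideal_mod_def)
  ultimately have "\<forall>i. s m i \<in> seq_sub (ideal_mod R (carrier R)) x l"
    using reg l by (auto simp: seq_regular_def)
  then have "s m \<in> seq_sub (free_mod R X) x l"
    by (rule seq_sub_free_modI[OF R x sm])
  then have "q (s m) \<in> seq_sub P x l" by (rule mod_hom_seq_sub[OF F P q x])
  then show "m \<in> seq_sub P x l" using qs m by simp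
qed

text \<open>The first syzygy step for R/J is done by hand, which costs the 1 in
  \<open>H - 1\<close>: the socle element \<open>w\<close> modulo \<open>J\<close> becomes the
  element \<open>x 0\<close> times \<open>w\<close> of \<open>J\<close>, considered modulo (x 0) J.
  It is nontrivial because \<open>x 0\<close> can be cancelled and \<open>w\<close> is outside
  \<open>J\<close>; it is killed by every \<open>x a\<close> because \<open>x a\<close> and
  \<open>x 0\<close> commute.\<close>

theorem proj_dim_ideal_ge:
  assumes R: "cring R" and J: "ideal J R" and x: "\<forall>t. x t \<in> carrier R"
    and reg: "seq_regular (ideal_mod R (carrier R)) x H"
    and w: "w \<in> carrier R" "w \<notin> J" "\<And>a. a < H \<Longrightarrow> x a \<otimes>\<^bsub>R\<^esub> w \<in> J"
  shows "proj_dim R (ideal_mod R J) \<ge> ereal (real H - 1)"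
proof (cases H)
  case 0
  \<comment> \<open>For \<open>H = 0\<close> the bound is -1, which is the value for the zero ideal
    and lies below every length of a resolution.\<close>
  have "ereal (- 1) \<le> Inf {ereal (real d) | d. \<exists>(P :: nat \<Rightarrow> ('a, nat \<times> 'a \<times> 'a) module) \<epsilon> \<delta>.
      proj_resolution R (ideal_mod R J) d P \<epsilon> \<delta>}"
  proof (rule Inf_greatest)
    fix y assume "y \<in> {ereal (real d) | d. \<exists>(P :: nat \<Rightarrow> ('a, nat \<times> 'a \<times> 'a) module) \<epsilon> \<delta>.
      proj_resolution R (ideal_mod R J) d P \<epsilon> \<delta>}"
    then obtain d where "y = ereal (real d)" by blast
    then show "ereal (- 1) \<le> y" by simp
  qed
  with 0 show ?thesis by (simp add: proj_dim_def one_ereal_def)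
next
  case (Suc H')
  interpret cring R by fact
  interpret J: ideal J R by fact
  note M = module_ideal_mod[OF R J]
  have xc: "x t \<in> carrier R" for t using x by simp
  have inj0: "y = \<zero>\<^bsub>R\<^esub>" if "y \<in> carrier R" "x 0 \<otimes>\<^bsub>R\<^esub> y = \<zero>\<^bsub>R\<^esub>" for y
    using reg[unfolded seq_regular_def, rule_format, of 0 y] that Suc by (simp add: ideal_mod_def)
  have x0w: "x 0 \<otimes>\<^bsub>R\<^esub> w \<in> J" using w(3) Suc by blast
  \<comment> \<open>The zero ideal has its own clause in \<open>proj_dim\<close>. It is excluded
    here, since it would contain \<open>x 0\<close> times \<open>w\<close> only if \<open>w\<close>
    were zero and hence in \<open>J\<close>.\<close>
  have nz: "J \<noteq> {\<zero>\<^bsub>R\<^esub>}" using inj0[OF w(1)] x0w w(2) J.zero_closed by blast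
  have "real H' \<le> real d"
    if res: "proj_resolution R (ideal_mod R J) d P \<epsilon> \<delta>" for d \<epsilon> \<delta> and P :: "nat \<Rightarrow> ('a, nat \<times> 'a \<times> 'a) module"
  proof -
    have "H \<le> 1 + d"
    proof (rule resolution_length_ge[OF x _ M res])
      show "seq_regular Q x H" if "projective_mod R Q" for Q :: "('a, nat \<times> 'a \<times> 'a) module"
        using seq_regular_projective_mod[OF R x reg that] .
      show "seq_regular (ideal_mod R J) x 1"
        unfolding seq_regular_def using inj0[OF J.Icarr] by (simp add: ideal_mod_def)
      show "x 0 \<otimes>\<^bsub>R\<^esub> w \<in> carrier (ideal_mod R J)" using x0w by (simp add: ideal_mod_def)
      show "x 0 \<otimes>\<^bsub>R\<^esub> w \<notin> seq_sub (ideal_mod R J) x 1"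
      proof
        assume "x 0 \<otimes>\<^bsub>R\<^esub> w \<in> seq_sub (ideal_mod R J) x 1"
        then obtain p where p: "p \<in> J" "x 0 \<otimes>\<^bsub>R\<^esub> w = x 0 \<otimes>\<^bsub>R\<^esub> p"
          using J.Icarr by (auto simp: ideal_mod_def xc)
        have pc: "p \<in> carrier R" using J.Icarr p(1) .
        have "x 0 \<otimes>\<^bsub>R\<^esub> (w \<oplus>\<^bsub>R\<^esub> \<ominus>\<^bsub>R\<^esub> p) = x 0 \<otimes>\<^bsub>R\<^esub> w \<oplus>\<^bsub>R\<^esub> \<ominus>\<^bsub>R\<^esub> (x 0 \<otimes>\<^bsub>R\<^esub> p)"
          using xc[of 0] w(1) pc by (simp add: r_distr r_minus)
        also have "\<dots> = \<zero>\<^bsub>R\<^esub>" unfolding p(2) using xc[of 0] pc by (simp add: r_neg)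
        finally have "w \<oplus>\<^bsub>R\<^esub> \<ominus>\<^bsub>R\<^esub> p = \<zero>\<^bsub>R\<^esub>" using inj0 w(1) pc by simp
        then have "w = p" using w(1) pc minus_equality[of w "\<ominus>\<^bsub>R\<^esub> p"] by simp
        with p w show False by simp
      qed
      show "x a \<odot>\<^bsub>ideal_mod R J\<^esub> (x 0 \<otimes>\<^bsub>R\<^esub> w) \<in> seq_sub (ideal_mod R J) x 1" if "a < H" for a
      proof -
        have "x a \<otimes>\<^bsub>R\<^esub> (x 0 \<otimes>\<^bsub>R\<^esub> w) = x 0 \<otimes>\<^bsub>R\<^esub> (x a \<otimes>\<^bsub>R\<^esub> w) \<oplus>\<^bsub>R\<^esub> \<zero>\<^bsub>R\<^esub>"
          using xc[of 0] xc[of a] w(1) by (simp add: m_lcomm)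
        then show ?thesis using w(3)[OF that] by (auto simp: ideal_mod_def)
      qed
    qed
    then show ?thesis using Suc by simp
  qed
  then have "ereal (real H') \<le> Inf {ereal (real d) | d. \<exists>(P :: nat \<Rightarrow> ('a, nat \<times> 'a \<times> 'a) module) \<epsilon> \<delta>.
      proj_resolution R (ideal_mod R J) d P \<epsilon> \<delta>}" (is "_ \<le> Inf ?D")
  proof (intro Inf_greatest)
    fix y assume "y \<in> ?D"
    then obtain d \<epsilon> \<delta> and P :: "nat \<Rightarrow> ('a, nat \<times> 'a \<times> 'a) module"
      where "y = ereal (real d)" "proj_resolution R (ideal_mod R J) d P \<epsilon> \<delta>" by blast
    with \<open>\<And>d \<epsilon> \<delta> P. proj_resolution R (ideal_mod R J) d P \<epsilon> \<delta> \<Longrightarrow> real H' \<le> real d\<close>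
    show "ereal (real H') \<le> y" by (simp del: of_nat_le_iff)
  qed
  then show ?thesis using nz Suc by (simp add: proj_dim_def ideal_mod_def)
qed

section \<open>Monomial ideals\<close>

abbreviation xmon :: "mon \<Rightarrow> ('k::field) pol" where
  "xmon a \<equiv> Poly_Mapping.single a 1"

definition le_mon :: "mon \<Rightarrow> mon \<Rightarrow> bool" where
  "le_mon a b \<longleftrightarrow> (\<forall>x. Poly_Mapping.lookup a x \<le> Poly_Mapping.lookup b x)"

definition mons :: "nat \<Rightarrow> nat \<Rightarrow> mon set" where
  "mons c n = {a. Poly_Mapping.keys a \<subseteq> {1..c} \<times> {1..n}}"

definition exps :: "('k::field) pol set \<Rightarrow> mon set" where
  "exps J = {a. xmon a \<in> J}"

text \<open>The effect of \<open>act\<close> on exponent vectors. Exponents add up where \<pi>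
  merges columns, so single exponents can be read off only if \<pi> is injective on the columns that
  occur.\<close>

definition shift :: "(nat \<Rightarrow> nat) \<Rightarrow> mon \<Rightarrow> mon" where
  "shift \<pi> a = (\<Sum>x\<in>Poly_Mapping.keys a. Poly_Mapping.single (fst x, \<pi> (snd x)) (Poly_Mapping.lookup a x))"

lemma le_monD: "le_mon a b \<Longrightarrow> Poly_Mapping.lookup a x \<le> Poly_Mapping.lookup b x"
  unfolding le_mon_def by blast

lemma le_mon_iff_add: "le_mon a b \<longleftrightarrow> (\<exists>d. b = a + d)"
proof
  assume "le_mon a b"
  then have "Poly_Mapping.lookup a x \<le> Poly_Mapping.lookup b x" for x
    unfolding le_mon_def by blast
  then have "b = a + (b - a)"
    by (intro poly_mapping_eqI) (simp add: lookup_add lookup_minus)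
  then show "\<exists>d. b = a + d" ..
qed (auto simp: le_mon_def lookup_add)

lemma le_mon_refl: "le_mon a a" by (simp add: le_mon_def)

lemma le_mon_trans: "le_mon a b \<Longrightarrow> le_mon b d \<Longrightarrow> le_mon a d"
  unfolding le_mon_def using order_trans by blast

lemma le_mon_keys: "le_mon a b \<Longrightarrow> Poly_Mapping.keys a \<subseteq> Poly_Mapping.keys b"
  unfolding le_mon_def in_keys_iff subset_iff by (metis le_zero_eq)

lemma keys_add_mon:
  "Poly_Mapping.keys (a + b :: mon) = Poly_Mapping.keys a \<union> Poly_Mapping.keys b"
  by (auto simp: in_keys_iff lookup_add)

lemma mons_add: "a + b \<in> mons c n \<longleftrightarrow> a \<in> mons c n \<and> b \<in> mons c n"
  by (auto simp: mons_def keys_add_mon)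

lemma mons_zero: "0 \<in> mons c n" by (simp add: mons_def)

lemma mons_mono: "m \<le> n \<Longrightarrow> mons c m \<subseteq> mons c n"
  by (fastforce simp: mons_def)

lemma xmon_mult: "xmon a * xmon b = (xmon (a + b) :: ('k::field) pol)"
  by (simp add: mult_single)

lemma poly_expand: "f = (\<Sum>a\<in>Poly_Mapping.keys f. Poly_Mapping.single a (Poly_Mapping.lookup f a))"
proof (rule poly_mapping_eqI)
  fix b
  have "Poly_Mapping.lookup (\<Sum>a\<in>Poly_Mapping.keys f. Poly_Mapping.single a (Poly_Mapping.lookup f a)) b
    = (\<Sum>a\<in>Poly_Mapping.keys f. if a = b then Poly_Mapping.lookup f a else 0)"
    by (simp add: lookup_sum lookup_single when_def)
  then show "Poly_Mapping.lookup f b =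
      Poly_Mapping.lookup (\<Sum>a\<in>Poly_Mapping.keys f. Poly_Mapping.single a (Poly_Mapping.lookup f a)) b"
    by (simp add: not_in_keys_iff_lookup_eq_zero)
qed

lemma lookup_xmon_mult:
  fixes f :: "('k::field) pol"
  shows "Poly_Mapping.lookup (xmon e * f) b =
    (if le_mon e b then Poly_Mapping.lookup f (b - e) else 0)"
proof -
  have "xmon e * f = (\<Sum>a\<in>Poly_Mapping.keys f. Poly_Mapping.single (e + a) (Poly_Mapping.lookup f a))"
    by (subst poly_expand[of f]) (simp add: sum_distrib_left mult_single)
  then have "Poly_Mapping.lookup (xmon e * f) b =
      (\<Sum>a\<in>Poly_Mapping.keys f. if e + a = b then Poly_Mapping.lookup f a else 0)"
    by (simp add: lookup_sum lookup_single when_def)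
  also have "\<dots> = (if le_mon e b then Poly_Mapping.lookup f (b - e) else 0)"
  proof (cases "le_mon e b")
    case True
    then have "e + a = b \<longleftrightarrow> a = b - e" for a by (auto simp: le_mon_iff_add)
    then show ?thesis using True by (auto simp: not_in_keys_iff_lookup_eq_zero)
  next
    case False
    then have "e + a \<noteq> b" for a by (auto simp: le_mon_iff_add)
    then show ?thesis using False by simp
  qed
  finally show ?thesis .
qed

lemma keys_xmon_mult:
  "Poly_Mapping.keys (xmon e * f :: ('k::field) pol) = (+) e ` Poly_Mapping.keys f"
proof (rule equalityI; rule subsetI)
  fix b assume "b \<in> Poly_Mapping.keys (xmon e * f)"
  then have "le_mon e b" "b - e \<in> Poly_Mapping.keys f"
    by (auto simp: in_keys_iff lookup_xmon_mult split: if_splits)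
  then show "b \<in> (+) e ` Poly_Mapping.keys f" by (auto simp: le_mon_iff_add)
next
  fix b assume "b \<in> (+) e ` Poly_Mapping.keys f"
  then obtain a where "a \<in> Poly_Mapping.keys f" "b = e + a" by auto
  moreover then have "le_mon e b" by (auto simp: le_mon_iff_add)
  ultimately show "b \<in> Poly_Mapping.keys (xmon e * f)"
    by (auto simp: in_keys_iff lookup_xmon_mult)
qed

lemma xmon_dvd_iff: "(xmon a :: ('k::field) pol) dvd xmon b \<longleftrightarrow> le_mon a b"
proof
  assume "(xmon a :: 'k pol) dvd xmon b"
  then obtain q :: "'k pol" where "xmon b = xmon a * q" by (elim dvdE)
  then have "Poly_Mapping.keys (xmon b :: 'k pol) = (+) a ` Poly_Mapping.keys q"
    using keys_xmon_mult by metis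
  then have "{b} = (+) a ` Poly_Mapping.keys q" by simp
  then have "b \<in> (+) a ` Poly_Mapping.keys q" by blast
  then show "le_mon a b" by (auto simp: le_mon_iff_add)
next
  assume "le_mon a b"
  then obtain d where "b = a + d" by (auto simp: le_mon_iff_add)
  then have "(xmon b :: 'k pol) = xmon a * xmon d" by (simp add: mult_single)
  then show "(xmon a :: 'k pol) dvd xmon b" by (rule dvdI)
qed

lemma xmon_inject [simp]: "(xmon a :: ('k::field) pol) = xmon b \<longleftrightarrow> a = b"
  by (metis keys_single singleton_inject zero_neq_one)

lemma var_dvd_xmon: "(var k j :: ('k::field) pol) dvd xmon a \<longleftrightarrow> (k, j) \<in> Poly_Mapping.keys a"
  unfolding var_def xmon_dvd_iff by (auto simp: le_mon_def lookup_single when_def in_keys_iff)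

lemma monomials_eq: "monomials = range xmon"
  by (auto simp: monomials_def)

lemma mon_min_gt_iff:
  assumes "a \<noteq> 0"
  shows "mon_min (xmon a :: ('k::field) pol) > i \<longleftrightarrow> (\<forall>x\<in>Poly_Mapping.keys a. i < snd x)"
proof -
  have "{j. \<exists>k. (var k j :: 'k pol) dvd xmon a} = snd ` Poly_Mapping.keys a"
    by (force simp: var_dvd_xmon)
  moreover have "Poly_Mapping.keys a \<noteq> {}" using assms by (metis keys_zero poly_expand sum.empty)
  ultimately show ?thesis by (simp add: mon_min_def)
qed

lemma mon_max_le_iff:
  assumes "a \<noteq> 0"
  shows "mon_max (xmon a :: ('k::field) pol) \<le> i \<longleftrightarrow> (\<forall>x\<in>Poly_Mapping.keys a. snd x \<le> i)"
proof -
  have "{j. \<exists>k. (var k j :: 'k pol) dvd xmon a} = snd ` Poly_Mapping.keys a"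
    by (force simp: var_dvd_xmon)
  moreover have "Poly_Mapping.keys a \<noteq> {}" using assms by (metis keys_zero poly_expand sum.empty)
  ultimately show ?thesis by (simp add: mon_max_def)
qed

lemma covers_xmon:
  assumes "a \<in> mons c n"
  shows "covers C (xmon a :: ('k::field) pol) \<longleftrightarrow> (\<exists>x\<in>Poly_Mapping.keys a. fst x \<in> C)"
  using assms unfolding covers_def mons_def by (force simp: var_dvd_xmon)

section \<open>The polynomial rings and their ideals as sets of exponents\<close>

lemma Rn_set_eq: "Rn_set c n = {f. Poly_Mapping.keys f \<subseteq> mons c n}"
  by (auto simp: Rn_set_def mons_def)

lemma Rn_set_xmon [simp]: "(xmon a :: ('k::field) pol) \<in> Rn_set c n \<longleftrightarrow> a \<in> mons c n"
  by (simp add: Rn_set_eq)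

lemma Rn_set_single: "a \<in> mons c n \<Longrightarrow> Poly_Mapping.single a s \<in> Rn_set c n"
  by (auto simp: Rn_set_eq)

lemma Rn_set_zero: "0 \<in> Rn_set c n"
  by (simp add: Rn_set_eq)

lemma Rn_set_one: "1 \<in> Rn_set c n"
  by (simp add: Rn_set_eq mons_zero)

lemma Rn_set_add: "f \<in> Rn_set c n \<Longrightarrow> g \<in> Rn_set c n \<Longrightarrow> f + g \<in> Rn_set c n"
  using Poly_Mapping.keys_add[of f g] by (auto simp: Rn_set_eq)

lemma Rn_set_mult: "f \<in> Rn_set c n \<Longrightarrow> g \<in> Rn_set c n \<Longrightarrow> f * g \<in> Rn_set c n"
  using keys_mult[of f g] by (fastforce simp: Rn_set_eq mons_add)

lemma Rn_set_uminus: "f \<in> Rn_set c n \<Longrightarrow> - f \<in> Rn_set c n"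
  by (simp add: Rn_set_eq)

lemma cring_Rn: "cring (Rn c n :: ('k::field) pol ring)"
proof (rule cringI)
  show "abelian_group (Rn c n :: 'k pol ring)"
  proof (rule abelian_groupI)
    fix f :: "'k pol" assume "f \<in> carrier (Rn c n)"
    then show "\<exists>g\<in>carrier (Rn c n). g \<oplus>\<^bsub>Rn c n\<^esub> f = \<zero>\<^bsub>Rn c n\<^esub>"
      by (intro bexI[of _ "- f"]) (auto simp: Rn_def Rn_set_uminus)
  qed (auto simp: Rn_def Rn_set_add algebra_simps Rn_set_zero)
  show "comm_monoid (Rn c n :: 'k pol ring)"
    by (intro comm_monoidI) (simp_all add: Rn_def Rn_set_mult Rn_set_one algebra_simps)
qed (auto simp: Rn_def algebra_simps)

lemma ideal_RnD:
  fixes J :: "('k::field) pol set"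
  assumes "ideal J (Rn c n)"
  shows "0 \<in> J" "f \<in> J \<Longrightarrow> g \<in> J \<Longrightarrow> f + g \<in> J" "f \<in> J \<Longrightarrow> g \<in> Rn_set c n \<Longrightarrow> g * f \<in> J"
    "J \<subseteq> Rn_set c n"
proof -
  interpret ideal J "Rn c n" by fact
  show "0 \<in> J" using additive_subgroup.zero_closed[OF is_additive_subgroup] by (simp add: Rn_def)
  show "f \<in> J \<Longrightarrow> g \<in> J \<Longrightarrow> f + g \<in> J" using additive_subgroup.a_closed[OF is_additive_subgroup] by (simp add: Rn_def)
  show "f \<in> J \<Longrightarrow> g \<in> Rn_set c n \<Longrightarrow> g * f \<in> J" using I_l_closed by (simp add: Rn_def)
  show "J \<subseteq> Rn_set c n" using additive_subgroup.a_subset[OF is_additive_subgroup] by (simp add: Rn_def)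
qed

lemma ideal_Rn_sum:
  fixes J :: "('k::field) pol set"
  assumes "ideal J (Rn c n)" "\<And>a. a \<in> A \<Longrightarrow> f a \<in> J"
  shows "sum f A \<in> J"
  using assms(2) ideal_RnD(1,2)[OF assms(1)] by (induction A rule: infinite_finite_induct) auto

lemma ideal_Rn_of_exps:
  fixes J :: "('k::field) pol set"
  assumes "ideal J (Rn c n)" "Poly_Mapping.keys f \<subseteq> exps J"
  shows "f \<in> J"
proof -
  have "Poly_Mapping.single a (Poly_Mapping.lookup f a) \<in> J" if "a \<in> Poly_Mapping.keys f" for a
  proof -
    have "Poly_Mapping.single a (Poly_Mapping.lookup f a)
        = Poly_Mapping.single 0 (Poly_Mapping.lookup f a) * xmon a" by (simp add: mult_single)
    moreover have "xmon a \<in> J" using that assms(2) by (auto simp: exps_def)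
    ultimately show ?thesis
      using ideal_RnD(3)[OF assms(1)] Rn_set_single[OF mons_zero] by metis
  qed
  then show ?thesis using ideal_Rn_sum[OF assms(1)] poly_expand[of f] by metis
qed

lemma exps_ideal:
  fixes J :: "('k::field) pol set"
  assumes "ideal J (Rn c n)"
  shows "exps J \<subseteq> mons c n" "a \<in> exps J \<Longrightarrow> le_mon a b \<Longrightarrow> b \<in> mons c n \<Longrightarrow> b \<in> exps J"
proof -
  show "exps J \<subseteq> mons c n" using ideal_RnD(4)[OF assms] by (auto simp: exps_def)
  assume a: "a \<in> exps J" "le_mon a b" "b \<in> mons c n"
  then obtain d where d: "b = d + a" by (auto simp: le_mon_iff_add add.commute)
  then have "(xmon d :: 'k pol) \<in> Rn_set c n" using a by (simp add: mons_add)
  then have "xmon d * xmon a \<in> J" using a ideal_RnD(3)[OF assms] by (simp add: exps_def)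
  then show "b \<in> exps J" by (simp add: exps_def d mult_single)
qed

lemma ideal_of_upset:
  assumes "\<And>a b. a \<in> U \<Longrightarrow> b \<in> mons c n \<Longrightarrow> b + a \<in> U"
  shows "ideal {f \<in> Rn_set c n. Poly_Mapping.keys f \<subseteq> U} (Rn c n :: ('k::field) pol ring)"
proof (rule idealI)
  interpret cring "Rn c n :: 'k pol ring" by (rule cring_Rn)
  show "ring (Rn c n :: 'k pol ring)" by (rule ring_axioms)
  have inv: "\<ominus>\<^bsub>Rn c n\<^esub> f = - f" if "f \<in> Rn_set c n" for f :: "'k pol"
    using that by (intro minus_equality) (auto simp: Rn_def Rn_set_uminus)
  show "subgroup {f \<in> Rn_set c n. Poly_Mapping.keys f \<subseteq> U} (add_monoid (Rn c n :: 'k pol ring))"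
  proof (rule add.subgroupI)
    show "{f \<in> Rn_set c n. Poly_Mapping.keys f \<subseteq> U} \<subseteq> carrier (Rn c n :: 'k pol ring)"
      by (auto simp: Rn_def)
    show "{f \<in> Rn_set c n. Poly_Mapping.keys f \<subseteq> U} \<noteq> ({} :: 'k pol set)"
      by (auto simp: Rn_set_eq intro!: exI[of _ 0])
    show "\<ominus>\<^bsub>Rn c n\<^esub> f \<in> {f \<in> Rn_set c n. Poly_Mapping.keys f \<subseteq> U}"
      if "f \<in> {f \<in> Rn_set c n. Poly_Mapping.keys f \<subseteq> U}" for f :: "'k pol"
      using that inv by (simp add: Rn_set_uminus)
    show "f \<oplus>\<^bsub>Rn c n\<^esub> g \<in> {f \<in> Rn_set c n. Poly_Mapping.keys f \<subseteq> U}"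
      if "f \<in> {f \<in> Rn_set c n. Poly_Mapping.keys f \<subseteq> U}"
        "g \<in> {f \<in> Rn_set c n. Poly_Mapping.keys f \<subseteq> U}" for f g :: "'k pol"
      using that Poly_Mapping.keys_add[of f g] Rn_set_add[of f c n g] by (auto simp: Rn_def)
  qed
  have cl: "g * f \<in> {f \<in> Rn_set c n. Poly_Mapping.keys f \<subseteq> U}"
    if "f \<in> {f \<in> Rn_set c n. Poly_Mapping.keys f \<subseteq> U}" "g \<in> Rn_set c n" for f g :: "'k pol"
  proof -
    have "a \<in> U" if a: "a \<in> Poly_Mapping.keys (g * f)" for a
    proof -
      obtain p q where "p \<in> Poly_Mapping.keys g" "q \<in> Poly_Mapping.keys f" "a = p + q"
        using a keys_mult[of g f] by blast
      then show ?thesis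
        using assms[of q p] \<open>f \<in> _\<close> \<open>g \<in> _\<close> by (auto simp: Rn_set_eq)
    qed
    then show ?thesis using that Rn_set_mult by blast
  qed
  then show "g \<otimes>\<^bsub>Rn c n\<^esub> f \<in> {f \<in> Rn_set c n. Poly_Mapping.keys f \<subseteq> U}"
    if "f \<in> {f \<in> Rn_set c n. Poly_Mapping.keys f \<subseteq> U}" "g \<in> carrier (Rn c n)" for f g :: "'k pol"
    using that by (simp add: Rn_def)
  from cl show "f \<otimes>\<^bsub>Rn c n\<^esub> g \<in> {f \<in> Rn_set c n. Poly_Mapping.keys f \<subseteq> U}"
    if "f \<in> {f \<in> Rn_set c n. Poly_Mapping.keys f \<subseteq> U}" "g \<in> carrier (Rn c n)" for f g :: "'k pol"
    using that by (simp add: Rn_def mult.commute)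
qed

text \<open>The polynomials all of whose terms are multiples of members of \<open>T\<close> form an
  ideal; it contains \<open>S\<close>, hence also the ideal generated by \<open>S\<close>.\<close>

lemma genideal_exps:
  fixes S :: "('k::field) pol set"
  assumes "S \<subseteq> Rn_set c n"
    and "\<And>f a. f \<in> S \<Longrightarrow> a \<in> Poly_Mapping.keys f \<Longrightarrow> \<exists>s\<in>T. le_mon s a"
    and "f \<in> Idl\<^bsub>Rn c n\<^esub> S" and "a \<in> Poly_Mapping.keys f"
  shows "\<exists>s\<in>T. le_mon s a"
proof -
  interpret cring "Rn c n :: 'k pol ring" by (rule cring_Rn)
  define U where "U = {a. \<exists>s\<in>T. le_mon s a}"
  have "le_mon a (b + a)" for a b by (auto simp: le_mon_iff_add add.commute)
  then have "ideal {f \<in> Rn_set c n. Poly_Mapping.keys f \<subseteq> U} (Rn c n :: 'k pol ring)"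
    unfolding U_def by (intro ideal_of_upset) (blast intro: le_mon_trans)
  moreover have "S \<subseteq> {f \<in> Rn_set c n. Poly_Mapping.keys f \<subseteq> U}"
    using assms(1,2) by (auto simp: U_def)
  ultimately have "Idl\<^bsub>Rn c n\<^esub> S \<subseteq> {f \<in> Rn_set c n. Poly_Mapping.keys f \<subseteq> U}"
    by (rule genideal_minimal)
  then show ?thesis using assms(3,4) by (auto simp: U_def)
qed

lemma Rn_genideal:
  fixes S :: "('k::field) pol set"
  assumes "S \<subseteq> Rn_set c n"
  shows "ideal (Idl\<^bsub>Rn c n\<^esub> S) (Rn c n)" "S \<subseteq> Idl\<^bsub>Rn c n\<^esub> S"
proof -
  interpret cring "Rn c n :: 'k pol ring" by (rule cring_Rn)
  show "ideal (Idl\<^bsub>Rn c n\<^esub> S) (Rn c n)" "S \<subseteq> Idl\<^bsub>Rn c n\<^esub> S"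
    using genideal_ideal genideal_self assms by (auto simp: Rn_def)
qed

text \<open>The working form of being a monomial ideal: every term of an element is again in the
  ideal, up to its coefficient. No generating set is mentioned, so the property passes to colon
  ideals directly.\<close>

definition has_exps :: "nat \<Rightarrow> nat \<Rightarrow> ('k::field) pol set \<Rightarrow> bool" where
  "has_exps c n J \<longleftrightarrow> ideal J (Rn c n) \<and> (\<forall>f\<in>J. Poly_Mapping.keys f \<subseteq> exps J)"

lemma monomial_ideal_has_exps:
  fixes J :: "('k::field) pol set"
  assumes "monomial_ideal c n J"
  shows "has_exps c n J"
  unfolding has_exps_def
proof (intro conjI ballI subsetI)
  from assms show I: "ideal J (Rn c n)" by (simp add: monomial_ideal_def)
  from assms obtain S where S: "S \<subseteq> monomials \<inter> Rn_set c n" "J = Idl\<^bsub>Rn c n\<^esub> S"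
    by (auto simp: monomial_ideal_def)
  fix f a assume f: "f \<in> J" "a \<in> Poly_Mapping.keys f"
  have "\<exists>s\<in>exps S. le_mon s a"
  proof (rule genideal_exps[of S c n])
    show "\<exists>s\<in>exps S. le_mon s a" if h: "f \<in> S" "a \<in> Poly_Mapping.keys f" for f a
    proof -
      obtain b where "f = xmon b" using h(1) S(1) unfolding monomials_def by blast
      with h show ?thesis using le_mon_refl by (auto simp: exps_def)
    qed
  qed (use S f in auto)
  then obtain s where s: "xmon s \<in> S" "le_mon s a" by (auto simp: exps_def)
  have "xmon s \<in> J" using s S Rn_genideal(2)[of S c n] by auto
  moreover have "a \<in> mons c n" using f ideal_RnD(4)[OF I] by (auto simp: Rn_set_eq)
  ultimately show "a \<in> exps J" using exps_ideal(2)[OF I _ s(2)] by (simp add: exps_def)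
qed

lemma genideal_xmon_eq:
  fixes J :: "('k::field) pol set"
  assumes "has_exps c n J" and "T \<subseteq> exps J" and "\<And>a. a \<in> exps J \<Longrightarrow> \<exists>t\<in>T. le_mon t a"
  shows "Idl\<^bsub>Rn c n\<^esub> (xmon ` T) = J"
proof -
  interpret cring "Rn c n :: 'k pol ring" by (rule cring_Rn)
  have I: "ideal J (Rn c n)" using assms(1) by (simp add: has_exps_def)
  have T: "(xmon ` T :: 'k pol set) \<subseteq> Rn_set c n" using assms(2) exps_ideal(1)[OF I] by auto
  have "Idl\<^bsub>Rn c n\<^esub> (xmon ` T) \<subseteq> J"
    using assms(2) by (intro genideal_minimal I) (auto simp: exps_def)
  moreover have "f \<in> Idl\<^bsub>Rn c n\<^esub> (xmon ` T)" if "f \<in> J" for f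
  proof (rule ideal_Rn_of_exps[OF Rn_genideal(1)[OF T]])
    show "Poly_Mapping.keys f \<subseteq> exps (Idl\<^bsub>Rn c n\<^esub> (xmon ` T) :: 'k pol set)"
    proof
      fix a assume "a \<in> Poly_Mapping.keys f"
      then have a: "a \<in> exps J" using that assms(1) by (auto simp: has_exps_def)
      then obtain t where t: "t \<in> T" "le_mon t a" using assms(3) by blast
      have e: "t \<in> exps (Idl\<^bsub>Rn c n\<^esub> (xmon ` T) :: 'k pol set)"
        using t Rn_genideal(2)[OF T] by (auto simp: exps_def)
      have am: "a \<in> mons c n" using a exps_ideal(1)[OF I] by (rule set_mp[rotated])
      show "a \<in> exps (Idl\<^bsub>Rn c n\<^esub> (xmon ` T) :: 'k pol set)"
        by (rule exps_ideal(2)[OF Rn_genideal(1)[OF T] e t(2) am])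
    qed
  qed
  ultimately show ?thesis by blast
qed

section \<open>Minimal generators and covers\<close>

definition deg :: "mon \<Rightarrow> nat" where
  "deg a = (\<Sum>x\<in>Poly_Mapping.keys a. Poly_Mapping.lookup a x)"

lemma deg_eq_sum:
  assumes "finite A" "Poly_Mapping.keys a \<subseteq> A"
  shows "deg a = (\<Sum>x\<in>A. Poly_Mapping.lookup a x)"
  unfolding deg_def using assms
  by (intro sum.mono_neutral_left) (auto simp: in_keys_iff)

lemma deg_less:
  assumes "le_mon a b" "a \<noteq> b"
  shows "deg a < deg b"
proof -
  obtain x where x: "Poly_Mapping.lookup a x \<noteq> Poly_Mapping.lookup b x"
    using assms(2) poly_mapping_eqI by metis
  then have "Poly_Mapping.lookup a x < Poly_Mapping.lookup b x"
    using le_monD[OF assms(1), of x] by simp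
  then show ?thesis
    unfolding deg_def[of b] deg_eq_sum[OF finite_keys le_mon_keys[OF assms(1)]]
    using le_monD[OF assms(1)] by (intro sum_strict_mono_ex1) (auto simp: in_keys_iff intro!: bexI[of _ x])
qed

definition min_exps :: "('k::field) pol set \<Rightarrow> mon set" where
  "min_exps J = {a \<in> exps J. \<forall>b\<in>exps J. le_mon b a \<longrightarrow> b = a}"

lemma min_exps_below:
  assumes "a \<in> exps J"
  shows "\<exists>b\<in>min_exps J. le_mon b a"
proof -
  obtain b where b: "b \<in> exps J \<and> le_mon b a" "\<And>d. d \<in> exps J \<and> le_mon d a \<Longrightarrow> deg b \<le> deg d"
    using ex_has_least_nat[of "\<lambda>b. b \<in> exps J \<and> le_mon b a" a deg] assms le_mon_refl by blast
  have "d = b" if "d \<in> exps J" "le_mon d b" for d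
    using b(2)[of d] that b(1) deg_less[of d b] le_mon_trans[of d b a] by linarith
  with b(1) have "b \<in> min_exps J" unfolding min_exps_def by blast
  with b show ?thesis by blast
qed

text \<open>A set of monomials generating \<open>J\<close> contains a divisor of every monomial in
  \<open>J\<close>, and for a monomial minimal under divisibility this divisor is the monomial
  itself. The minimal monomials are thus contained in every monomial generating set, which justifies
  the \<open>THE\<close> in \<open>min_gens\<close>.\<close>

lemma min_gens_eq:
  fixes J :: "('k::field) pol set"
  assumes "has_exps c n J"
  shows "min_gens c n J = xmon ` min_exps J"
  unfolding min_gens_def
proof (rule the_equality)
  have I: "ideal J (Rn c n)" using assms by (simp add: has_exps_def)
  have gen: "Idl\<^bsub>Rn c n\<^esub> (xmon ` min_exps J) = J"
    using min_exps_below by (intro genideal_xmon_eq assms) (auto simp: min_exps_def)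
  have below: "\<exists>s\<in>exps H. le_mon s a"
    if H: "H \<subseteq> monomials \<inter> Rn_set c n" "Idl\<^bsub>Rn c n\<^esub> H = J" and a: "a \<in> exps J" for H a
  proof (rule genideal_exps[of H c n _ "xmon a"])
    show "\<exists>s\<in>exps H. le_mon s a" if h: "f \<in> H" "a \<in> Poly_Mapping.keys f" for f a
    proof -
      obtain b where "f = xmon b" using h(1) H(1) unfolding monomials_def by blast
      with h show ?thesis using le_mon_refl by (auto simp: exps_def)
    qed
  qed (use H a in \<open>auto simp: exps_def\<close>)
  have sub: "xmon ` min_exps J \<subseteq> H"
    if H: "H \<subseteq> monomials \<inter> Rn_set c n" "Idl\<^bsub>Rn c n\<^esub> H = J" for H
  proof
    fix u :: "'k pol" assume "u \<in> xmon ` min_exps J"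
    then obtain a where a: "a \<in> min_exps J" "u = xmon a" by auto
    then obtain s where s: "s \<in> exps H" "le_mon s a" using below[OF H] by (auto simp: min_exps_def)
    have "s \<in> exps J" using s H Rn_genideal(2)[of H c n] by (auto simp: exps_def)
    then have "s = a" using a s by (auto simp: min_exps_def)
    then show "u \<in> H" using a s by (auto simp: exps_def)
  qed
  have m: "xmon ` min_exps J \<subseteq> monomials \<inter> Rn_set c n"
    using exps_ideal(1)[OF I] by (auto simp: min_exps_def monomials_def)
  show "xmon ` min_exps J \<subseteq> monomials \<inter> Rn_set c n \<and> Idl\<^bsub>Rn c n\<^esub> (xmon ` min_exps J) = J \<and>
      (\<forall>H. H \<subset> xmon ` min_exps J \<longrightarrow> Idl\<^bsub>Rn c n\<^esub> H \<noteq> J)"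
  proof (intro conjI allI impI notI m gen)
    fix H assume H: "H \<subset> xmon ` min_exps J" "Idl\<^bsub>Rn c n\<^esub> H = J"
    then have "xmon ` min_exps J \<subseteq> H" using m by (intro sub) auto
    with H(1) show False by blast
  qed
  show "G = xmon ` min_exps J"
    if "G \<subseteq> monomials \<inter> Rn_set c n \<and> Idl\<^bsub>Rn c n\<^esub> G = J \<and> (\<forall>H. H \<subset> G \<longrightarrow> Idl\<^bsub>Rn c n\<^esub> H \<noteq> J)" for G
  proof (rule ccontr)
    assume "G \<noteq> xmon ` min_exps J"
    then have "xmon ` min_exps J \<subset> G" using sub[of G] that by blast
    with that gen show False by blast
  qed
qed

text \<open>A minimal divisor of a monomial uses a subset of its variables: it still lies beyond
  column \<open>i\<close>, and a row covering it covers the multiple too. Covers can therefore be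
  tested on all monomials of \<open>J\<close>, which removes minimal generators from the treatment
  of \<gamma>. Properness keeps away the monomial 1, at which \<open>mon_min\<close> is a minimum
  over the empty set.\<close>

lemma i_cover_iff:
  fixes J :: "('k::field) pol set"
  assumes "has_exps c n J" "0 \<notin> exps J"
  shows "i_cover c n i J C \<longleftrightarrow> C \<subseteq> {1..c} \<and>
    (\<forall>a\<in>exps J. (\<forall>x\<in>Poly_Mapping.keys a. i < snd x) \<longrightarrow> (\<exists>x\<in>Poly_Mapping.keys a. fst x \<in> C))"
proof -
  have I: "ideal J (Rn c n)" using assms by (simp add: has_exps_def)
  have pos: "gens_pos c n i J = xmon ` {a \<in> min_exps J. \<forall>x\<in>Poly_Mapping.keys a. i < snd x}"
  proof -
    have "a \<noteq> 0" if "a \<in> min_exps J" for a using that assms(2) by (auto simp: min_exps_def)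
    then show ?thesis unfolding gens_pos_def min_gens_eq[OF assms(1)] by (auto simp: mon_min_gt_iff)
  qed
  have cov: "covers C (xmon a :: 'k pol) \<longleftrightarrow> (\<exists>x\<in>Poly_Mapping.keys a. fst x \<in> C)" if "a \<in> exps J" for a
    using that exps_ideal(1)[OF I] covers_xmon by blast
  have "(\<forall>u\<in>gens_pos c n i J. covers C u) \<longleftrightarrow>
    (\<forall>a\<in>min_exps J. (\<forall>x\<in>Poly_Mapping.keys a. i < snd x) \<longrightarrow> (\<exists>x\<in>Poly_Mapping.keys a. fst x \<in> C))"
    unfolding pos using cov by (auto simp: min_exps_def)
  also have "\<dots> \<longleftrightarrow>
    (\<forall>a\<in>exps J. (\<forall>x\<in>Poly_Mapping.keys a. i < snd x) \<longrightarrow> (\<exists>x\<in>Poly_Mapping.keys a. fst x \<in> C))"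
    (is "?L \<longleftrightarrow> ?R")
  proof
    assume L: ?L
    show ?R
    proof (intro ballI impI)
      fix a assume a: "a \<in> exps J" "\<forall>x\<in>Poly_Mapping.keys a. i < snd x"
      then obtain b where b: "b \<in> min_exps J" "le_mon b a" using min_exps_below by blast
      with L a le_mon_keys[OF b(2)] show "\<exists>x\<in>Poly_Mapping.keys a. fst x \<in> C" by blast
    qed
  qed (auto simp: min_exps_def)
  finally show ?thesis unfolding i_cover_def by blast
qed

section \<open>The action of increasing maps on exponents\<close>

lemma xmon_prod: "(\<Prod>x\<in>A. xmon (g x) :: ('k::field) pol) = xmon (\<Sum>x\<in>A. g x)"
  by (induction A rule: infinite_finite_induct) (auto simp: mult_single)

lemma var_power: "(var k j :: ('k::field) pol) ^ m = xmon (Poly_Mapping.single (k, j) m)"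
  by (induction m) (auto simp: var_def mult_single simp flip: single_add)

lemma act_eq:
  "act \<pi> (f :: ('k::field) pol) =
    (\<Sum>a\<in>Poly_Mapping.keys f. Poly_Mapping.single (shift \<pi> a) (Poly_Mapping.lookup f a))"
  unfolding act_def
proof (rule sum.cong[OF refl])
  fix a
  have "(\<Prod>(k, j)\<in>Poly_Mapping.keys a. (var k (\<pi> j) :: 'k pol) ^ Poly_Mapping.lookup a (k, j)) = xmon (shift \<pi> a)"
    unfolding shift_def by (simp add: var_power case_prod_beta xmon_prod)
  then show "Poly_Mapping.single 0 (Poly_Mapping.lookup f a) *
      (\<Prod>(k, j)\<in>Poly_Mapping.keys a. (var k (\<pi> j) :: 'k pol) ^ Poly_Mapping.lookup a (k, j)) =
      Poly_Mapping.single (shift \<pi> a) (Poly_Mapping.lookup f a)"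
    by (simp add: mult_single)
qed

lemma act_xmon: "act \<pi> (xmon a :: ('k::field) pol) = xmon (shift \<pi> a)"
  by (simp add: act_eq)

lemma keys_act:
  "Poly_Mapping.keys (act \<pi> (f :: ('k::field) pol)) \<subseteq> shift \<pi> ` Poly_Mapping.keys f"
proof
  fix y assume "y \<in> Poly_Mapping.keys (act \<pi> f)"
  then have "(\<Sum>a\<in>Poly_Mapping.keys f.
      Poly_Mapping.lookup (Poly_Mapping.single (shift \<pi> a) (Poly_Mapping.lookup f a)) y) \<noteq> 0"
    by (simp add: act_eq in_keys_iff lookup_sum)
  then obtain a where "a \<in> Poly_Mapping.keys f"
    "Poly_Mapping.lookup (Poly_Mapping.single (shift \<pi> a) (Poly_Mapping.lookup f a)) y \<noteq> 0"
    by (rule sum.not_neutral_contains_not_neutral)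
  then show "y \<in> shift \<pi> ` Poly_Mapping.keys f"
    by (auto simp: lookup_single when_def split: if_splits)
qed

lemma shift_eq_sum:
  assumes "finite A" "Poly_Mapping.keys a \<subseteq> A"
  shows "shift \<pi> a = (\<Sum>x\<in>A. Poly_Mapping.single (fst x, \<pi> (snd x)) (Poly_Mapping.lookup a x))"
  unfolding shift_def using assms by (intro sum.mono_neutral_left) (auto simp: in_keys_iff)

lemma shift_add: "shift \<pi> (a + b) = shift \<pi> a + shift \<pi> b"
proof -
  let ?A = "Poly_Mapping.keys a \<union> Poly_Mapping.keys b"
  have "shift \<pi> (a + b) = (\<Sum>x\<in>?A. Poly_Mapping.single (fst x, \<pi> (snd x)) (Poly_Mapping.lookup (a + b) x))"
    by (rule shift_eq_sum) (auto simp: keys_add_mon)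
  also have "\<dots> = (\<Sum>x\<in>?A. Poly_Mapping.single (fst x, \<pi> (snd x)) (Poly_Mapping.lookup a x)) +
      (\<Sum>x\<in>?A. Poly_Mapping.single (fst x, \<pi> (snd x)) (Poly_Mapping.lookup b x))"
    by (simp add: lookup_add single_add sum.distrib)
  also have "\<dots> = shift \<pi> a + shift \<pi> b"
    by (subst (1 2) shift_eq_sum[symmetric]) auto
  finally show ?thesis .
qed

lemma shift_zero [simp]: "shift \<pi> 0 = 0" by (simp add: shift_def)

lemma shift_single: "shift \<pi> (Poly_Mapping.single x m) = Poly_Mapping.single (fst x, \<pi> (snd x)) m"
  by (simp add: shift_def)

lemma shift_sum: "shift \<pi> (sum g A) = (\<Sum>x\<in>A. shift \<pi> (g x))"
  by (induction A rule: infinite_finite_induct) (auto simp: shift_add)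

lemma shift_shift: "shift \<sigma> (shift \<tau> a) = shift (\<sigma> \<circ> \<tau>) a"
  unfolding shift_def[of \<tau>] shift_sum shift_single by (simp add: shift_def)

lemma shift_cong:
  assumes "\<And>x. x \<in> Poly_Mapping.keys a \<Longrightarrow> \<pi> (snd x) = \<sigma> (snd x)"
  shows "shift \<pi> a = shift \<sigma> a"
  unfolding shift_def using assms by (intro sum.cong) auto

lemma shift_id: "shift id a = a"
  unfolding shift_def using poly_expand[of a] by simp

lemma shift_fixed:
  assumes "\<And>x. x \<in> Poly_Mapping.keys a \<Longrightarrow> \<pi> (snd x) = snd x"
  shows "shift \<pi> a = a"
  using shift_cong[of a \<pi> id] assms shift_id by simp

lemma keys_shift: "Poly_Mapping.keys (shift \<pi> a) = (\<lambda>x. (fst x, \<pi> (snd x))) ` Poly_Mapping.keys a"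
proof -
  have "y \<in> Poly_Mapping.keys (shift \<pi> a) \<longleftrightarrow> (\<exists>x\<in>Poly_Mapping.keys a. y = (fst x, \<pi> (snd x)))" for y
  proof -
    have "Poly_Mapping.lookup (shift \<pi> a) y =
      (\<Sum>x\<in>Poly_Mapping.keys a. if (fst x, \<pi> (snd x)) = y then Poly_Mapping.lookup a x else 0)"
      by (simp add: shift_def lookup_sum lookup_single when_def)
    then show ?thesis by (auto simp: in_keys_iff)
  qed
  then show ?thesis by blast
qed

lemma lookup_shift:
  assumes "inj_on \<pi> (snd ` Poly_Mapping.keys a)" "x \<in> Poly_Mapping.keys a"
  shows "Poly_Mapping.lookup (shift \<pi> a) (fst x, \<pi> (snd x)) = Poly_Mapping.lookup a x"
proof -
  have "Poly_Mapping.lookup (shift \<pi> a) (fst x, \<pi> (snd x)) =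
    (\<Sum>y\<in>Poly_Mapping.keys a. if (fst y, \<pi> (snd y)) = (fst x, \<pi> (snd x)) then Poly_Mapping.lookup a y else 0)"
    by (simp add: shift_def lookup_sum lookup_single when_def)
  also have "\<dots> = (\<Sum>y\<in>Poly_Mapping.keys a. if y = x then Poly_Mapping.lookup a y else 0)"
    using assms by (intro sum.cong refl) (auto simp: prod_eq_iff inj_on_def)
  finally show ?thesis using assms(2) by simp
qed

section \<open>Higman's lemma and stabilization\<close>

lemma nat_nondecreasing_subseq:
  fixes f :: "nat \<Rightarrow> nat"
  shows "\<exists>g :: nat \<Rightarrow> nat. strict_mono g \<and> (\<forall>m n. m \<le> n \<longrightarrow> f (g m) \<le> f (g n))"
proof -
  obtain g where g: "strict_mono g" "monoseq (\<lambda>n. f (g n))" using seq_monosub by blast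
  from g(2) consider "incseq (\<lambda>n. f (g n))" | "decseq (\<lambda>n. f (g n))"
    by (auto simp: monoseq_iff)
  then show ?thesis
  proof cases
    case 1
    with g show ?thesis by (auto simp: incseq_def)
  next
    case 2
    \<comment> \<open>A decreasing sequence of natural numbers is constant from a position of its
      minimum on.\<close>
    obtain p where p: "\<And>n. f (g p) \<le> f (g n)"
      using ex_has_least_nat[of "\<lambda>_. True" 0 "\<lambda>n. f (g n)"] by blast
    have "f (g (m + p)) = f (g p)" for m
      using p[of "m + p"] decseqD[OF 2, of p "m + p"] by simp
    moreover have "strict_mono (\<lambda>m. g (m + p))"
      using g(1) by (simp add: strict_mono_def)
    ultimately show ?thesis by (intro exI[of _ "\<lambda>m. g (m + p)"]) simp
  qed
qed

lemma Dickson_subseq: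
  fixes f :: "nat \<Rightarrow> nat \<Rightarrow> nat"
  shows "\<exists>g :: nat \<Rightarrow> nat. strict_mono g \<and> (\<forall>m n. m \<le> n \<longrightarrow> (\<forall>k<N. f (g m) k \<le> f (g n) k))"
proof (induction N)
  case 0
  show ?case by (intro exI[of _ id]) (simp add: strict_mono_def)
next
  case (Suc N)
  then obtain g :: "nat \<Rightarrow> nat"
    where g: "strict_mono g" "\<And>m n k. m \<le> n \<Longrightarrow> k < N \<Longrightarrow> f (g m) k \<le> f (g n) k" by blast
  obtain h :: "nat \<Rightarrow> nat"
    where h: "strict_mono h" "\<And>m n. m \<le> n \<Longrightarrow> f (g (h m)) N \<le> f (g (h n)) N"
    using nat_nondecreasing_subseq[of "\<lambda>n. f (g n) N"] by blast
  have "f (g (h m)) k \<le> f (g (h n)) k" if "m \<le> n" "k < Suc N" for m n k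
    using that g(2)[of "h m" "h n" k] h(2)[of m n] strict_mono_less_eq[OF h(1)] by (cases "k = N") auto
  moreover have "strict_mono (\<lambda>m. g (h m))" using g(1) h(1) by (simp add: strict_mono_def)
  ultimately show ?case by (intro exI[of _ "\<lambda>m. g (h m)"]) blast
qed

text \<open>Nash-Williams' argument with a minimal bad sequence. The hypothesis on letters is the
  subsequence form of a well-quasi-order, because an infinite ascending sequence of first letters is
  needed, not merely one comparable pair.\<close>

lemma Higman:
  fixes P :: "'a \<Rightarrow> 'a \<Rightarrow> bool" and f :: "nat \<Rightarrow> 'a list"
  assumes P: "\<And>f :: nat \<Rightarrow> 'a. \<exists>g :: nat \<Rightarrow> nat. strict_mono g \<and> (\<forall>m n. m < n \<longrightarrow> P (f (g m)) (f (g n)))"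
  shows "\<exists>i j. i < j \<and> list_emb P (f i) (f j)"
proof (rule ccontr)
  define bad where "bad s \<longleftrightarrow> (\<forall>i j. i < j \<longrightarrow> \<not> list_emb P (s i) (s j))"
    for s :: "nat \<Rightarrow> 'a list"
  assume "\<not> ?thesis"
  then have f: "bad f" by (auto simp: bad_def)
  \<comment> \<open>One stage of the choice: the words before position \<open>n\<close> are kept,
    and the word at \<open>n\<close> becomes as short as any bad continuation allows.\<close>
  define Q where "Q n s s' \<longleftrightarrow> (\<forall>k<n. s' k = s k) \<and>
    (\<forall>t. bad t \<and> (\<forall>k<n. t k = s k) \<longrightarrow> length (s' n) \<le> length (t n))" for n s s'
  have "\<exists>S. \<forall>n. bad (S n) \<and> Q n (S n) (S (Suc n))"
  proof (rule dependent_nat_choice)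
    show "\<exists>s. bad s" using f by blast
    fix s n assume "bad s"
    then obtain s' where "bad s' \<and> (\<forall>k<n. s' k = s k)"
      "\<And>t. bad t \<and> (\<forall>k<n. t k = s k) \<Longrightarrow> length (s' n) \<le> length (t n)"
      using ex_has_least_nat[of "\<lambda>t. bad t \<and> (\<forall>k<n. t k = s k)" s "\<lambda>t. length (t n)"] by blast
    then show "\<exists>s'. bad s' \<and> Q n s s'" unfolding Q_def by blast
  qed
  then obtain S where S: "\<And>n. bad (S n)" "\<And>n. Q n (S n) (S (Suc n))" by blast
  \<comment> \<open>The diagonal of the stages. Each of its finite initial parts is shared with a
    bad sequence, so the diagonal is bad too.\<close>
  define m where "m n = S (Suc n) n" for n
  have agree: "S n k = m k" if "k < n" for n k
    using that
  proof (induction n)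
    case 0
    then show ?case by simp
  next
    case (Suc n)
    show ?case
    proof (cases "k = n")
      case True
      then show ?thesis by (simp add: m_def)
    next
      case False
      then have "S (Suc n) k = S n k" using Suc.prems S(2)[of n] by (simp add: Q_def)
      with Suc False show ?thesis by simp
    qed
  qed
  have m_emb: "\<not> list_emb P (m i) (m j)" if "i < j" for i j
  proof -
    have "\<not> list_emb P (S (Suc j) i) (S (Suc j) j)" using S(1)[of "Suc j"] that unfolding bad_def by blast
    then show ?thesis using that by (simp add: agree)
  qed
  have m_min: "length (m n) \<le> length (t n)" if "bad t" "\<And>k. k < n \<Longrightarrow> t k = m k" for t n
    using S(2)[of n] that agree unfolding Q_def m_def by metis
  have ne: "m n \<noteq> []" for n using m_emb[of n "Suc n"] by auto
  define a where "a n = hd (m n)" for n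
  define w where "w n = tl (m n)" for n
  have m: "m n = a n # w n" for n using ne by (simp add: a_def w_def)
  obtain g :: "nat \<Rightarrow> nat" where g: "strict_mono g" "\<And>p q. p < q \<Longrightarrow> P (a (g p)) (a (g q))"
    using P[of a] by blast
  \<comment> \<open>The words before position \<open>g 0\<close> are kept, followed by the tails
    along \<open>g\<close>. Restoring first letters would turn an embedding between members of
    \<open>t\<close> into one between members of \<open>m\<close>, so \<open>t\<close> is bad; but
    its word at \<open>g 0\<close> is shorter than minimality allows.\<close>
  define t where "t k = (if k < g 0 then m k else w (g (k - g 0)))" for k
  have g0: "g 0 \<le> g p" for p using g(1) by (simp add: strict_mono_less_eq)
  have "bad t"
    unfolding bad_def
  proof (intro allI impI notI)
    fix i j :: nat assume ij: "i < j" and e: "list_emb P (t i) (t j)"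
    consider "j < g 0" | "i < g 0" "g 0 \<le> j" | "g 0 \<le> i" using ij by linarith
    then show False
    proof cases
      case 1
      then show False using e ij m_emb by (simp add: t_def)
    next
      case 2
      then have "list_emb P (m i) (w (g (j - g 0)))" using e by (simp add: t_def)
      then have "list_emb P (m i) (m (g (j - g 0)))" by (subst m[of "g (j - g 0)"]) auto
      then show False using m_emb[of i "g (j - g 0)"] g0[of "j - g 0"] 2 by simp
    next
      case 3
      then have "list_emb P (w (g (i - g 0))) (w (g (j - g 0)))" using e ij by (simp add: t_def)
      moreover have lt: "i - g 0 < j - g 0" using 3 ij by linarith
      ultimately have "list_emb P (m (g (i - g 0))) (m (g (j - g 0)))"
        unfolding m[of "g (j - g 0)"] m[of "g (i - g 0)"] using g(2) by blast
      then show False using m_emb strict_monoD[OF g(1) lt] by blast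
    qed
  qed
  then have "length (m (g 0)) \<le> length (t (g 0))" by (rule m_min) (simp add: t_def)
  then show False using m[of "g 0"] by (simp add: t_def)
qed

lemma list_emb_strict_mono:
  assumes "list_emb P xs ys"
  shows "\<exists>\<pi>. strict_mono_on {..<length xs} \<pi> \<and>
    (\<forall>p<length xs. \<pi> p < length ys \<and> P (xs ! p) (ys ! \<pi> p))"
  using assms
proof (induction rule: list_emb.induct)
  case (list_emb_Nil ys)
  show ?case by (simp add: strict_mono_on_def)
next
  case (list_emb_Cons xs ys y)
  then obtain \<pi> where "strict_mono_on {..<length xs} \<pi>"
    "\<And>p. p < length xs \<Longrightarrow> \<pi> p < length ys \<and> P (xs ! p) (ys ! \<pi> p)" by blast
  then show ?case by (intro exI[of _ "\<lambda>p. Suc (\<pi> p)"]) (simp add: strict_mono_on_def)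
next
  case (list_emb_Cons2 x y xs ys)
  then obtain \<pi> where "strict_mono_on {..<length xs} \<pi>"
    "\<And>p. p < length xs \<Longrightarrow> \<pi> p < length ys \<and> P (xs ! p) (ys ! \<pi> p)" by blast
  with list_emb_Cons2(1) show ?case
    by (intro exI[of _ "\<lambda>p. case p of 0 \<Rightarrow> 0 | Suc p \<Rightarrow> Suc (\<pi> p)"])
      (auto simp: strict_mono_on_def split: nat.splits)
qed

section \<open>Increasing maps and their factorization\<close>

lemma IncD:
  assumes "\<pi> \<in> Inc i"
  shows "1 \<le> j \<Longrightarrow> 1 \<le> \<pi> j" "1 \<le> j \<Longrightarrow> j < k \<Longrightarrow> \<pi> j < \<pi> k" "1 \<le> j \<Longrightarrow> j \<le> i \<Longrightarrow> \<pi> j = j"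
  using assms by (auto simp: Inc_def strict_mono_on_def image_subset_iff)

lemma IncI:
  assumes "\<And>j. 1 \<le> j \<Longrightarrow> 1 \<le> \<pi> j" "\<And>j k. 1 \<le> j \<Longrightarrow> j < k \<Longrightarrow> \<pi> j < \<pi> k"
    "\<And>j. 1 \<le> j \<Longrightarrow> j \<le> i \<Longrightarrow> \<pi> j = j"
  shows "\<pi> \<in> Inc i"
  using assms by (auto simp: Inc_def strict_mono_on_def image_subset_iff)

lemma Inc_ge:
  assumes "\<pi> \<in> Inc i" "1 \<le> j"
  shows "j \<le> \<pi> j"
  using assms(2)
proof (induction j rule: dec_induct)
  case base
  then show ?case using IncD(1)[OF assms(1)] by blast
next
  case (step n)
  then show ?case using IncD(2)[OF assms(1), of n "Suc n"] by simp
qed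

lemma Inc_inj_on: "\<pi> \<in> Inc i \<Longrightarrow> inj_on \<pi> {1..}"
  unfolding Inc_def by (auto intro: strict_mono_on_imp_inj_on)

lemma Inc_mn_id: "m \<le> n \<Longrightarrow> id \<in> Inc_mn i m n"
  by (auto simp: Inc_mn_def intro!: IncI)

lemma Inc_mono: "\<pi> \<in> Inc i \<Longrightarrow> 1 \<le> j \<Longrightarrow> j \<le> k \<Longrightarrow> \<pi> j \<le> \<pi> k"
  using IncD(2)[of \<pi> i j k] by (cases "j = k") auto

text \<open>The map \<open>\<tau>\<close> leaves a gap at the first column that \<open>\<pi>\<close> moves.\<close>

lemma Inc_factor_step:
  assumes pi: "\<pi> \<in> Inc_mn i m n" and m: "1 \<le> m" "m < n"
  shows "\<exists>\<tau>\<in>Inc_mn i m (Suc m). \<exists>\<sigma>\<in>Inc_mn i (Suc m) n. \<forall>j\<in>{1..m}. \<sigma> (\<tau> j) = \<pi> j"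
proof (cases "\<pi> m = m")
  case True
  have P: "\<pi> \<in> Inc i" using pi by (simp add: Inc_mn_def)
  have "\<pi> j = j" if "j \<in> {1..m}" for j
  proof (rule ccontr)
    assume "\<pi> j \<noteq> j"
    then have lt: "j < \<pi> j" using Inc_ge[OF P, of j] that by simp
    \<comment> \<open>Once a strictly increasing map is ahead of the identity it stays ahead by at
      least the same amount, so it could not return to fix \<open>m\<close>.\<close>
    have "\<pi> j + (k - j) \<le> \<pi> k" if "j \<le> k" for k
      using that
    proof (induction k rule: dec_induct)
      case (step k)
      then show ?case using IncD(2)[OF P, of k "Suc k"] \<open>j \<in> {1..m}\<close> by simp
    qed simp
    from this[of m] lt True that show False by simp
  qed
  then show ?thesis using m Inc_mn_id[of m "Suc m" i] Inc_mn_id[of "Suc m" n i]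
    by (intro bexI[of _ id]) auto
next
  case False
  have P: "\<pi> \<in> Inc i" and pm: "\<pi> m \<le> n" using pi by (auto simp: Inc_mn_def)
  define q where "q = (LEAST j. 1 \<le> j \<and> \<pi> j \<noteq> j)"
  have q: "1 \<le> q \<and> \<pi> q \<noteq> q" unfolding q_def by (rule LeastI[of _ m]) (use False m in simp)
  have qm: "q \<le> m" unfolding q_def by (rule Least_le) (use False m in simp)
  have fixed: "\<pi> j = j" if "1 \<le> j" "j < q" for j
    using not_less_Least[of j "\<lambda>j. 1 \<le> j \<and> \<pi> j \<noteq> j"] that by (simp add: q_def)
  have qi: "i < q" using q IncD(3)[OF P] by force
  have qlt: "q < \<pi> q" using q Inc_ge[OF P, of q] by linarith
  define \<tau> where "\<tau> j = (if j < q then j else Suc j)" for j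
  \<comment> \<open>The column \<open>q\<close> is the gap that \<tau> leaves. The value
    \<open>q\<close> fits there because it lies below \<open>\<pi> q\<close>, which is the value of
    \<sigma> at \<open>Suc q\<close>.\<close>
  define \<sigma> where "\<sigma> l = (if l \<le> q then l else \<pi> (l - 1))" for l
  have "\<tau> \<in> Inc_mn i m (Suc m)"
    unfolding Inc_mn_def using qi by (auto simp: \<tau>_def intro!: IncI)
  moreover have "\<sigma> \<in> Inc i"
  proof (rule IncI)
    fix j k :: nat assume jk: "1 \<le> j" "j < k"
    show "\<sigma> j < \<sigma> k"
    proof (cases "k \<le> q")
      case True
      with jk show ?thesis by (simp add: \<sigma>_def)
    next
      case kq: False
      show ?thesis
      proof (cases "j \<le> q")
        case True
        have "\<pi> q \<le> \<pi> (k - 1)" using Inc_mono[OF P, of q "k - 1"] q kq by simp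
        with True kq qlt show ?thesis by (simp add: \<sigma>_def)
      next
        case False
        then have "1 \<le> j - 1" "j - 1 < k - 1" using jk q by linarith+
        then show ?thesis using IncD(2)[OF P] False kq by (simp add: \<sigma>_def)
      qed
    qed
  next
    fix j :: nat assume "1 \<le> j"
    then show "1 \<le> \<sigma> j" using IncD(1)[OF P, of "j - 1"] q by (auto simp: \<sigma>_def)
  qed (use qi in \<open>auto simp: \<sigma>_def\<close>)
  then have "\<sigma> \<in> Inc_mn i (Suc m) n"
    using qm pm by (simp add: Inc_mn_def \<sigma>_def)
  moreover have "\<forall>j\<in>{1..m}. \<sigma> (\<tau> j) = \<pi> j"
    using fixed by (auto simp: \<sigma>_def \<tau>_def)
  ultimately show ?thesis by blast
qed

text \<open>The intermediate level is raised one column at a time: the outer factor is split once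
  more and its inner part is absorbed into \<tau>.\<close>

lemma Inc_factor:
  assumes "1 \<le> m" "m \<le> r" "r \<le> n" "\<pi> \<in> Inc_mn i m n"
  shows "\<exists>\<tau>\<in>Inc_mn i m r. \<exists>\<sigma>\<in>Inc_mn i r n. \<forall>j\<in>{1..m}. \<sigma> (\<tau> j) = \<pi> j"
  using assms(2,3)
proof (induction r rule: dec_induct)
  case base
  show ?case using assms(4) Inc_mn_id[of m m i] by (intro bexI[of _ id] bexI[of _ \<pi>]) auto
next
  case (step r)
  then obtain \<tau> \<sigma> where 1: "\<tau> \<in> Inc_mn i m r" "\<sigma> \<in> Inc_mn i r n" "\<forall>j\<in>{1..m}. \<sigma> (\<tau> j) = \<pi> j"
    by auto
  have "1 \<le> r" using step assms(1) by linarith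
  then obtain \<tau>' \<sigma>' where 2: "\<tau>' \<in> Inc_mn i r (Suc r)" "\<sigma>' \<in> Inc_mn i (Suc r) n"
    "\<forall>j\<in>{1..r}. \<sigma>' (\<tau>' j) = \<sigma> j"
    using Inc_factor_step[OF 1(2)] step by auto
  have T: "\<tau> \<in> Inc i" "\<tau> m \<le> r" and T': "\<tau>' \<in> Inc i" "\<tau>' r \<le> Suc r"
    using 1 2 by (auto simp: Inc_mn_def)
  have rng: "\<tau> j \<in> {1..r}" if "j \<in> {1..m}" for j
    using that T IncD(1)[OF T(1), of j] Inc_mono[OF T(1), of j m] by simp
  have "\<tau>' \<circ> \<tau> \<in> Inc i"
    using IncD[OF T(1)] IncD[OF T'(1)] by (intro IncI) auto
  moreover have "\<tau>' (\<tau> m) \<le> Suc r"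
    using Inc_mono[OF T'(1), of "\<tau> m" r] T T' rng[of m] assms(1) by simp
  ultimately have "\<tau>' \<circ> \<tau> \<in> Inc_mn i m (Suc r)" by (simp add: Inc_mn_def)
  moreover have "\<forall>j\<in>{1..m}. \<sigma>' ((\<tau>' \<circ> \<tau>) j) = \<pi> j" using 1(3) 2(3) rng by simp
  ultimately show ?case using 2(2) by blast
qed

section \<open>Invariant chains in terms of exponents\<close>

definition Inc_span :: "nat \<Rightarrow> nat \<Rightarrow> nat \<Rightarrow> mon set \<Rightarrow> mon set" where
  "Inc_span i r n B = {a. \<exists>\<pi>\<in>Inc_mn i r n. \<exists>b\<in>B. le_mon (shift \<pi> b) a}"

context
  fixes c i :: nat and L :: "nat \<Rightarrow> ('k::field) pol set"
  assumes chain: "Inc_invariant_chain c i L" and L: "\<And>n. 1 \<le> n \<Longrightarrow> has_exps c n (L n)"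
begin

lemma chain_shift:
  "1 \<le> m \<Longrightarrow> m \<le> n \<Longrightarrow> a \<in> exps (L m) \<Longrightarrow> \<pi> \<in> Inc_mn i m n \<Longrightarrow> shift \<pi> a \<in> exps (L n)"
  using chain unfolding Inc_invariant_chain_def exps_def by (metis act_xmon mem_Collect_eq)

lemma chain_ideal: "1 \<le> n \<Longrightarrow> ideal (L n) (Rn c n)"
  using L by (simp add: has_exps_def)

lemma chain_exps_mons: "1 \<le> n \<Longrightarrow> exps (L n) \<subseteq> mons c n"
  using exps_ideal(1) chain_ideal by blast

lemma chain_exps_mono:
  assumes "1 \<le> m" "m \<le> n"
  shows "exps (L m) \<subseteq> exps (L n)"
  using chain_shift[OF assms _ Inc_mn_id[OF assms(2)]] shift_id by (metis subsetI)

text \<open>Terms of a shifted polynomial are shifts of its terms, and those terms are again in the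
  ideal. Generation by the orbit of level \<open>r\<close> thereby becomes a divisibility statement
  about monomials, which is what Higman's lemma can address.\<close>

lemma chain_generated_iff:
  assumes "1 \<le> r" "r \<le> n"
  shows "L n = Idl\<^bsub>Rn c n\<^esub> {act \<pi> f | \<pi> f. f \<in> L r \<and> \<pi> \<in> Inc_mn i r n} \<longleftrightarrow>
    exps (L n) \<subseteq> Inc_span i r n (exps (L r))"
proof
  interpret cring "Rn c n :: 'k pol ring" by (rule cring_Rn)
  let ?S = "{act \<pi> f | \<pi> f. f \<in> L r \<and> \<pi> \<in> Inc_mn i r n}"
  have SL: "?S \<subseteq> L n"
    using chain assms unfolding Inc_invariant_chain_def by blast
  have n: "1 \<le> n" using assms by simp
  have S: "?S \<subseteq> Rn_set c n" using SL ideal_RnD(4)[OF chain_ideal[OF n]] by blast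
  show "exps (L n) \<subseteq> Inc_span i r n (exps (L r))" if eq: "L n = Idl\<^bsub>Rn c n\<^esub> ?S"
  proof
    fix a assume "a \<in> exps (L n)"
    then have "(xmon a :: 'k pol) \<in> Idl\<^bsub>Rn c n\<^esub> ?S" using eq by (simp add: exps_def)
    have "\<exists>s\<in>{shift \<pi> b | \<pi> b. \<pi> \<in> Inc_mn i r n \<and> b \<in> exps (L r)}. le_mon s a"
    proof (rule genideal_exps[OF S])
      fix f a assume "f \<in> ?S" and a: "a \<in> Poly_Mapping.keys f"
      then obtain \<pi> h where h: "f = act \<pi> h" "h \<in> L r" "\<pi> \<in> Inc_mn i r n" by blast
      then obtain b where b: "b \<in> Poly_Mapping.keys h" "a = shift \<pi> b"
        using a keys_act by blast
      then have "b \<in> exps (L r)" using h(2) L[OF assms(1)] by (auto simp: has_exps_def)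
      with h b show "\<exists>s\<in>{shift \<pi> b | \<pi> b. \<pi> \<in> Inc_mn i r n \<and> b \<in> exps (L r)}. le_mon s a"
        using le_mon_refl by blast
    next
      show "(xmon a :: 'k pol) \<in> Idl\<^bsub>Rn c n\<^esub> ?S" by fact
    qed simp
    then show "a \<in> Inc_span i r n (exps (L r))" by (auto simp: Inc_span_def)
  qed
  show "L n = Idl\<^bsub>Rn c n\<^esub> ?S" if sub: "exps (L n) \<subseteq> Inc_span i r n (exps (L r))"
  proof (rule equalityI)
    show "Idl\<^bsub>Rn c n\<^esub> ?S \<subseteq> L n" using SL by (rule genideal_minimal[OF chain_ideal[OF n]])
    show "L n \<subseteq> Idl\<^bsub>Rn c n\<^esub> ?S"
    proof
      fix f assume f: "f \<in> L n"
      show "f \<in> Idl\<^bsub>Rn c n\<^esub> ?S"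
      proof (rule ideal_Rn_of_exps[OF Rn_genideal(1)[OF S]], rule subsetI)
        fix a assume "a \<in> Poly_Mapping.keys f"
        then have a: "a \<in> exps (L n)" using L[OF n] f by (auto simp: has_exps_def)
        then obtain \<pi> b where pb: "\<pi> \<in> Inc_mn i r n" "b \<in> exps (L r)" "le_mon (shift \<pi> b) a"
          using sub by (auto simp: Inc_span_def)
        have "act \<pi> (xmon b) \<in> ?S" using pb by (auto simp: exps_def)
        then have e: "shift \<pi> b \<in> exps (Idl\<^bsub>Rn c n\<^esub> ?S)"
          using Rn_genideal(2)[OF S] by (auto simp: exps_def act_xmon)
        have "a \<in> mons c n" using a chain_exps_mons[OF n] by blast
        then show "a \<in> exps (Idl\<^bsub>Rn c n\<^esub> ?S)"
          by (rule exps_ideal(2)[OF Rn_genideal(1)[OF S] e pb(3)])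
      qed
    qed
  qed
qed

text \<open>A map from level \<open>m\<close> to level \<open>n\<close> factors through level
  \<open>r\<close>, and invariance puts the image under the inner factor into the chain at level
  \<open>r\<close>. This is why a monomial that is new at level \<open>r\<close> is also new with
  respect to all earlier levels.\<close>

lemma Inc_span_mono:
  assumes "1 \<le> m" "m \<le> r" "r \<le> n"
  shows "Inc_span i m n (exps (L m)) \<subseteq> Inc_span i r n (exps (L r))"
proof
  fix a assume "a \<in> Inc_span i m n (exps (L m))"
  then obtain \<pi> b where pb: "\<pi> \<in> Inc_mn i m n" "b \<in> exps (L m)" "le_mon (shift \<pi> b) a"
    by (auto simp: Inc_span_def)
  obtain \<tau> \<sigma> where ts: "\<tau> \<in> Inc_mn i m r" "\<sigma> \<in> Inc_mn i r n" "\<forall>j\<in>{1..m}. \<sigma> (\<tau> j) = \<pi> j"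
    using Inc_factor[OF assms pb(1)] by blast
  have "b \<in> mons c m" using pb chain_exps_mons[OF assms(1)] by blast
  then have "shift \<sigma> (shift \<tau> b) = shift \<pi> b"
    unfolding shift_shift using ts(3) by (intro shift_cong) (auto simp: mons_def)
  moreover have "shift \<tau> b \<in> exps (L r)" using chain_shift[OF assms(1,2) pb(2) ts(1)] .
  ultimately show "a \<in> Inc_span i r n (exps (L r))"
    using ts(2) pb(3) by (auto simp: Inc_span_def intro!: bexI[of _ \<sigma>] bexI[of _ "shift \<tau> b"])
qed

end

text \<open>Monomials are encoded as words over their columns. The letters with indices \<open>0\<close> and
  \<open>Suc c\<close> tag the first \<open>i\<close> columns, so that embeddings fix them.\<close>

definition column :: "nat \<Rightarrow> nat \<Rightarrow> mon \<Rightarrow> nat \<Rightarrow> nat \<Rightarrow> nat" where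
  "column c i a j k =
    (if k = 0 then (if j \<le> i then j else 0)
     else if k = Suc c then i - (if j \<le> i then j else 0)
     else Poly_Mapping.lookup a (k, j))"

definition word :: "nat \<Rightarrow> nat \<Rightarrow> nat \<Rightarrow> mon \<Rightarrow> (nat \<Rightarrow> nat) list" where
  "word c i n a = map (column c i a) [1..<Suc n]"

text \<open>The positions used by the embedding supply the map on columns, and comparison of letters
  gives divisibility row by row. For \<open>1 \<le> j \<le> i\<close> the two tags yield
  \<open>j \<le> \<pi> j \<le> i\<close> and \<open>i - j \<le> i - \<pi> j\<close>, which together
  force \<open>\<pi> j = j\<close>.\<close>

lemma word_emb:
  assumes emb: "list_emb (\<lambda>x y. \<forall>k<c + 2. x k \<le> y k) (word c i m a) (word c i n b)"
    and i: "i \<le> m" and m: "1 \<le> m" and a: "a \<in> mons c m"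
  shows "\<exists>\<pi>\<in>Inc_mn i m n. le_mon (shift \<pi> a) b"
proof -
  obtain \<rho> where \<rho>: "strict_mono_on {..<m} \<rho>" "\<And>p. p < m \<Longrightarrow> \<rho> p < n"
    "\<And>p k. p < m \<Longrightarrow> k < c + 2 \<Longrightarrow> column c i a (Suc p) k \<le> column c i b (Suc (\<rho> p)) k"
    using list_emb_strict_mono[OF emb] by (force simp: word_def simp del: upt_Suc)
  \<comment> \<open>Columns count from 1 and list positions from 0, hence the shift by one. Beyond
    \<open>m\<close> the value \<open>n + j\<close> exceeds everything taken before.\<close>
  define \<pi> where "\<pi> j = (if j \<le> m then Suc (\<rho> (j - 1)) else n + j)" for j
  have "\<pi> \<in> Inc i"
  proof (rule IncI)
    fix j k :: nat assume jk: "1 \<le> j" "j < k"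
    show "\<pi> j < \<pi> k"
    proof (cases "k \<le> m")
      case True
      with jk strict_mono_onD[OF \<rho>(1), of "j - 1" "k - 1"] show ?thesis by (simp add: \<pi>_def)
    next
      case False
      have "j \<le> m \<Longrightarrow> \<rho> (j - 1) < n" by (rule \<rho>(2)) (use m in linarith)
      with False jk show ?thesis by (auto simp: \<pi>_def)
    qed
  next
    fix j :: nat assume "1 \<le> j"
    then show "1 \<le> \<pi> j" by (simp add: \<pi>_def)
  next
    fix j :: nat assume j: "1 \<le> j" "j \<le> i"
    then have "column c i a j 0 \<le> column c i b (\<pi> j) 0" "column c i a j (Suc c) \<le> column c i b (\<pi> j) (Suc c)"
      using \<rho>(3)[of "j - 1" 0] \<rho>(3)[of "j - 1" "Suc c"] i by (auto simp: \<pi>_def)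
    then show "\<pi> j = j" using j by (auto simp: column_def split: if_splits)
  qed
  moreover have "\<pi> m \<le> n" using m \<rho>(2)[of "m - 1"] by (simp add: \<pi>_def)
  ultimately have pi: "\<pi> \<in> Inc_mn i m n" by (simp add: Inc_mn_def)
  have inj: "inj_on \<pi> (snd ` Poly_Mapping.keys a)"
    using a by (intro inj_on_subset[OF Inc_inj_on[OF \<open>\<pi> \<in> Inc i\<close>]]) (auto simp: mons_def)
  have "Poly_Mapping.lookup (shift \<pi> a) y \<le> Poly_Mapping.lookup b y" for y
  proof (cases "y \<in> Poly_Mapping.keys (shift \<pi> a)")
    case True
    then obtain x where x: "x \<in> Poly_Mapping.keys a" "y = (fst x, \<pi> (snd x))"
      by (auto simp: keys_shift)
    then have r: "fst x \<in> {1..c}" "snd x \<in> {1..m}" using a by (auto simp: mons_def)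
    then have "column c i a (snd x) (fst x) \<le> column c i b (\<pi> (snd x)) (fst x)"
    proof -
      have "snd x - 1 < m" using r m by (cases "snd x") auto
      then show ?thesis using \<rho>(3)[of "snd x - 1" "fst x"] r by (simp add: \<pi>_def)
    qed
    then show ?thesis using lookup_shift[OF inj x(1)] x(2) r by (simp add: column_def)
  next
    case False
    then show ?thesis by (simp add: in_keys_iff)
  qed
  then have "le_mon (shift \<pi> a) b" by (simp add: le_mon_def)
  with pi show ?thesis by blast
qed

text \<open>If every level failed to generate the later ones, iteration would produce monomials
  \<open>B (\<rho> k)\<close>, each new with respect to level \<open>\<rho> k\<close>. By Higman's
  lemma a shift of an earlier \<open>B (\<rho> j)\<close> divides a later
  \<open>B (\<rho> k)\<close>. The earlier one belongs to level \<open>\<rho> (Suc j)\<close>, which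
  is at most \<open>\<rho> k\<close>, so the later one was not new.\<close>

theorem chain_stabilizes:
  fixes L :: "nat \<Rightarrow> ('k::field) pol set"
  assumes chain: "Inc_invariant_chain c i L" and L: "\<And>n. 1 \<le> n \<Longrightarrow> has_exps c n (L n)"
  shows "\<exists>r\<ge>1. \<forall>n\<ge>r. L n = Idl\<^bsub>Rn c n\<^esub> {act \<pi> f | \<pi> f. f \<in> L r \<and> \<pi> \<in> Inc_mn i r n}"
proof (rule ccontr)
  assume "\<not> ?thesis"
  then have "\<exists>n a. r \<le> n \<and> a \<in> exps (L n) \<and> a \<notin> Inc_span i r n (exps (L r))" if "1 \<le> r" for r
    using that chain_generated_iff[OF chain L that] by blast
  then obtain N B where NB: "\<And>r. 1 \<le> r \<Longrightarrow> r \<le> N r" "\<And>r. 1 \<le> r \<Longrightarrow> B r \<in> exps (L (N r))"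
    "\<And>r. 1 \<le> r \<Longrightarrow> B r \<notin> Inc_span i r (N r) (exps (L r))" by metis
  \<comment> \<open>Starting at \<open>Suc i\<close> makes all levels positive and all words long
    enough to contain the tagged columns.\<close>
  define \<rho> where "\<rho> k = (N ^^ k) (Suc i)" for k
  have \<rho>: "\<rho> (Suc k) = N (\<rho> k)" for k by (simp add: \<rho>_def)
  have ge: "Suc i \<le> \<rho> k" for k
  proof (induction k)
    case (Suc k)
    then show ?case using NB(1)[of "\<rho> k"] \<rho>[of k] by simp
  qed (simp add: \<rho>_def)
  have mono: "\<rho> j \<le> \<rho> k" if "j \<le> k" for j k
    using that
  proof (induction k rule: dec_induct)
    case (step k)
    then show ?case using NB(1)[of "\<rho> k"] ge[of k] \<rho>[of k] by simp
  qed simp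
  define W where "W k = word c i (\<rho> (Suc k)) (B (\<rho> k))" for k
  have "\<exists>j k. j < k \<and> list_emb (\<lambda>x y. \<forall>k<c + 2. x k \<le> y k) (W j) (W k)"
  proof (rule Higman)
    fix f :: "nat \<Rightarrow> nat \<Rightarrow> nat"
    show "\<exists>g :: nat \<Rightarrow> nat. strict_mono g \<and> (\<forall>m n. m < n \<longrightarrow> (\<forall>k<c + 2. f (g m) k \<le> f (g n) k))"
      using Dickson_subseq[of "c + 2" f] by (meson less_imp_le)
  qed
  then obtain j k where jk: "j < k" "list_emb (\<lambda>x y. \<forall>k<c + 2. x k \<le> y k) (W j) (W k)" by blast
  have 1: "1 \<le> \<rho> k" "1 \<le> \<rho> j" "1 \<le> \<rho> (Suc j)" for k j using ge[of k] ge[of j] ge[of "Suc j"] by auto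
  have Bj: "B (\<rho> j) \<in> exps (L (\<rho> (Suc j)))" using NB(2)[OF 1(1)] by (simp add: \<rho>)
  have "B (\<rho> j) \<in> mons c (\<rho> (Suc j))" using Bj chain_exps_mons[OF chain L 1(3)] by blast
  then obtain \<pi> where "\<pi> \<in> Inc_mn i (\<rho> (Suc j)) (\<rho> (Suc k))" "le_mon (shift \<pi> (B (\<rho> j))) (B (\<rho> k))"
    using word_emb[OF jk(2)[unfolded W_def]] ge[of "Suc j"] by auto
  then have "B (\<rho> k) \<in> Inc_span i (\<rho> (Suc j)) (\<rho> (Suc k)) (exps (L (\<rho> (Suc j))))"
    using Bj by (auto simp: Inc_span_def)
  also have "\<dots> \<subseteq> Inc_span i (\<rho> k) (\<rho> (Suc k)) (exps (L (\<rho> k)))"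
    using Inc_span_mono[OF chain L 1(3) mono mono] jk(1) by simp
  finally show False using NB(3)[OF 1(1)] by (simp add: \<rho>)
qed

lemma Inc_ind_stable:
  fixes L :: "nat \<Rightarrow> ('k::field) pol set"
  assumes "Inc_invariant_chain c i L" and "\<And>n. 1 \<le> n \<Longrightarrow> has_exps c n (L n)"
  shows "1 \<le> Inc_ind c i L"
    and "Inc_ind c i L \<le> n \<Longrightarrow> exps (L n) \<subseteq> Inc_span i (Inc_ind c i L) n (exps (L (Inc_ind c i L)))"
proof -
  have *: "1 \<le> Inc_ind c i L \<and> (\<forall>n\<ge>Inc_ind c i L. L n =
      Idl\<^bsub>Rn c n\<^esub> {act \<pi> f | \<pi> f. f \<in> L (Inc_ind c i L) \<and> \<pi> \<in> Inc_mn i (Inc_ind c i L) n})"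
    unfolding Inc_ind_def by (rule LeastI_ex) (use chain_stabilizes[OF assms] in blast)
  then show "1 \<le> Inc_ind c i L" by blast
  with * show "exps (L n) \<subseteq> Inc_span i (Inc_ind c i L) n (exps (L (Inc_ind c i L)))"
    if "Inc_ind c i L \<le> n"
    using that chain_generated_iff[OF assms] by blast
qed

section \<open>Projective dimension of monomial ideals\<close>

text \<open>Collecting the terms of \<open>f\<close> that contain the latest variable, and dividing
  that variable out, gives exactly the decomposition required by the recursion of
  \<open>seq_sub\<close>.\<close>

lemma seq_sub_vars:
  fixes e :: "nat \<Rightarrow> nat \<times> nat" and f :: "('k::field) pol"
  assumes e: "\<And>t. t < H \<Longrightarrow> e t \<in> {1..c} \<times> {1..n}" and "l \<le> H"
    and x: "\<And>t. t < H \<Longrightarrow> x t = xmon (Poly_Mapping.single (e t) 1)"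
  shows "f \<in> seq_sub (ideal_mod (Rn c n) (carrier (Rn c n))) x l \<longleftrightarrow>
    f \<in> Rn_set c n \<and> (\<forall>a\<in>Poly_Mapping.keys f. \<exists>t<l. e t \<in> Poly_Mapping.keys a)"
  using assms(2)
proof (induction l arbitrary: f)
  case 0
  have "Poly_Mapping.keys f = {} \<longleftrightarrow> f = 0"
    by (metis keys_zero poly_expand sum.empty)
  then show ?case by (auto simp: ideal_mod_def Rn_def Rn_set_zero)
next
  case (Suc l)
  let ?S = "ideal_mod (Rn c n) (carrier (Rn c n)) :: ('k pol, 'k pol) module"
  let ?s = "Poly_Mapping.single (e l) 1 :: mon"
  have l: "l < H" "l \<le> H" using Suc.prems by simp_all
  have IH: "q \<in> seq_sub ?S x l \<longleftrightarrow> q \<in> Rn_set c n \<and> (\<forall>a\<in>Poly_Mapping.keys q. \<exists>t<l. e t \<in> Poly_Mapping.keys a)"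
    for q using Suc.IH[OF l(2)] .
  have s: "?s \<in> mons c n" using e[OF l(1)] by (simp add: mons_def)
  have unf: "f \<in> seq_sub ?S x (Suc l) \<longleftrightarrow> (\<exists>p q. f = xmon ?s * p + q \<and> p \<in> Rn_set c n \<and> q \<in> seq_sub ?S x l)"
    using x[OF l(1)] by (simp add: ideal_mod_def Rn_def)
  show ?case
  proof
    assume "f \<in> seq_sub ?S x (Suc l)"
    then obtain p q where f: "f = xmon ?s * p + q" and p: "p \<in> Rn_set c n" and q: "q \<in> seq_sub ?S x l"
      using unf by blast
    have "f \<in> Rn_set c n"
      unfolding f using p q IH s by (intro Rn_set_add Rn_set_mult) auto
    moreover have "\<exists>t<Suc l. e t \<in> Poly_Mapping.keys a" if a: "a \<in> Poly_Mapping.keys f" for a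
    proof -
      have "a \<in> (+) ?s ` Poly_Mapping.keys p \<or> a \<in> Poly_Mapping.keys q"
        using a Poly_Mapping.keys_add[of "xmon ?s * p" q] unfolding f keys_xmon_mult by blast
      then show ?thesis
      proof
        assume "a \<in> (+) ?s ` Poly_Mapping.keys p"
        then have "e l \<in> Poly_Mapping.keys a" by (auto simp: keys_add_mon)
        then show ?thesis by blast
      next
        assume "a \<in> Poly_Mapping.keys q"
        then show ?thesis using q IH less_SucI by blast
      qed
    qed
    ultimately show "f \<in> Rn_set c n \<and> (\<forall>a\<in>Poly_Mapping.keys f. \<exists>t<Suc l. e t \<in> Poly_Mapping.keys a)" by blast
  next
    assume f: "f \<in> Rn_set c n \<and> (\<forall>a\<in>Poly_Mapping.keys f. \<exists>t<Suc l. e t \<in> Poly_Mapping.keys a)"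
    let ?K = "{a \<in> Poly_Mapping.keys f. e l \<in> Poly_Mapping.keys a}"
    let ?N = "Poly_Mapping.keys f - ?K"
    define p where "p = (\<Sum>a\<in>?K. Poly_Mapping.single (a - ?s) (Poly_Mapping.lookup f a))"
    define q where "q = (\<Sum>a\<in>?N. Poly_Mapping.single a (Poly_Mapping.lookup f a))"
    have le: "?s + (a - ?s) = a" if "a \<in> ?K" for a
    proof -
      have "le_mon ?s a" using that by (auto simp: le_mon_def lookup_single when_def in_keys_iff)
      then show ?thesis by (auto simp: le_mon_iff_add)
    qed
    have "xmon ?s * p = (\<Sum>a\<in>?K. Poly_Mapping.single a (Poly_Mapping.lookup f a))"
      unfolding p_def sum_distrib_left by (rule sum.cong) (simp_all add: mult_single le del: One_nat_def)
    then have "xmon ?s * p + q = (\<Sum>a\<in>Poly_Mapping.keys f. Poly_Mapping.single a (Poly_Mapping.lookup f a))"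
      unfolding q_def by (subst sum.subset_diff[of ?K "Poly_Mapping.keys f"]) (auto simp: add.commute)
    then have fpq: "f = xmon ?s * p + q" using poly_expand[of f] by simp
    have sumR: "(\<Sum>a\<in>B. Poly_Mapping.single (g a) (h a)) \<in> Rn_set c n"
      if "\<And>a. a \<in> B \<Longrightarrow> g a \<in> mons c n" for B :: "mon set" and g and h :: "mon \<Rightarrow> 'k"
      using that
      by (induction B rule: infinite_finite_induct) (auto simp: Rn_set_zero intro!: Rn_set_add Rn_set_single)
    have fm: "a \<in> mons c n" if "a \<in> Poly_Mapping.keys f" for a using f that by (auto simp: Rn_set_eq)
    have "p \<in> Rn_set c n"
      unfolding p_def
    proof (rule sumR)
      fix a assume a: "a \<in> ?K"
      then show "a - ?s \<in> mons c n" using fm[of a] le[OF a] mons_add[of ?s "a - ?s" c n] by simp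
    qed
    moreover have "q \<in> seq_sub ?S x l"
      unfolding IH
    proof (intro conjI ballI)
      show "q \<in> Rn_set c n" unfolding q_def using fm by (intro sumR) auto
      fix a assume "a \<in> Poly_Mapping.keys q"
      then have "(\<Sum>b\<in>?N. Poly_Mapping.lookup (Poly_Mapping.single b (Poly_Mapping.lookup f b)) a) \<noteq> 0"
        by (simp add: q_def in_keys_iff lookup_sum)
      then obtain b where "b \<in> ?N" "Poly_Mapping.lookup (Poly_Mapping.single b (Poly_Mapping.lookup f b)) a \<noteq> 0"
        by (rule sum.not_neutral_contains_not_neutral)
      then have "a \<in> ?N" by (auto simp: lookup_single when_def split: if_splits)
      then have "e l \<notin> Poly_Mapping.keys a" "\<exists>t<Suc l. e t \<in> Poly_Mapping.keys a" using f by auto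
      then show "\<exists>t<l. e t \<in> Poly_Mapping.keys a" by (metis less_Suc_eq)
    qed
    ultimately show "f \<in> seq_sub ?S x (Suc l)" unfolding unf using fpq by blast
  qed
qed

text \<open>Distinct variables form a regular sequence in any order: if a monomial times one
  variable is divisible by another variable, the monomial itself is. The hypotheses on
  \<open>w\<close> are those of a socle element, so \<open>proj_dim_ideal_ge\<close> applies to an
  enumeration of \<open>A\<close>.\<close>

lemma proj_dim_monomial_ideal_ge:
  fixes J :: "('k::field) pol set"
  assumes J: "ideal J (Rn c n)" and w: "w \<in> mons c n" "w \<notin> exps J"
    and A: "A \<subseteq> {1..c} \<times> {1..n}" "\<And>y. y \<in> A \<Longrightarrow> w + Poly_Mapping.single y 1 \<in> exps J"
  shows "proj_dim (Rn c n) (ideal_mod (Rn c n) J) \<ge> ereal (real (card A) - 1)"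
proof -
  have "finite A" using A(1) by (rule finite_subset) simp
  then obtain e where e: "bij_betw e {0..<card A} A" using ex_bij_betw_nat_finite by blast
  define H where "H = card A"
  \<comment> \<open>The value 0 from \<open>H\<close> on is a filler that keeps \<open>x t\<close>
    in the ring for every \<open>t\<close>.\<close>
  define x where "x t = (if t < H then xmon (Poly_Mapping.single (e t) 1) else 0 :: 'k pol)" for t
  have eA: "e t \<in> A" if "t < H" for t using e that by (auto simp: H_def bij_betw_def)
  have eb: "e t \<in> {1..c} \<times> {1..n}" if "t < H" for t using eA[OF that] A(1) by blast
  have xe: "x t = xmon (Poly_Mapping.single (e t) 1)" if "t < H" for t using that by (simp add: x_def)
  have xc: "x t \<in> Rn_set c n" for t
  proof (cases "t < H")
    case True
    then show ?thesis using eb[OF True] by (simp add: x_def mons_def)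
  next
    case False
    then show ?thesis by (simp add: x_def Rn_set_zero)
  qed
  have reg: "seq_regular (ideal_mod (Rn c n) (carrier (Rn c n))) x H"
    unfolding seq_regular_def
  proof (intro allI impI ballI)
    fix l and f :: "'k pol"
    assume l: "l < H" and f: "f \<in> carrier (ideal_mod (Rn c n) (carrier (Rn c n)))"
      and xf: "x l \<odot>\<^bsub>ideal_mod (Rn c n) (carrier (Rn c n))\<^esub> f \<in> seq_sub (ideal_mod (Rn c n) (carrier (Rn c n))) x l"
    have l': "l \<le> H" using l by simp
    note sv = seq_sub_vars[of H e c n l x, OF eb l' xe]
    have "x l * f \<in> seq_sub (ideal_mod (Rn c n) (carrier (Rn c n))) x l"
      using xf by (simp add: ideal_mod_def Rn_def)
    then have k: "\<forall>a\<in>Poly_Mapping.keys (xmon (Poly_Mapping.single (e l) 1) * f). \<exists>t<l. e t \<in> Poly_Mapping.keys a"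
      unfolding xe[OF l] by (simp add: sv)
    have "\<exists>t<l. e t \<in> Poly_Mapping.keys a" if a: "a \<in> Poly_Mapping.keys f" for a
    proof -
      obtain t where t: "t < l" "e t \<in> Poly_Mapping.keys (Poly_Mapping.single (e l) 1 + a)"
        using k a unfolding keys_xmon_mult by blast
      moreover have "e t \<noteq> e l"
        using inj_on_eq_iff[OF bij_betw_imp_inj_on[OF e], of t l] t(1) l by (simp add: H_def)
      ultimately have "e t \<in> Poly_Mapping.keys a" by (simp add: keys_add_mon)
      with t(1) show ?thesis by blast
    qed
    moreover have "f \<in> Rn_set c n" using f by (simp add: ideal_mod_def Rn_def)
    ultimately show "f \<in> seq_sub (ideal_mod (Rn c n) (carrier (Rn c n))) x l"
      by (simp add: sv)
  qed
  have "ereal (real H - 1) \<le> proj_dim (Rn c n) (ideal_mod (Rn c n) J)"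
  proof (rule proj_dim_ideal_ge[OF cring_Rn J _ reg])
    show "\<forall>t. x t \<in> carrier (Rn c n)" using xc by (simp add: Rn_def)
    show "xmon w \<in> carrier (Rn c n)" "xmon w \<notin> J"
      using w by (simp_all add: Rn_def exps_def)
    show "x a \<otimes>\<^bsub>Rn c n\<^esub> xmon w \<in> J" if "a < H" for a
      using A(2)[OF eA[OF that]] by (simp add: xe[OF that] Rn_def exps_def mult_single add.commute)
  qed
  then show ?thesis by (simp add: H_def)
qed

text \<open>The second part is how \<gamma> enters the estimate: too few rows cannot form a cover,
  and the monomial they miss is the one to be moved by an increasing map.\<close>

lemma gamma_eq:
  fixes J :: "('k::field) pol set"
  assumes "has_exps c n J" "0 \<notin> exps J"
  shows "gamma c n i J = enat (Min {card C | C. i_cover c n i J C})"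
    and "T \<subseteq> {1..c} \<Longrightarrow> card T < Min {card C | C. i_cover c n i J C} \<Longrightarrow>
      \<exists>a\<in>exps J. (\<forall>x\<in>Poly_Mapping.keys a. i < snd x) \<and> (\<forall>x\<in>Poly_Mapping.keys a. fst x \<notin> T)"
proof -
  have "1 \<notin> J" using assms(2) by (simp add: exps_def)
  then have "J \<noteq> Rn_set c n" using Rn_set_one by metis
  then show "gamma c n i J = enat (Min {card C | C. i_cover c n i J C})" by (simp add: gamma_def)
  assume T: "T \<subseteq> {1..c}" "card T < Min {card C | C. i_cover c n i J C}"
  have "{card C | C. i_cover c n i J C} \<subseteq> card ` Pow {1..c}" by (auto simp: i_cover_def)
  then have fin: "finite {card C | C. i_cover c n i J C}" by (rule finite_subset) simp
  have "\<not> i_cover c n i J T"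
  proof
    assume "i_cover c n i J T"
    then have "Min {card C | C. i_cover c n i J C} \<le> card T" by (intro Min_le[OF fin]) blast
    with T(2) show False by simp
  qed
  with T(1) show "\<exists>a\<in>exps J. (\<forall>x\<in>Poly_Mapping.keys a. i < snd x) \<and> (\<forall>x\<in>Poly_Mapping.keys a. fst x \<notin> T)"
    unfolding i_cover_iff[OF assms] by blast
qed

section \<open>Vertex covers and colon chains\<close>

lemma lookup_le_deg: "Poly_Mapping.lookup a x \<le> deg a"
proof (cases "x \<in> Poly_Mapping.keys a")
  case True
  then show ?thesis unfolding deg_def by (intro member_le_sum) auto
next
  case False
  then show ?thesis by (simp add: in_keys_iff)
qed

text \<open>The targets are the elements of \<open>Q\<close> beyond column \<open>i\<close>, in
  increasing order. Dropping the first \<open>i\<close> columns removes at most \<open>i\<close> of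
  at least \<open>m\<close> elements, which leaves enough for the columns from \<open>Suc i\<close>
  to \<open>m\<close>.\<close>

lemma Inc_mn_into:
  assumes "Q \<subseteq> {1..n}" "m \<le> card Q" "1 \<le> m"
  shows "\<exists>\<pi>\<in>Inc_mn i m n. \<forall>j\<in>{Suc i..m}. \<pi> j \<in> Q"
proof -
  have fQ: "finite Q" using assms(1) by (rule finite_subset) simp
  have mn: "m \<le> n" using card_mono[OF _ assms(1)] assms(2) by simp
  define xs where "xs = sorted_list_of_set (Q - {1..i})"
  have len: "m - i \<le> length xs"
    using diff_card_le_card_Diff[of "{1..i}" Q] assms(2) by (simp add: xs_def)
  have set: "set xs = Q - {1..i}" using fQ by (simp add: xs_def)
  have srt: "sorted_wrt (<) xs" by (simp add: xs_def)
  define \<pi> where "\<pi> j = (if j \<le> i then j else if j \<le> m then xs ! (j - Suc i) else n + j)" for j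
  have mem: "\<pi> j \<in> Q" "i < \<pi> j" "\<pi> j \<le> n" if "j \<in> {Suc i..m}" for j
  proof -
    have "xs ! (j - Suc i) \<in> set xs" using that len by (intro nth_mem) auto
    then have "\<pi> j \<in> Q - {1..i}" using that set by (simp add: \<pi>_def)
    then show "\<pi> j \<in> Q" "i < \<pi> j" "\<pi> j \<le> n" using assms(1) by force+
  qed
  have "\<pi> \<in> Inc i"
  proof (rule IncI)
    fix j k :: nat assume jk: "1 \<le> j" "j < k"
    consider "k \<le> i" | "j \<le> i" "i < k" "k \<le> m" | "i < j" "k \<le> m" | "i < k" "m < k" by linarith
    then show "\<pi> j < \<pi> k"
    proof cases
      case 1
      with jk show ?thesis by (simp add: \<pi>_def)
    next
      case 2
      then have "i < \<pi> k" by (intro mem) simp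
      with 2 show ?thesis by (simp add: \<pi>_def[of j])
    next
      case 3
      then have "xs ! (j - Suc i) < xs ! (k - Suc i)"
        using jk len by (intro sorted_wrt_nth_less[OF srt]) auto
      with 3 jk show ?thesis by (simp add: \<pi>_def)
    next
      case 4
      then have "\<pi> k = n + k" by (simp add: \<pi>_def)
      moreover have "\<pi> j < n + k"
        using mem(3)[of j] jk by (cases "j \<le> i"; cases "j \<le> m") (auto simp: \<pi>_def)
      ultimately show ?thesis by simp
    qed
  next
    fix j :: nat assume "1 \<le> j"
    then show "1 \<le> \<pi> j" using mem(2)[of j] by (cases "j \<le> i"; cases "j \<le> m") (auto simp: \<pi>_def)
  qed (simp add: \<pi>_def)
  moreover have "\<pi> m \<le> n" using mem(3)[of m] mn by (cases "m \<le> i") (auto simp: \<pi>_def)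
  ultimately show ?thesis using mem(1) by (intro bexI[of _ \<pi>]) (auto simp: Inc_mn_def)
qed

text \<open>A column of \<open>A\<close> with fewer than \<gamma> elements has one of at most
  \<open>2 ^ c\<close> shapes, and each shape occurs at most \<open>m\<close> times. Hence at most
  \<open>2 ^ c * m\<close> columns fall short, each by at most \<gamma>.\<close>

lemma card_ge_of_columns:
  fixes A :: "(nat \<times> nat) set" and C :: "nat \<Rightarrow> nat set"
  assumes "A \<subseteq> {1..c} \<times> {1..n}"
    and fib: "\<And>T. T \<subseteq> {1..c} \<Longrightarrow> card T < \<gamma> \<Longrightarrow> card {j \<in> {1..n}. {k. (k, j) \<in> A} = T} \<le> m"
  shows "\<gamma> * n \<le> card A + \<gamma> * (2 ^ c * m)"
proof -
  define C where "C j = {k. (k, j) \<in> A}" for j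
  have CS: "C j \<subseteq> {1..c}" for j using assms(1) by (auto simp: C_def)
  have "bij_betw (\<lambda>(j, k). (k, j)) (Sigma {1..n} C) A"
    using assms(1) by (intro bij_betwI[where g = "\<lambda>(k, j). (j, k)"]) (auto simp: C_def)
  then have "card A = card (Sigma {1..n} C)" using bij_betw_same_card by fastforce
  also have "\<dots> = (\<Sum>j\<in>{1..n}. card (C j))"
    using CS by (intro card_SigmaI) (auto intro: finite_subset)
  finally have cA: "card A = (\<Sum>j\<in>{1..n}. card (C j))" .
  define B where "B = {j \<in> {1..n}. card (C j) < \<gamma>}"
  define \<T> where "\<T> = {T. T \<subseteq> {1..c} \<and> card T < \<gamma>}"
  have fT: "finite \<T>" unfolding \<T>_def by (rule finite_subset[of _ "Pow {1..c}"]) auto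
  have "card \<T> \<le> card (Pow {1..c})" unfolding \<T>_def by (intro card_mono) auto
  then have cT: "card \<T> \<le> 2 ^ c" by (simp add: card_Pow)
  have "B = (\<Union>T\<in>\<T>. {j \<in> {1..n}. C j = T})" using CS by (auto simp: B_def \<T>_def)
  then have "card B \<le> (\<Sum>T\<in>\<T>. card {j \<in> {1..n}. C j = T})" using card_UN_le[OF fT] by simp
  also have "\<dots> \<le> (\<Sum>T\<in>\<T>. m)" using fib by (intro sum_mono) (auto simp: \<T>_def C_def)
  also have "\<dots> \<le> 2 ^ c * m" using cT by simp
  finally have cB: "card B \<le> 2 ^ c * m" .
  have "\<gamma> * card ({1..n} - B) = (\<Sum>j\<in>{1..n} - B. \<gamma>)" by simp
  also have "\<dots> \<le> (\<Sum>j\<in>{1..n} - B. card (C j))" by (intro sum_mono) (auto simp: B_def)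
  also have "\<dots> \<le> card A" unfolding cA by (intro sum_mono2) auto
  finally have 1: "\<gamma> * card ({1..n} - B) \<le> card A" .
  have "n \<le> card ({1..n} - B) + card B"
    using diff_card_le_card_Diff[of B "{1..n}"] by (simp add: B_def)
  then have "\<gamma> * n \<le> \<gamma> * (card ({1..n} - B) + card B)" by simp
  also have "\<dots> \<le> card A + \<gamma> * (2 ^ c * m)"
    unfolding distrib_left using 1 cB by (intro add_mono mult_le_mono) auto
  finally show ?thesis .
qed

text \<open>The assumption \<open>cov\<close> speaks of the fixed level \<open>m\<close> and
  provides one monomial for each small set of rows. Moving these finitely many monomials to level
  \<open>n\<close> gives an error term independent of \<open>n\<close>.\<close>

lemma exists_large_socle:
  fixes I :: "nat \<Rightarrow> ('k::field) pol set"
  assumes chain: "Inc_invariant_chain c i I" and I: "\<And>n. 1 \<le> n \<Longrightarrow> has_exps c n (I n)"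
    and m: "1 \<le> m" and b: "\<And>x. x \<in> Poly_Mapping.keys b \<Longrightarrow> snd x \<in> {1..i}"
    and bm: "b \<in> mons c m"
    and cov: "\<And>T. T \<subseteq> {1..c} \<Longrightarrow> card T < \<gamma> \<Longrightarrow> \<exists>a\<in>mons c m. a + b \<in> exps (I m) \<and>
      (\<forall>x\<in>Poly_Mapping.keys a. i < snd x) \<and> (\<forall>x\<in>Poly_Mapping.keys a. fst x \<notin> T)"
    and n: "m \<le> n" and bn: "b \<notin> exps (I n)"
  shows "\<exists>w\<in>mons c n. w \<notin> exps (I n) \<and> (\<exists>A \<subseteq> {1..c} \<times> {1..n}.
    (\<forall>y\<in>A. w + Poly_Mapping.single y 1 \<in> exps (I n)) \<and> \<gamma> * n \<le> card A + \<gamma> * (2 ^ c * m))"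
proof -
  define \<T> where "\<T> = {T. T \<subseteq> {1..c} \<and> card T < \<gamma>}"
  have fT: "finite \<T>" unfolding \<T>_def by (rule finite_subset[of _ "Pow {1..c}"]) auto
  have "\<exists>a. \<forall>T\<in>\<T>. a T \<in> mons c m \<and> a T + b \<in> exps (I m) \<and>
      (\<forall>x\<in>Poly_Mapping.keys (a T). i < snd x) \<and> (\<forall>x\<in>Poly_Mapping.keys (a T). fst x \<notin> T)"
  proof (rule bchoice, rule ballI)
    fix T assume "T \<in> \<T>"
    then have "T \<subseteq> {1..c}" "card T < \<gamma>" by (auto simp: \<T>_def)
    from cov[OF this] show "\<exists>a. a \<in> mons c m \<and> a + b \<in> exps (I m) \<and>
      (\<forall>x\<in>Poly_Mapping.keys a. i < snd x) \<and> (\<forall>x\<in>Poly_Mapping.keys a. fst x \<notin> T)" by blast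
  qed
  then obtain a where a: "\<And>T. T \<in> \<T> \<Longrightarrow> a T \<in> mons c m" "\<And>T. T \<in> \<T> \<Longrightarrow> a T + b \<in> exps (I m)"
    "\<And>T x. T \<in> \<T> \<Longrightarrow> x \<in> Poly_Mapping.keys (a T) \<Longrightarrow> i < snd x"
    "\<And>T x. T \<in> \<T> \<Longrightarrow> x \<in> Poly_Mapping.keys (a T) \<Longrightarrow> fst x \<notin> T" by blast
  \<comment> \<open>A bound for all exponents of \<open>b\<close> and of the chosen
    \<open>a T\<close>. It admits \<open>b\<close> itself as a candidate for \<open>w\<close>, and
    an exponent of \<open>w\<close> that reaches \<open>E\<close> dominates any exponent of a
    shifted \<open>a T\<close>.\<close>
  define E where "E = deg b + (\<Sum>T\<in>\<T>. deg (a T))"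
  have Eb: "Poly_Mapping.lookup b x \<le> E" for x using lookup_le_deg[of b x] by (simp add: E_def)
  have Ea: "Poly_Mapping.lookup (a T) x \<le> E" if "T \<in> \<T>" for T x
  proof -
    have "deg (a T) \<le> (\<Sum>T\<in>\<T>. deg (a T))" using that fT by (intro member_le_sum) auto
    then show ?thesis using lookup_le_deg[of "a T" x] by (simp add: E_def)
  qed
  have n1: "1 \<le> n" using m n by simp
  have idn: "ideal (I n) (Rn c n)" using I[OF n1] by (simp add: has_exps_def)
  define W where "W w \<longleftrightarrow> w \<in> mons c n \<and> w \<notin> exps (I n) \<and> le_mon b w \<and>
    (\<forall>x. Poly_Mapping.lookup w x \<le> E)" for w
  have "W b" using bm mons_mono[OF n] bn Eb by (auto simp: W_def le_mon_refl)
  moreover have "deg w \<le> card ({1..c} \<times> {1..n}) * E" if "W w" for w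
  proof -
    have "deg w = (\<Sum>x\<in>{1..c} \<times> {1..n}. Poly_Mapping.lookup w x)"
      using that by (intro deg_eq_sum) (auto simp: W_def mons_def)
    also have "\<dots> \<le> (\<Sum>x\<in>{1..c} \<times> {1..n}. E)"
      using that unfolding W_def by (intro sum_mono) blast
    finally show ?thesis by simp
  qed
  ultimately have "\<exists>w. W w \<and> (\<forall>w'. W w' \<longrightarrow> deg w' \<le> deg w)"
    by (intro ex_has_greatest_nat[of W b deg "Suc (card ({1..c} \<times> {1..n}) * E)"])
      (simp_all add: less_Suc_eq_le)
  then obtain w where w: "W w" "\<And>w'. W w' \<Longrightarrow> deg w' \<le> deg w" by blast
  define A where "A = {y \<in> {1..c} \<times> {1..n}. w + Poly_Mapping.single y 1 \<in> exps (I n)}"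
  \<comment> \<open>An exponent of \<open>w\<close> below \<open>E\<close> at a variable outside
    \<open>A\<close> could be raised by one, giving a candidate of larger degree.\<close>
  have large: "E \<le> Poly_Mapping.lookup w y" if y: "y \<in> {1..c} \<times> {1..n}" "y \<notin> A" for y
  proof (rule ccontr)
    assume lt: "\<not> E \<le> Poly_Mapping.lookup w y"
    let ?w = "w + Poly_Mapping.single y 1"
    have le: "le_mon w ?w" by (auto simp: le_mon_iff_add)
    have "?w \<in> mons c n" using w(1) y(1) by (simp add: W_def mons_add) (simp add: mons_def)
    moreover have "?w \<notin> exps (I n)" using y by (simp add: A_def)
    moreover have "le_mon b ?w" using w(1) le le_mon_trans unfolding W_def by blast
    moreover have "Poly_Mapping.lookup ?w x \<le> E" for x
    proof -
      have "Poly_Mapping.lookup w x \<le> E" using w(1) unfolding W_def by blast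
      then show ?thesis using lt by (auto simp: lookup_add lookup_single when_def)
    qed
    ultimately have "W ?w" by (simp add: W_def)
    then have "deg ?w \<le> deg w" by (rule w(2))
    moreover have "?w \<noteq> w"
    proof
      assume "?w = w"
      then have "Poly_Mapping.lookup ?w y = Poly_Mapping.lookup w y" by simp
      then show False by (simp add: lookup_add)
    qed
    ultimately show False using deg_less[OF le] by simp
  qed
  have fib: "card {j \<in> {1..n}. {k. (k, j) \<in> A} = T} \<le> m" if T: "T \<subseteq> {1..c}" "card T < \<gamma>" for T
  proof (rule ccontr)
    let ?Q = "{j \<in> {1..n}. {k. (k, j) \<in> A} = T}"
    assume "\<not> card ?Q \<le> m"
    then have "m \<le> card ?Q" "?Q \<subseteq> {1..n}" by auto
    then obtain \<pi> where pi: "\<pi> \<in> Inc_mn i m n" "\<forall>j\<in>{Suc i..m}. \<pi> j \<in> ?Q"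
      using Inc_mn_into[OF _ _ m] by blast
    have PI: "\<pi> \<in> Inc i" using pi(1) by (simp add: Inc_mn_def)
    have TT: "T \<in> \<T>" using T by (simp add: \<T>_def)
    have "shift \<pi> (a T + b) \<in> exps (I n)" by (rule chain_shift[OF chain I m n a(2)[OF TT] pi(1)])
    moreover have "shift \<pi> b = b" using b IncD(3)[OF PI] by (intro shift_fixed) auto
    ultimately have ex: "shift \<pi> (a T) + b \<in> exps (I n)" by (simp add: shift_add)
    have inj: "inj_on \<pi> (snd ` Poly_Mapping.keys (a T))"
      using a(1)[OF TT] by (intro inj_on_subset[OF Inc_inj_on[OF PI]]) (auto simp: mons_def)
    \<comment> \<open>The shift of \<open>a T\<close> lies beyond column \<open>i\<close> and
      \<open>b\<close> within the first \<open>i\<close> columns, so the supports are disjoint. On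
      the first, rows outside \<open>T\<close> in columns of \<open>?Q\<close> are outside
      \<open>A\<close>, where \<open>w\<close> has exponent at least \<open>E\<close>; on the
      second, \<open>w\<close> is a multiple of \<open>b\<close>.\<close>
    have "Poly_Mapping.lookup (shift \<pi> (a T) + b) y \<le> Poly_Mapping.lookup w y" for y
    proof (cases "y \<in> Poly_Mapping.keys (shift \<pi> (a T))")
      case True
      then obtain x where x: "x \<in> Poly_Mapping.keys (a T)" "y = (fst x, \<pi> (snd x))"
        by (auto simp: keys_shift)
      have xr: "fst x \<in> {1..c}" "snd x \<in> {1..m}" "i < snd x" "fst x \<notin> T"
        using a(1)[OF TT] a(3,4)[OF TT] x(1) by (auto simp: mons_def)
      then have q: "\<pi> (snd x) \<in> ?Q" using pi(2) by simp
      then have "y \<in> {1..c} \<times> {1..n}" "y \<notin> A" using xr x(2) by auto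
      then have "E \<le> Poly_Mapping.lookup w y" by (rule large)
      moreover have "y \<notin> Poly_Mapping.keys b"
      proof
        assume "y \<in> Poly_Mapping.keys b"
        then have "\<pi> (snd x) \<le> i" using b[of y] x(2) by simp
        moreover have "snd x \<le> \<pi> (snd x)" using Inc_ge[OF PI] xr by simp
        ultimately show False using xr by simp
      qed
      ultimately show ?thesis
        using lookup_shift[OF inj x(1)] Ea[OF TT, of x] x(2) by (simp add: lookup_add in_keys_iff)
    next
      case False
      have "le_mon b w" using w(1) by (simp add: W_def)
      with False show ?thesis using le_monD by (simp add: lookup_add in_keys_iff)
    qed
    then have "le_mon (shift \<pi> (a T) + b) w" unfolding le_mon_def by blast
    moreover have "w \<in> mons c n" "w \<notin> exps (I n)" using w(1) by (simp_all add: W_def)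
    ultimately show False using exps_ideal(2)[OF idn ex] by blast
  qed
  have AS: "A \<subseteq> {1..c} \<times> {1..n}" by (auto simp: A_def)
  have "\<gamma> * n \<le> card A + \<gamma> * (2 ^ c * m)" by (rule card_ge_of_columns[OF AS fib])
  moreover have "w \<in> mons c n" "w \<notin> exps (I n)" using w(1) by (simp_all add: W_def)
  moreover have "\<forall>y\<in>A. w + Poly_Mapping.single y 1 \<in> exps (I n)" by (simp add: A_def)
  ultimately show ?thesis using AS by blast
qed

section \<open>Colon chains\<close>

lemma colon_eq:
  fixes I :: "nat \<Rightarrow> ('k::field) pol set"
  assumes "has_exps c n (I n)"
  shows "colon_chain c I (xmon b) n =
    {f \<in> Rn_set c n. Poly_Mapping.keys f \<subseteq> {a \<in> mons c n. a + b \<in> exps (I n)}}"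
proof -
  have "f * xmon b \<in> I n \<longleftrightarrow> (\<forall>a\<in>Poly_Mapping.keys f. a + b \<in> exps (I n))" for f
  proof -
    have id: "ideal (I n) (Rn c n)" using assms by (simp add: has_exps_def)
    have "f * xmon b \<in> I n \<longleftrightarrow> Poly_Mapping.keys (xmon b * f) \<subseteq> exps (I n)"
      using assms ideal_Rn_of_exps[OF id] unfolding has_exps_def by (metis mult.commute)
    then show ?thesis by (auto simp: keys_xmon_mult add.commute)
  qed
  then show ?thesis by (auto simp: colon_chain_def Rn_set_eq)
qed

text \<open>Small \<open>n\<close> need no separate case: if \<open>b\<close> is not in
  \<open>mons c n\<close>, then neither is any \<open>a + b\<close>, and both sides are
  empty.\<close>

lemma exps_colon:
  fixes I :: "nat \<Rightarrow> ('k::field) pol set"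
  assumes "has_exps c n (I n)"
  shows "exps (colon_chain c I (xmon b) n) = {a \<in> mons c n. a + b \<in> exps (I n)}"
proof -
  have "xmon a \<in> colon_chain c I (xmon b) n \<longleftrightarrow> a \<in> mons c n \<and> a + b \<in> exps (I n)" for a
    unfolding colon_eq[where I = I, OF assms] by auto
  then show ?thesis by (auto simp: exps_def[of "colon_chain c I (xmon b) n"])
qed

lemma has_exps_colon:
  fixes I :: "nat \<Rightarrow> ('k::field) pol set"
  assumes "has_exps c n (I n)"
  shows "has_exps c n (colon_chain c I (xmon b) n)"
proof -
  have id: "ideal (I n) (Rn c n)" using assms by (simp add: has_exps_def)
  have "ideal (colon_chain c I (xmon b) n) (Rn c n)"
    unfolding colon_eq[where I = I, OF assms]
  proof (rule ideal_of_upset)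
    fix a d assume a: "a \<in> {a \<in> mons c n. a + b \<in> exps (I n)}" and d: "d \<in> mons c n"
    have "a + b \<in> mons c n" using a exps_ideal(1)[OF id] by blast
    then have m: "d + a + b \<in> mons c n" using d by (simp add: mons_add)
    have "le_mon (a + b) (d + a + b)" by (auto simp: le_mon_iff_add algebra_simps)
    then have "d + a + b \<in> exps (I n)" using exps_ideal(2)[OF id] a m by blast
    with m show "d + a \<in> {a \<in> mons c n. a + b \<in> exps (I n)}" by (simp add: mons_add)
  qed
  moreover have "Poly_Mapping.keys f \<subseteq> exps (colon_chain c I (xmon b) n)" if "f \<in> colon_chain c I (xmon b) n" for f
    using that unfolding exps_colon[where I = I, OF assms] unfolding colon_eq[where I = I, OF assms] by simp
  ultimately show ?thesis by (simp add: has_exps_def)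
qed

text \<open>Maps in \<open>Inc i\<close> fix \<open>b\<close>, which lives in the first
  \<open>i\<close> columns, so the shift of \<open>a + b\<close> is the shift of \<open>a\<close>
  plus \<open>b\<close>.\<close>

lemma Inc_invariant_colon:
  fixes I :: "nat \<Rightarrow> ('k::field) pol set"
  assumes chain: "Inc_invariant_chain c i I" and I: "\<And>n. 1 \<le> n \<Longrightarrow> has_exps c n (I n)"
    and b: "\<And>x. x \<in> Poly_Mapping.keys b \<Longrightarrow> snd x \<in> {1..i}"
  shows "Inc_invariant_chain c i (colon_chain c I (xmon b))"
  unfolding Inc_invariant_chain_def
proof (intro conjI allI impI)
  fix n :: nat assume "1 \<le> n"
  then show "ideal (colon_chain c I (xmon b) n) (Rn c n)"
    using has_exps_colon[where I = I, OF I[of n]] by (simp add: has_exps_def)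
next
  fix m n f \<pi>
  assume h: "1 \<le> m \<and> m \<le> n \<and> f \<in> colon_chain c I (xmon b) m \<and> \<pi> \<in> Inc_mn i m n"
  then have n: "1 \<le> n" and PI: "\<pi> \<in> Inc i" by (auto simp: Inc_mn_def)
  have "shift \<pi> a \<in> mons c n \<and> shift \<pi> a + b \<in> exps (I n)" if "a \<in> Poly_Mapping.keys f" for a
  proof -
    have a: "a \<in> mons c m" "a + b \<in> exps (I m)" using h that colon_eq[where I = I, OF I, of m] by auto
    have "shift \<pi> (a + b) \<in> exps (I n)" using chain_shift[OF chain I, of m n "a + b" \<pi>] h a by blast
    moreover have "shift \<pi> b = b" using b IncD(3)[OF PI] by (intro shift_fixed) auto
    ultimately have "shift \<pi> a + b \<in> exps (I n)" by (simp add: shift_add)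
    moreover from this have "shift \<pi> a + b \<in> mons c n"
      using exps_ideal(1)[of "I n" c n] I[OF n] by (auto simp: has_exps_def)
    ultimately show ?thesis by (simp add: mons_add)
  qed
  then have "Poly_Mapping.keys (act \<pi> f) \<subseteq> {a \<in> mons c n. a + b \<in> exps (I n)}"
    using keys_act[of \<pi> f] by blast
  then show "act \<pi> f \<in> colon_chain c I (xmon b) n"
    unfolding colon_eq[where I = I, OF I[OF n]] by (auto simp: Rn_set_eq)
qed

text \<open>A shift preserves rows, so rows that cover a monomial cover every multiple of its
  shifts. If such a multiple lies beyond column \<open>i\<close>, the monomial did too, because
  smaller columns are fixed. The covers are thus the same at all stable levels, and the
  \<open>THE\<close> in \<open>gamma_chain\<close> has a value.\<close>

lemma gamma_chain_eq:
  fixes J :: "nat \<Rightarrow> ('k::field) pol set"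
  assumes chain: "Inc_invariant_chain c i J" and J: "\<And>n. 1 \<le> n \<Longrightarrow> has_exps c n (J n)"
    and proper: "\<And>n. 1 \<le> n \<Longrightarrow> 0 \<notin> exps (J n)" and n: "Inc_ind c i J \<le> n"
  shows "gamma_chain c i J = gamma c n i (J n)"
proof -
  let ?t = "Inc_ind c i J"
  have t: "1 \<le> ?t" "?t \<le> n \<Longrightarrow> exps (J n) \<subseteq> Inc_span i ?t n (exps (J ?t))" for n
    using Inc_ind_stable[OF chain J] by blast+
  have eq: "gamma c n i (J n) = gamma c ?t i (J ?t)" if n: "?t \<le> n" for n
  proof -
    have n1: "1 \<le> n" using t(1) n by linarith
    have "i_cover c n i (J n) C \<longleftrightarrow> i_cover c ?t i (J ?t) C" for C
      unfolding i_cover_iff[OF J[OF n1] proper[OF n1]] i_cover_iff[OF J[OF t(1)] proper[OF t(1)]]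
    proof (rule conj_cong, rule refl, intro iffI ballI impI)
      fix a assume "\<forall>a\<in>exps (J n). (\<forall>x\<in>Poly_Mapping.keys a. i < snd x) \<longrightarrow> (\<exists>x\<in>Poly_Mapping.keys a. fst x \<in> C)"
        "a \<in> exps (J ?t)" "\<forall>x\<in>Poly_Mapping.keys a. i < snd x"
      then show "\<exists>x\<in>Poly_Mapping.keys a. fst x \<in> C"
        using chain_exps_mono[OF chain J t(1) n] by blast
    next
      fix a assume C: "\<forall>a\<in>exps (J ?t). (\<forall>x\<in>Poly_Mapping.keys a. i < snd x) \<longrightarrow> (\<exists>x\<in>Poly_Mapping.keys a. fst x \<in> C)"
        and a: "a \<in> exps (J n)" "\<forall>x\<in>Poly_Mapping.keys a. i < snd x"
      obtain \<pi> d where d: "\<pi> \<in> Inc_mn i ?t n" "d \<in> exps (J ?t)" "le_mon (shift \<pi> d) a"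
        using t(2)[OF n] a(1) by (auto simp: Inc_span_def)
      have PI: "\<pi> \<in> Inc i" using d(1) by (simp add: Inc_mn_def)
      have ks: "(fst x, \<pi> (snd x)) \<in> Poly_Mapping.keys a" if "x \<in> Poly_Mapping.keys d" for x
        using le_mon_keys[OF d(3)] that by (auto simp: keys_shift)
      have "i < snd x" if x: "x \<in> Poly_Mapping.keys d" for x
      proof (rule ccontr)
        assume "\<not> i < snd x"
        moreover have "d \<in> mons c ?t" using d(2) chain_exps_mons[OF chain J t(1)] by blast
        then have "1 \<le> snd x" using x by (auto simp: mons_def)
        ultimately have "\<pi> (snd x) = snd x" using IncD(3)[OF PI] by simp
        then show False using a(2) ks[OF x] \<open>\<not> i < snd x\<close> by auto
      qed
      then obtain x where "x \<in> Poly_Mapping.keys d" "fst x \<in> C" using C d(2) by blast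
      with ks show "\<exists>x\<in>Poly_Mapping.keys a. fst x \<in> C"
        by (intro bexI[of _ "(fst x, \<pi> (snd x))"]) auto
    qed
    then show ?thesis
      by (simp add: gamma_eq(1)[OF J[OF n1] proper[OF n1]] gamma_eq(1)[OF J[OF t(1)] proper[OF t(1)]])
  qed
  have "gamma_chain c i J = gamma c ?t i (J ?t)"
    unfolding gamma_chain_def
  proof (rule the_equality)
    show "\<forall>n\<ge>?t. gamma c n i (J n) = gamma c ?t i (J ?t)" using eq by blast
    show "g = gamma c ?t i (J ?t)" if "\<forall>n\<ge>?t. gamma c n i (J n) = g" for g using that by blast
  qed
  also have "\<dots> = gamma c n i (J n)" using eq[OF n] by (rule sym)
  finally show ?thesis .
qed

section \<open>The monomials v_M\<close>

lemma lower_part_xmon: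
  "\<exists>b. lower_part i (xmon a :: ('k::field) pol) = xmon b \<and>
    Poly_Mapping.keys b \<subseteq> {x \<in> Poly_Mapping.keys a. snd x \<le> i}"
proof -
  define b where "b = (\<Sum>x\<in>{x \<in> Poly_Mapping.keys a. snd x \<le> i}. Poly_Mapping.single x (Poly_Mapping.lookup a x))"
  define d where "d = (\<Sum>x\<in>{x \<in> Poly_Mapping.keys a. \<not> snd x \<le> i}. Poly_Mapping.single x (Poly_Mapping.lookup a x))"
  have lb: "Poly_Mapping.lookup b x = (if snd x \<le> i then Poly_Mapping.lookup a x else 0)" for x
    by (auto simp: b_def lookup_sum lookup_single when_def not_in_keys_iff_lookup_eq_zero)
  have ld: "Poly_Mapping.lookup d x = (if snd x \<le> i then 0 else Poly_Mapping.lookup a x)" for x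
    by (auto simp: d_def lookup_sum lookup_single when_def not_in_keys_iff_lookup_eq_zero)
  have lo: "(xmon e = (1 :: 'k pol) \<or> mon_max (xmon e :: 'k pol) \<le> i) \<longleftrightarrow> (\<forall>x\<in>Poly_Mapping.keys e. snd x \<le> i)" for e
    using mon_max_le_iff[of e, where 'k = 'k] xmon_inject[of e 0, where 'k = 'k] by (cases "e = 0") auto
  have up: "(xmon e = (1 :: 'k pol) \<or> i < mon_min (xmon e :: 'k pol)) \<longleftrightarrow> (\<forall>x\<in>Poly_Mapping.keys e. i < snd x)" for e
    using mon_min_gt_iff[of e, where 'k = 'k] xmon_inject[of e 0, where 'k = 'k] by (cases "e = 0") auto
  have abd: "a = b + d" by (rule poly_mapping_eqI) (simp add: lookup_add lb ld)
  have "lower_part i (xmon a :: 'k pol) = xmon b"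
    unfolding lower_part_def
  proof (rule the_equality, intro conjI)
    show "xmon b \<in> (monomials :: 'k pol set)" by (simp add: monomials_eq)
    show "xmon b = (1 :: 'k pol) \<or> mon_max (xmon b :: 'k pol) \<le> i"
      unfolding lo by (auto simp: in_keys_iff lb split: if_splits)
    show "\<exists>u2\<in>monomials. (u2 = 1 \<or> i < mon_min u2) \<and> (xmon a :: 'k pol) = xmon b * u2"
    proof (intro bexI conjI)
      show "xmon d = (1 :: 'k pol) \<or> i < mon_min (xmon d :: 'k pol)"
        unfolding up by (auto simp: in_keys_iff ld split: if_splits)
    qed (simp_all add: monomials_eq abd mult_single)
  next
    fix u1 :: "'k pol"
    assume "u1 \<in> monomials \<and> (u1 = 1 \<or> mon_max u1 \<le> i) \<and>
      (\<exists>u2\<in>monomials. (u2 = 1 \<or> i < mon_min u2) \<and> xmon a = u1 * u2)"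
    then obtain p q where pq: "u1 = xmon p" "\<forall>x\<in>Poly_Mapping.keys p. snd x \<le> i"
      "\<forall>x\<in>Poly_Mapping.keys q. i < snd x" "(xmon a :: 'k pol) = xmon p * xmon q"
      unfolding monomials_eq by (auto simp flip: lo up)
    then have apq: "a = p + q" by (simp add: xmon_mult)
    have "p = b"
    proof (rule poly_mapping_eqI)
      fix x
      show "Poly_Mapping.lookup p x = Poly_Mapping.lookup b x"
      proof (cases "snd x \<le> i")
        case True
        then have "x \<notin> Poly_Mapping.keys q" using pq(3) by auto
        with True show ?thesis by (simp add: lb apq lookup_add in_keys_iff)
      next
        case False
        then have "x \<notin> Poly_Mapping.keys p" using pq(2) by auto
        with False show ?thesis by (simp add: lb in_keys_iff)
      qed
    qed
    with pq show "u1 = xmon b" by simp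
  qed
  moreover have "Poly_Mapping.keys b \<subseteq> {x \<in> Poly_Mapping.keys a. snd x \<le> i}"
    by (auto simp: in_keys_iff lb split: if_splits)
  ultimately show ?thesis by blast
qed

text \<open>An infinite product is 1 by convention, which is \<open>xmon 0\<close> and satisfies the
  claim; so the induction covers arbitrary sets.\<close>

lemma v_prod_xmon:
  fixes M :: "('k::field) pol set"
  assumes "\<And>u. u \<in> M \<Longrightarrow> \<exists>a\<in>mons c r. u = xmon a"
  shows "\<exists>b\<in>mons c r. v_prod i M = xmon b \<and> (\<forall>x\<in>Poly_Mapping.keys b. snd x \<le> i)"
  using assms unfolding v_prod_def
proof (induction M rule: infinite_finite_induct)
  case (insert u M)
  then obtain b where b: "b \<in> mons c r" "(\<Prod>u\<in>M. lower_part i u) = xmon b"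
    "\<forall>x\<in>Poly_Mapping.keys b. snd x \<le> i" by auto
  obtain a where a: "a \<in> mons c r" "u = xmon a" using insert.prems by blast
  obtain d where d: "lower_part i u = xmon d" "Poly_Mapping.keys d \<subseteq> {x \<in> Poly_Mapping.keys a. snd x \<le> i}"
    using lower_part_xmon a(2) by blast
  have "d + b \<in> mons c r" using a b d unfolding mons_add by (auto simp: mons_def)
  moreover have "(\<Prod>u\<in>insert u M. lower_part i u) = xmon (d + b)"
    using insert.hyps b d by (simp add: xmon_mult)
  moreover have "\<forall>x\<in>Poly_Mapping.keys (d + b). snd x \<le> i"
    using b d by (auto simp: keys_add_mon)
  ultimately show ?case by blast
qed (auto intro!: bexI[of _ 0] simp: mons_zero)

section \<open>The bound for a single M\<close>

context
  fixes c i r :: nat and I :: "nat \<Rightarrow> ('k::field) pol set"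
  assumes chain: "Inc_invariant_chain c i I"
    and mon: "\<And>n. n \<ge> 1 \<Longrightarrow> monomial_ideal c n (I n)"
    and proper: "\<And>n. n \<ge> 1 \<Longrightarrow> I n \<subset> carrier (Rn c n)"
    and r: "r \<ge> Inc_ind c i I"
begin

lemma chain_has_exps: "1 \<le> n \<Longrightarrow> has_exps c n (I n)"
  using mon monomial_ideal_has_exps by blast

lemma r_ge_1: "1 \<le> r"
  using Inc_ind_stable(1)[OF chain chain_has_exps] r by simp

lemma zero_notin_chain:
  assumes n: "1 \<le> n"
  shows "0 \<notin> exps (I n)"
proof
  assume z: "0 \<in> exps (I n)"
  have id: "ideal (I n) (Rn c n)" using chain_has_exps[OF n] by (simp add: has_exps_def)
  have "mons c n \<subseteq> exps (I n)"
    using exps_ideal(2)[OF id z] by (auto simp: le_mon_def)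
  then have "Rn_set c n \<subseteq> I n" using ideal_Rn_of_exps[OF id] by (auto simp: Rn_set_eq)
  with proper[OF n] show False by (auto simp: Rn_def)
qed

text \<open>A minimal generator of \<open>I r\<close> dividing \<open>v\<close> would use only the
  first \<open>i\<close> columns and thus belong to \<open>gens_neg\<close>, which the family
  excludes. If \<open>v\<close> were in some \<open>I n\<close>, a shift of a monomial
  \<open>d\<close> from the stable level would divide it. The shifted columns are then at most
  \<open>i\<close>, and increasing maps never move a column down, so \<open>d\<close> is not moved
  at all and divides \<open>v\<close> within \<open>I r\<close>.\<close>

lemma M_family_xmon:
  assumes M: "M \<in> M_family c i r I"
  shows "\<exists>b\<in>mons c r. v_prod i M = xmon b \<and> (\<forall>x\<in>Poly_Mapping.keys b. snd x \<in> {1..i}) \<and>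
    (\<forall>n\<ge>1. b \<notin> exps (I n))"
proof -
  note he = chain_has_exps
  have idr: "ideal (I r) (Rn c r)" using he[OF r_ge_1] by (simp add: has_exps_def)
  have "\<exists>a\<in>mons c r. u = xmon a" if "u \<in> M" for u
  proof -
    have "u \<in> min_gens c r (I r)" using that M by (auto simp: M_family_def gens_mid_def)
    then obtain a where "a \<in> exps (I r)" "u = xmon a"
      unfolding min_gens_eq[OF he[OF r_ge_1]] by (auto simp: min_exps_def)
    then show ?thesis using exps_ideal(1)[OF idr] by blast
  qed
  then obtain b where b: "b \<in> mons c r" "v_prod i M = xmon b" "\<forall>x\<in>Poly_Mapping.keys b. snd x \<le> i"
    using v_prod_xmon[of M c r i] by blast
  have keys: "snd x \<in> {1..i}" if "x \<in> Poly_Mapping.keys b" for x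
    using b that by (auto simp: mons_def)
  have nr: "b \<notin> exps (I r)"
  proof
    assume "b \<in> exps (I r)"
    then obtain d where d: "d \<in> min_exps (I r)" "le_mon d b" using min_exps_below by blast
    have "d \<noteq> 0" using d(1) zero_notin_chain[OF r_ge_1] by (auto simp: min_exps_def)
    then have "mon_max (xmon d :: 'k pol) \<le> i"
      using mon_max_le_iff le_mon_keys[OF d(2)] b(3) by blast
    then have "xmon d \<in> gens_neg c r i (I r)"
      using d(1) by (simp add: gens_neg_def min_gens_eq[OF he[OF r_ge_1]])
    moreover have "xmon d dvd v_prod i M" using d(2) by (simp add: b(2) xmon_dvd_iff)
    ultimately show False using M by (auto simp: M_family_def)
  qed
  have "b \<notin> exps (I n)" if n: "1 \<le> n" for n
  proof
    assume bn: "b \<in> exps (I n)"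
    let ?t = "Inc_ind c i I"
    have t: "1 \<le> ?t" "?t \<le> n \<Longrightarrow> exps (I n) \<subseteq> Inc_span i ?t n (exps (I ?t))" for n
      using Inc_ind_stable[OF chain he] by blast+
    define N where "N = max n ?t"
    have "b \<in> exps (I N)" using bn chain_exps_mono[OF chain he n, of N] by (auto simp: N_def)
    then obtain \<pi> d where d: "\<pi> \<in> Inc_mn i ?t N" "d \<in> exps (I ?t)" "le_mon (shift \<pi> d) b"
      using t(2)[of N] by (auto simp: Inc_span_def N_def)
    have PI: "\<pi> \<in> Inc i" using d(1) by (simp add: Inc_mn_def)
    have "\<pi> (snd x) = snd x" if x: "x \<in> Poly_Mapping.keys d" for x
    proof -
      have "\<pi> (snd x) \<le> i" using le_mon_keys[OF d(3)] x keys by (force simp: keys_shift)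
      moreover have "d \<in> mons c ?t" using d(2) chain_exps_mons[OF chain he t(1)] by blast
      then have s: "1 \<le> snd x" using x by (auto simp: mons_def)
      moreover have "snd x \<le> \<pi> (snd x)" using Inc_ge[OF PI s] .
      ultimately show ?thesis using IncD(3)[OF PI] by simp
    qed
    then have "shift \<pi> d = d" by (rule shift_fixed)
    moreover have "d \<in> exps (I r)" using d(2) chain_exps_mono[OF chain he t(1) r] by blast
    ultimately have "b \<in> exps (I r)" using exps_ideal(2)[OF idr] d(3) b(1) by metis
    with nr show False by simp
  qed
  with b keys show ?thesis by blast
qed

lemma proj_dim_chain_ge:
  assumes M: "M \<in> M_family c i r I"
  shows "\<exists>g (D :: int). gamma_chain c i (colon_chain c I (v_prod i M)) = enat g \<and> g \<le> c \<and>
    (\<forall>\<^sub>F n in sequentially. ereal (real g * real n + real_of_int D) \<le>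
      proj_dim (Rn c n) (ideal_mod (Rn c n) (I n)))"
proof -
  note he = chain_has_exps
  obtain b where b: "b \<in> mons c r" "v_prod i M = xmon b"
    "\<And>x. x \<in> Poly_Mapping.keys b \<Longrightarrow> snd x \<in> {1..i}" "\<And>n. 1 \<le> n \<Longrightarrow> b \<notin> exps (I n)"
    using M_family_xmon[OF M] by blast
  define J where "J = colon_chain c I (xmon b)"
  have Jc: "Inc_invariant_chain c i J"
    unfolding J_def by (rule Inc_invariant_colon[OF chain he b(3)])
  have Je: "has_exps c n (J n)" if "1 \<le> n" for n unfolding J_def using has_exps_colon[where I = I, OF he[OF that]] .
  have eJ: "exps (J n) = {a \<in> mons c n. a + b \<in> exps (I n)}" if "1 \<le> n" for n
    unfolding J_def using exps_colon[where I = I, OF he[OF that]] .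
  have Jp: "0 \<notin> exps (J n)" if "1 \<le> n" for n using b(4)[OF that] eJ[OF that] by simp
  \<comment> \<open>The level \<open>m\<close> has to contain \<open>v\<close>, which lies in the
    ring of level \<open>r\<close>, and to be past the stability index of the colon chain, where
    \<gamma> can be read off.\<close>
  define m where "m = max r (Inc_ind c i J)"
  have m: "1 \<le> m" "r \<le> m" "Inc_ind c i J \<le> m" using r_ge_1 by (auto simp: m_def)
  define g where "g = Min {card C | C. i_cover c m i (J m) C}"
  have gc: "gamma_chain c i J = enat g"
    using gamma_chain_eq[OF Jc Je Jp m(3)] gamma_eq(1)[OF Je[OF m(1)] Jp[OF m(1)]] by (simp add: g_def)
  note cov = gamma_eq(2)[where i = i, OF Je[OF m(1)] Jp[OF m(1)], folded g_def]
  \<comment> \<open>A monomial avoiding all rows is 1, which is not in a proper ideal. The bound is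
    recorded because it makes the set of covering numbers finite.\<close>
  have "g \<le> c"
  proof (rule ccontr)
    assume "\<not> g \<le> c"
    then obtain a where a: "a \<in> exps (J m)" "\<forall>x\<in>Poly_Mapping.keys a. fst x \<notin> {1..c}"
      using cov[of "{1..c}"] by auto
    have "a \<in> mons c m" using a(1) eJ[OF m(1)] by blast
    with a(2) have "Poly_Mapping.keys a = {}" by (fastforce simp: mons_def)
    then have "a = 0" by (metis poly_expand sum.empty)
    with a(1) Jp[OF m(1)] show False by simp
  qed
  \<comment> \<open>The constant accounts for at most \<open>g\<close> variables lost in each of
    \<open>2 ^ c * m\<close> columns, and for the 1 between the number of variables in
    \<open>A\<close> and the projective dimension of the ideal.\<close>
  have "ereal (real g * real n + real_of_int (- int (g * (2 ^ c * m)) - 1)) \<le>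
      proj_dim (Rn c n) (ideal_mod (Rn c n) (I n))" if n: "m \<le> n" for n
  proof -
    have n1: "1 \<le> n" using m n by simp
    have bm: "b \<in> mons c m" using b(1) mons_mono[OF m(2)] by blast
    have "\<exists>w\<in>mons c n. w \<notin> exps (I n) \<and> (\<exists>A \<subseteq> {1..c} \<times> {1..n}.
      (\<forall>y\<in>A. w + Poly_Mapping.single y 1 \<in> exps (I n)) \<and> g * n \<le> card A + g * (2 ^ c * m))"
    proof (rule exists_large_socle[OF chain he m(1) b(3) bm _ n b(4)[OF n1]])
      fix T assume "T \<subseteq> {1..c}" "card T < g"
      from cov[OF this] show "\<exists>a\<in>mons c m. a + b \<in> exps (I m) \<and>
        (\<forall>x\<in>Poly_Mapping.keys a. i < snd x) \<and> (\<forall>x\<in>Poly_Mapping.keys a. fst x \<notin> T)"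
        using eJ[OF m(1)] by auto
    qed
    then obtain w A where w: "w \<in> mons c n" "w \<notin> exps (I n)" and A: "A \<subseteq> {1..c} \<times> {1..n}"
      "\<And>y. y \<in> A \<Longrightarrow> w + Poly_Mapping.single y 1 \<in> exps (I n)" "g * n \<le> card A + g * (2 ^ c * m)"
      by blast
    have id: "ideal (I n) (Rn c n)" using he[OF n1] by (simp add: has_exps_def)
    have "real (g * n) \<le> real (card A + g * (2 ^ c * m))" using A(3) by (rule of_nat_mono)
    then have "real g * real n + real_of_int (- int (g * (2 ^ c * m)) - 1) \<le> real (card A) - 1" by simp
    then have "ereal (real g * real n + real_of_int (- int (g * (2 ^ c * m)) - 1)) \<le> ereal (real (card A) - 1)"
      by (simp only: ereal_less_eq)
    also have "\<dots> \<le> proj_dim (Rn c n) (ideal_mod (Rn c n) (I n))"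
      by (rule proj_dim_monomial_ideal_ge[OF id w A(1,2)])
    finally show ?thesis .
  qed
  then have "\<forall>\<^sub>F n in sequentially. ereal (real g * real n + real_of_int (- int (g * (2 ^ c * m)) - 1)) \<le>
      proj_dim (Rn c n) (ideal_mod (Rn c n) (I n))"
    unfolding eventually_sequentially by blast
  with gc \<open>g \<le> c\<close> show ?thesis unfolding J_def b(2) by blast
qed

text \<open>This keeps the maximum in the final statement from ranging over the empty set: the empty
  product 1 is divisible by no generator of a proper ideal.\<close>

lemma empty_in_M_family: "{} \<in> M_family c i r I"
proof -
  note he = chain_has_exps[OF r_ge_1]
  have "\<not> u dvd 1" if u: "u \<in> gens_neg c r i (I r)" for u :: "'k pol"
  proof
    assume "u dvd 1"
    obtain d where d: "d \<in> min_exps (I r)" "u = xmon d"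
      using u unfolding gens_neg_def min_gens_eq[OF he] by blast
    have "(xmon d :: 'k pol) dvd xmon 0" using \<open>u dvd 1\<close> d(2) by simp
    then have "le_mon d 0" by (simp only: xmon_dvd_iff)
    then have "d = 0" using le_monD[of d 0] by (intro poly_mapping_eqI) simp
    then show False using d(1) zero_notin_chain[OF r_ge_1] by (simp add: min_exps_def)
  qed
  then show ?thesis by (auto simp: M_family_def v_prod_def)
qed

end

theorem theorem4p10:
  fixes c i r :: nat and I :: "nat \<Rightarrow> ('k::field) pol set"
  assumes "c \<ge> 1"
    and "Inc_invariant_chain c i I"
    and "\<And>n. n \<ge> 1 \<Longrightarrow> monomial_ideal c n (I n)"
    and "\<And>n. n \<ge> 1 \<Longrightarrow> I n \<subset> carrier (Rn c n)"
    and "r \<ge> Inc_ind c i I"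
  shows "\<exists>D::int. \<forall>\<^sub>F n in sequentially.
    proj_dim (Rn c n) (ideal_mod (Rn c n) (I n)) \<ge>
      ereal_of_enat (Max {gamma_chain c i (colon_chain c I (v_prod i M)) | M. M \<in> M_family c i r I})
        * ereal (real n) + ereal (real_of_int D)"
proof -
  let ?G = "{gamma_chain c i (colon_chain c I (v_prod i M)) | M. M \<in> M_family c i r I}"
  have ge: "\<exists>g (D :: int). gamma_chain c i (colon_chain c I (v_prod i M)) = enat g \<and> g \<le> c \<and>
      (\<forall>\<^sub>F n in sequentially. ereal (real g * real n + real_of_int D) \<le>
        proj_dim (Rn c n) (ideal_mod (Rn c n) (I n)))" if "M \<in> M_family c i r I" for M
    using proj_dim_chain_ge[OF assms(2-5) that] by blast
  \<comment> \<open>Finiteness and non-emptiness make \<open>Max\<close> the value of one particular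
    \<open>M\<close>, so the bound for that \<open>M\<close> gives the constant.\<close>
  have "?G \<subseteq> enat ` {..c}" using ge by force
  then have fin: "finite ?G" by (rule finite_subset) simp
  have "?G \<noteq> {}" using empty_in_M_family[OF assms(2-5)] by blast
  with fin have "Max ?G \<in> ?G" by (rule Max_in)
  then obtain M where M: "M \<in> M_family c i r I"
    "Max ?G = gamma_chain c i (colon_chain c I (v_prod i M))" by blast
  obtain g and D :: int where g: "gamma_chain c i (colon_chain c I (v_prod i M)) = enat g"
    and D: "\<forall>\<^sub>F n in sequentially. ereal (real g * real n + real_of_int D) \<le>
      proj_dim (Rn c n) (ideal_mod (Rn c n) (I n))"
    using ge[OF M(1)] by blast
  show ?thesis unfolding M(2) g using D by (intro exI[of _ D]) simp
qed

end
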